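(* Let $X_1,X_2,\dots$ be i.i.d. real random variables with mean $u$ and variance $\sigma^2\in(0,\infty)$. Let $\varphi:\mathbb{R}\to\mathbb{R}$ be continuous and non-decreasing with $$-\log(1-x+x^2/2)\le \varphi(x)\le \log(1+x+x^2/2)\qquad\text{for all }x\in\mathbb{R}.$$ Let $\alpha_n=a_n\sigma^{-1}$ with $a_n>0$, and suppose there is a constant $0\le C_0<\infty$ with $\limsup_{n\to\infty}\sqrt n\,a_n\le C_0$. Let $\hat\theta$ be a solution of $\sum_{i=1}^n\varphi[\alpha_n(X_i-\theta)]=0$ and let $u_n$ be any solution of $\mathbb{E}\{\varphi[\alpha_n(X_1-x)]\}=0$ in $x$. Suppose there exist $t_0>0$ and $C_1>0$ such that $\mathbb{E}e^{t_0\sqrt{|X_1|}}<C_1<\infty$. Then there exist two positive constants $c_0$ and $C$ depending on $t_0$, $C_0$ and $C_1$ such that $$\Big|\frac{\mathbb{P}\big(\sqrt n(\hat\theta-u_n)/\sigma>z\big)}{1-\Phi(z)}-1\Big|\le C(1+z^3)n^{-1/2}$$ for $0\le z\le c_0n^{1/6}$.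
   Context: $\Phi$ denotes the standard normal distribution function. $\hat\theta=\hat\theta_n$ depends on $n$ and on $X_1,\dots,X_n$ (Catoni's estimator of the mean); $u_n$ is deterministic. The constants $c_0$, $C$ do not depend on $n$ or $z$.
   Formalization: Constants depending only on t0, C0, C1 are impossible (Bernoulli(p), p→0; limsup leaves finitely many a_n free): c0, C may also depend on σ, and for n below some n0 depending on (a_n) another constant C' replaces C; formally also per sample-space type. *)

theory Defs
  imports "HOL-Probability.Probability"
begin

definition catoni_influence :: "(real \<Rightarrow> real) \<Rightarrow> bool" where
  "catoni_influence \<phi> \<longleftrightarrow>
     continuous_on UNIV \<phi> \<and> mono \<phi> \<and>
     (\<forall>x. - ln (1 - x + x\<^sup>2 / 2) \<le> \<phi> x \<and> \<phi> x \<le> ln (1 + x + x\<^sup>2 / 2))"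

text \<open>
  The estimator is a statistic: \<open>T n\<close> is a measurable function on samples of size \<open>n\<close>
  (indexed by \<open>{1..n}\<close>), and \<open>theta_hat n\<close> is its value at the observed sample.  The zero
  defining it need not be unique, since \<open>\<phi>\<close> may have flat pieces; \<open>T n\<close> is an arbitrary
  measurable choice of a zero, and \<open>un n\<close> is an arbitrary zero of the population equation.
\<close>

definition theta_hat ::
  "(nat \<Rightarrow> 'a \<Rightarrow> real) \<Rightarrow> (nat \<Rightarrow> (nat \<Rightarrow> real) \<Rightarrow> real) \<Rightarrow> nat \<Rightarrow> 'a \<Rightarrow> real" where
  "theta_hat X T n \<omega> = T n (\<lambda>i\<in>{1..n}. X i \<omega>)"

locale catoni_setting = prob_space M
  for M :: "'a measure" +
  fixes X :: "nat \<Rightarrow> 'a \<Rightarrow> real"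
    and u \<sigma> :: real
    and \<phi> :: "real \<Rightarrow> real"
    and \<alpha> :: "nat \<Rightarrow> real"
    and T :: "nat \<Rightarrow> (nat \<Rightarrow> real) \<Rightarrow> real"
    and un :: "nat \<Rightarrow> real"
  assumes indep: "indep_vars (\<lambda>_. borel) X {1..}"
    and ident: "\<And>i. i \<ge> 1 \<Longrightarrow> distr M borel (X i) = distr M borel (X 1)"
    and mean_integrable: "integrable M (X 1)"
    and mean: "expectation (X 1) = u"
    and square_integrable: "integrable M (\<lambda>\<omega>. (X 1 \<omega>)\<^sup>2)"
    and variance: "variance (X 1) = \<sigma>\<^sup>2"
    and sd_pos: "0 < \<sigma>"
    and influence: "catoni_influence \<phi>"
    and statistic: "\<And>n. n \<ge> 1 \<Longrightarrow> T n \<in> borel_measurable (\<Pi>\<^sub>M i\<in>{1..n}. borel)"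
    and sample_zero: "\<And>n \<omega>. n \<ge> 1 \<Longrightarrow> \<omega> \<in> space M \<Longrightarrow>
           (\<Sum>i = 1..n. \<phi> (\<alpha> n * (X i \<omega> - theta_hat X T n \<omega>))) = 0"
    and population_zero: "\<And>n. n \<ge> 1 \<Longrightarrow> expectation (\<lambda>\<omega>. \<phi> (\<alpha> n * (X 1 \<omega> - un n))) = 0"

abbreviation std_normal_cdf :: "real \<Rightarrow> real" where
  "std_normal_cdf \<equiv> cdf std_normal_distribution"

end

theory Submission
  imports Defs
begin

text \<open>
  Put \<open>\<theta> = un n + z \<sigma> / sqrt n\<close>.  Since \<open>\<phi>\<close> is monotone, the event \<open>\<theta> < theta_hat\<close> lies between the events that
  \<open>\<Sum> \<phi> (\<alpha> (X i - \<theta>))\<close> is positive and that it is nonnegative.  So the claim concerns the tail at \<open>0\<close> of a sum of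
  \<open>n\<close> independent copies of \<open>Y = \<phi> (\<alpha> (X 1 - \<theta>)) / a\<close>.  The two logarithms that enclose \<open>\<phi>\<close> agree with the
  identity to second order, so \<open>\<bar>\<phi> x - x\<bar> \<le> 8 \<bar>x\<bar>^3\<close>; with \<open>a = O(n^(-1/2))\<close> this makes \<open>Y\<close> a small
  perturbation of \<open>(X 1 - \<theta>) / \<sigma>\<close>.  The equation for \<open>un n\<close> then gives \<open>E Y = - z / sqrt n + O(1/n)\<close>, and
  \<open>E Y^2 = 1 + O((1 + z) / sqrt n)\<close>, while \<open>Y\<close> inherits an exponential moment of \<open>sqrt \<bar>Y\<bar>\<close> from \<open>X 1\<close>
  (\<open>influence_row_moments\<close>).

  What remains is a moderate deviation theorem for such rows (\<open>row_moderate_deviation\<close>), proved by Cramer's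
  method.  The variables are truncated at \<open>n^(2/3)\<close>: below this level, and for \<open>h = z / sqrt n \<le> c0 n^(-1/3)\<close> with
  small \<open>c0\<close>, the weight \<open>exp (h \<bar>y\<bar>)\<close> is dominated by \<open>exp (t sqrt \<bar>y\<bar> / 2)\<close>, and the discarded probability
  \<open>n exp (- t n^(1/3))\<close> is negligible against the normal tail at \<open>z \<le> c0 n^(1/6)\<close>.  Reweighting each variable by
  \<open>exp (h y)\<close> removes the drift \<open>- z / sqrt n\<close>: under the new law the sum is almost centred, and the original tail
  is \<open>mgf^n\<close> times the integral of \<open>exp (- h s)\<close> over \<open>s > 0\<close>.  Berry-Esseen allows a normal law to be inserted
  in this integral (\<open>tilted_tail_approximation\<close>).  After the change of measure the error is relative to the tail
  and no longer absolute.  Taylor expansion of the exponential moments evaluates the result as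
  \<open>(1 - \<Phi> z) (1 + O((1 + z^3) / sqrt n))\<close> (\<open>cramer_unit_variance_bound\<close>).

  The Berry-Esseen theorem is proved by Esseen's smoothing: adding independent noise whose characteristic
  function has compact support reduces Levy's inversion formula to a finite interval, on which the
  characteristic function of a standardized sum is close to the Gaussian one.  Noise with the Fejer density
  \<open>(1 - cos x) / (pi x^2)\<close> has this property.

  Only finitely many \<open>n\<close> are not covered by this argument, and for those the bound with its own constant is
  trivial.
\<close>

section \<open>Elementary estimates\<close>

lemma abs_power_le_one_plus_cube:
  fixes y :: real
  assumes "k \<le> 3"
  shows "\<bar>y\<bar> ^ k \<le> 1 + \<bar>y\<bar> ^ 3"
proof (cases "\<bar>y\<bar> \<le> 1")
  case True
  then have "\<bar>y\<bar> ^ k \<le> 1" by (intro power_le_one) auto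
  then show ?thesis by (intro add_increasing2) auto
next
  case False
  then have "\<bar>y\<bar> ^ k \<le> \<bar>y\<bar> ^ 3" using assms by (intro power_increasing) auto
  then show ?thesis by simp
qed

lemma abs_diff_cube_le: "\<bar>x - m\<bar> ^ 3 \<le> 4 * \<bar>x\<bar> ^ 3 + 4 * \<bar>m\<bar> ^ 3" for x m :: real
proof -
  define p q where "p = \<bar>x\<bar>" and "q = \<bar>m\<bar>"
  have pq: "0 \<le> p" "0 \<le> q" by (auto simp: p_def q_def)
  have "\<bar>x - m\<bar> ^ 3 \<le> (p + q) ^ 3" unfolding p_def q_def by (intro power_mono) auto
  also have "\<dots> = 4 * p ^ 3 + 4 * q ^ 3 - 3 * (p + q) * (p - q)\<^sup>2"
    by (simp add: power2_eq_square power3_eq_cube algebra_simps)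
  also have "\<dots> \<le> 4 * p ^ 3 + 4 * q ^ 3" using pq by simp
  finally show ?thesis by (simp add: p_def q_def)
qed

lemma exp_Taylor_bound:
  fixes y :: real
  shows "\<bar>exp y - (\<Sum>m<k. y ^ m / fact m)\<bar> \<le> \<bar>y\<bar> ^ k * exp \<bar>y\<bar>"
proof -
  obtain t where t: "\<bar>t\<bar> \<le> \<bar>y\<bar>" "exp y = (\<Sum>m<k. y ^ m / fact m) + exp t / fact k * y ^ k"
    using Maclaurin_exp_le by blast
  have "\<bar>exp y - (\<Sum>m<k. y ^ m / fact m)\<bar> = exp t / fact k * \<bar>y\<bar> ^ k"
    unfolding t(2) by (simp add: abs_mult power_abs)
  also have "\<dots> \<le> exp \<bar>y\<bar> / 1 * \<bar>y\<bar> ^ k"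
    using t(1) by (intro mult_right_mono frac_le) (auto simp: fact_ge_1)
  finally show ?thesis by (simp add: mult.commute)
qed

lemma power_le_exp:
  fixes x c :: real
  assumes "0 \<le> x" "0 < c"
  shows "x ^ k \<le> fact k / c ^ k * exp (c * x)"
proof -
  define y where "y = c * x"
  have y: "0 \<le> y" using assms by (simp add: y_def)
  obtain u where u: "\<bar>u\<bar> \<le> \<bar>y\<bar>" "exp y = (\<Sum>m<Suc k. y ^ m / fact m) + exp u / fact (Suc k) * y ^ Suc k"
    using Maclaurin_exp_le by blast
  have "y ^ k / fact k \<le> (\<Sum>m<Suc k. y ^ m / fact m)"
    by (rule member_le_sum) (use y in auto)
  also have "\<dots> \<le> exp y" unfolding u(2) using y by simp
  finally have "c ^ k * x ^ k \<le> fact k * exp (c * x)"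
    by (simp add: y_def power_mult_distrib field_simps)
  then show ?thesis using assms by (simp add: field_simps)
qed

lemma exp_minus_quadratic: 
  assumes "0 \<le> (x::real)" shows "\<bar>exp (- x) - (1 - x)\<bar> \<le> x\<^sup>2 / 2"
proof -
  have 1: "1 - x \<le> exp (- x)" using exp_ge_add_one_self[of "-x"] by simp
  have "x - x\<^sup>2/2 + exp (-x) \<le> 0 - 0\<^sup>2/2 + exp (-0)"
  proof (rule DERIV_nonpos_imp_nonincreasing[where f="\<lambda>x. x - x\<^sup>2/2 + exp (-x)", OF assms])
    fix y :: real assume "0 \<le> y"
    have "((\<lambda>x. x - x\<^sup>2/2 + exp (-x)) has_real_derivative (1 - y - exp (-y))) (at y)"
      by (auto intro!: derivative_eq_intros)
    moreover have "1 - y - exp (-y) \<le> 0" using exp_ge_add_one_self[of "-y"] by simp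
    ultimately show "\<exists>d. ((\<lambda>x. x - x\<^sup>2/2 + exp (-x)) has_real_derivative d) (at y) \<and> d \<le> 0" by blast
  qed
  then have "exp (-x) \<le> 1 - x + x\<^sup>2/2" by simp
  with 1 show ?thesis by simp
qed

lemma norm_power_diff_le:
  fixes a b :: complex
  assumes "norm a \<le> m" "norm b \<le> m"
  shows "norm (a ^ n - b ^ n) \<le> real n * norm (a - b) * m ^ (n - 1)"
proof (induction n)
  case (Suc n)
  have m: "0 \<le> m" using assms norm_ge_zero order_trans by blast
  have "a ^ Suc n - b ^ Suc n = a * (a ^ n - b ^ n) + (a - b) * b ^ n"
    by (simp add: algebra_simps)
  then have "norm (a ^ Suc n - b ^ Suc n) \<le> norm a * norm (a ^ n - b ^ n) + norm (a - b) * norm b ^ n"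
    by (metis norm_mult norm_power norm_triangle_ineq)
  also have "\<dots> \<le> m * (real n * norm (a - b) * m ^ (n - 1)) + norm (a - b) * m ^ n"
    using assms Suc m by (intro add_mono mult_mono power_mono) auto
  also have "\<dots> = real (Suc n) * norm (a - b) * m ^ (Suc n - 1)"
    by (cases n) (simp_all add: algebra_simps)
  finally show ?case .
qed simp

lemma (in prob_space) integrable_of_third_moment:
  fixes Y :: "'a \<Rightarrow> real"
  assumes [measurable]: "Y \<in> borel_measurable M" and int3: "integrable M (\<lambda>\<omega>. \<bar>Y \<omega>\<bar> ^ 3)"
  shows "integrable M Y" "integrable M (\<lambda>\<omega>. (Y \<omega>)\<^sup>2)"
proof -
  have bd: "\<bar>y\<bar> \<le> 1 + \<bar>y\<bar> ^ 3" "y\<^sup>2 \<le> 1 + \<bar>y\<bar> ^ 3" for y :: real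
    using abs_power_le_one_plus_cube[of 1 y] abs_power_le_one_plus_cube[of 2 y] by auto
  have int1: "integrable M (\<lambda>\<omega>. 1 + \<bar>Y \<omega>\<bar> ^ 3)" using int3 by auto
  show "integrable M Y" "integrable M (\<lambda>\<omega>. (Y \<omega>)\<^sup>2)"
    by (rule Bochner_Integration.integrable_bound[OF int1]; use bd in \<open>auto intro!: order_trans[OF _ abs_ge_self]\<close>)+
qed

lemma (in real_distribution) third_central_moment:
  assumes "integrable M (\<lambda>x. \<bar>x\<bar> ^ 3)"
  shows "integrable M (\<lambda>x. \<bar>x - m\<bar> ^ 3)"
    and "expectation (\<lambda>x. \<bar>x - m\<bar> ^ 3) \<le> 4 * expectation (\<lambda>x. \<bar>x\<bar> ^ 3) + 4 * \<bar>m\<bar> ^ 3"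
proof -
  have int: "integrable M (\<lambda>x. 4 * \<bar>x\<bar> ^ 3 + 4 * \<bar>m\<bar> ^ 3)" using assms by auto
  show int3: "integrable M (\<lambda>x. \<bar>x - m\<bar> ^ 3)"
    by (rule Bochner_Integration.integrable_bound[OF int])
       (use abs_diff_cube_le in \<open>auto simp: abs_of_nonneg intro: order_trans\<close>)
  have "expectation (\<lambda>x. \<bar>x - m\<bar> ^ 3) \<le> expectation (\<lambda>x. 4 * \<bar>x\<bar> ^ 3 + 4 * \<bar>m\<bar> ^ 3)"
    using int int3 abs_diff_cube_le by (intro integral_mono)
  also have "\<dots> = 4 * expectation (\<lambda>x. \<bar>x\<bar> ^ 3) + 4 * \<bar>m\<bar> ^ 3"
    using assms prob_space by simp
  finally show "expectation (\<lambda>x. \<bar>x - m\<bar> ^ 3) \<le> 4 * expectation (\<lambda>x. \<bar>x\<bar> ^ 3) + 4 * \<bar>m\<bar> ^ 3" .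
qed

lemma (in real_distribution) third_moment_ge:
  assumes "integrable M (\<lambda>x. \<bar>x\<bar> ^ 3)" "integrable M (\<lambda>x. x\<^sup>2)" "0 < s"
    and "expectation (\<lambda>x. x\<^sup>2) = s\<^sup>2"
  shows "s ^ 3 \<le> expectation (\<lambda>x. \<bar>x\<bar> ^ 3)"
proof -
  \<comment> \<open>the inequality of the arithmetic and geometric means for \<open>|y|^3, |y|^3, s^3\<close>\<close>
  have "3 * s * y\<^sup>2 \<le> 2 * \<bar>y\<bar> ^ 3 + s ^ 3" for y
  proof -
    have "0 \<le> (\<bar>y\<bar> - s)\<^sup>2 * (2 * \<bar>y\<bar> + s)" using \<open>0 < s\<close> by simp
    also have "\<dots> = 2 * \<bar>y\<bar> ^ 3 + s ^ 3 - 3 * s * \<bar>y\<bar>\<^sup>2"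
      by (simp add: power2_eq_square power3_eq_cube algebra_simps del: abs_mult_self_eq)
    finally show ?thesis by simp
  qed
  then have "expectation (\<lambda>y. 3 * s * y\<^sup>2) \<le> expectation (\<lambda>y. 2 * \<bar>y\<bar> ^ 3 + s ^ 3)"
    using assms by (intro integral_mono) auto
  then show ?thesis
    using assms prob_space by (simp add: power2_eq_square power3_eq_cube)
qed

lemma density_lborel_no_atoms:
  fixes f :: "real \<Rightarrow> ennreal"
  assumes [measurable]: "f \<in> borel_measurable borel"
  shows "measure (density lborel f) {x} = 0"
proof -
  have "emeasure (density lborel f) {x} = (\<integral>\<^sup>+y. f y * indicator {x} y \<partial>lborel)"
    by (subst emeasure_density) auto
  also have "\<dots> = (\<integral>\<^sup>+(y::real). 0 \<partial>lborel)"
  proof (rule nn_integral_cong_AE)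
    show "AE y in lborel. f y * indicator {x} y = 0"
      using AE_lborel_singleton[of x] by eventually_elim simp
  qed
  finally show ?thesis by (simp add: measure_def)
qed

section \<open>The Fejer kernel\<close>

lemma has_bochner_integral_one_minus_cos:
  "has_bochner_integral lborel (\<lambda>x::real. (1 - cos x) / x\<^sup>2) pi"
proof -
  let ?f = "\<lambda>x::real. (1 - cos x) / x\<^sup>2"
  \<comment> \<open>integrate \<open>(1 - cos x) / x^2\<close> by parts: its antiderivative on \<open>x > 0\<close> is \<open>Si x - (1 - cos x) / x\<close>\<close>
  let ?G = "\<lambda>x::real. Si x - (1 - cos x) / x"
  have Gder: "DERIV ?G x :> ?f x" if "0 < ereal x" "ereal x < \<infinity>" for x
    using that DERIV_Si[of x]
    by (auto intro!: derivative_eq_intros simp: field_simps power2_eq_square)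
  have cont: "isCont ?f x" if "0 < ereal x" "ereal x < \<infinity>" for x
    using that by (auto intro!: continuous_intros)
  have lim0: "((?G \<circ> real_of_ereal) \<longlongrightarrow> 0) (at_right 0)"
  proof -
    have "((\<lambda>x. Si x) \<longlongrightarrow> Si 0) (at_right 0)"
      using isCont_Si[of 0] by (simp add: continuous_at_imp_continuous_at_within continuous_within[symmetric])
    moreover have "Si 0 = 0" by (simp add: Si_def zero_ereal_def)
    moreover have "((\<lambda>x::real. (1 - cos x) / x) \<longlongrightarrow> 0) (at_right 0)"
      by real_asymp
    ultimately have "(?G \<longlongrightarrow> 0 - 0) (at_right 0)"
      by (intro tendsto_diff) auto
    then show ?thesis
      by (simp add: zero_ereal_def ereal_tendsto_simps)
  qed
  have liminf: "((?G \<circ> real_of_ereal) \<longlongrightarrow> pi / 2) (at_left \<infinity>)"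
  proof -
    have "((\<lambda>x::real. (1 - cos x) / x) \<longlongrightarrow> 0) at_top"
      by real_asymp
    then have "(?G \<longlongrightarrow> pi / 2 - 0) at_top"
      by (intro tendsto_diff Si_at_top)
    then show ?thesis
      by (simp add: ereal_tendsto_simps)
  qed
  have FTC: "set_integrable lborel (einterval 0 \<infinity>) ?f" "(LBINT x=0..\<infinity>. ?f x) = pi / 2 - 0"
    using interval_integral_FTC_nonneg[of 0 \<infinity> ?G ?f 0 "pi / 2", OF _ Gder cont _ lim0 liminf]
    by auto
  have AEeq: "AE x in lborel. indicator (einterval 0 \<infinity>) x *\<^sub>R ?f x = indicator {0..} x *\<^sub>R ?f x"
    by (intro always_eventually) (auto simp: einterval_def indicator_def)
  have "has_bochner_integral lborel (\<lambda>x. indicator (einterval 0 \<infinity>) x *\<^sub>R ?f x) (pi / 2)"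
    using FTC by (auto simp: has_bochner_integral_iff set_integrable_def interval_lebesgue_integral_def set_lebesgue_integral_def)
  then have "has_bochner_integral lborel (\<lambda>x. indicator {0..} x *\<^sub>R ?f x) (pi / 2)"
    by (rule has_bochner_integral_cong_AE[THEN iffD1, rotated 3]) (use AEeq in auto)
  then have "has_bochner_integral lborel ?f (2 *\<^sub>R (pi / 2))"
    by (rule has_bochner_integral_even_function) (simp_all add: field_simps)
  then show ?thesis by simp
qed

lemma has_bochner_integral_one_minus_cos_scaled:
  "has_bochner_integral lborel (\<lambda>x::real. (1 - cos (a * x)) / x\<^sup>2) (pi * \<bar>a\<bar>)"
proof (cases "a = 0")
  case False
  then have "has_bochner_integral lborel (\<lambda>x::real. (1 - cos (0 + a * x)) / (0 + a * x)\<^sup>2) (pi /\<^sub>R \<bar>a\<bar>)"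
    using lborel_has_bochner_integral_real_affine_iff[of a "\<lambda>x. (1 - cos x) / x\<^sup>2" pi 0]
      has_bochner_integral_one_minus_cos by simp
  from has_bochner_integral_mult_right[OF this, of "a\<^sup>2"]
  show ?thesis
  proof (rule has_bochner_integral_cong[THEN iffD1, rotated 3])
    show "a\<^sup>2 * ((1 - cos (0 + a * x)) / (0 + a * x)\<^sup>2) = (1 - cos (a * x)) / x\<^sup>2" for x
      using False by (simp add: power_mult_distrib)
    have "a\<^sup>2 = \<bar>a\<bar> * \<bar>a\<bar>"
      by (simp add: power2_eq_square)
    then show "a\<^sup>2 * (pi /\<^sub>R \<bar>a\<bar>) = pi * \<bar>a\<bar>"
      using False by (simp only:) (simp add: field_simps del: abs_mult_self_eq)
  qed simp
qed (simp add: has_bochner_integral_zero)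

definition fejer_density :: "real \<Rightarrow> real" where
  "fejer_density x = (1 - cos x) / (pi * x\<^sup>2)"

definition fejer :: "real measure" where
  "fejer = density lborel (\<lambda>x. ennreal (fejer_density x))"

lemma fejer_density_nonneg [simp]: "0 \<le> fejer_density x"
  by (simp add: fejer_density_def)

lemma fejer_density_measurable [measurable]: "fejer_density \<in> borel_measurable borel"
  unfolding fejer_density_def[abs_def] by measurable

lemma has_bochner_integral_fejer_density: "has_bochner_integral lborel fejer_density 1"
  using has_bochner_integral_mult_right[OF has_bochner_integral_one_minus_cos, of "1 / pi"]
  by (simp add: fejer_density_def[abs_def])

lemma real_distribution_fejer: "real_distribution fejer"
proof -
  have "prob_space fejer"
    unfolding fejer_def
    using has_bochner_integral_fejer_density
    by (intro prob_spaceI) (simp add: emeasure_density nn_integral_eq_integral has_bochner_integral_iff)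
  then show ?thesis
    by (auto simp: real_distribution_def real_distribution_axioms_def fejer_def)
qed

text \<open>
  The compact support of this characteristic function is the reason for the choice of the kernel.
\<close>
lemma char_fejer: "char fejer t = of_real (max 0 (1 - \<bar>t\<bar>))"
proof -
  interpret real_distribution fejer by (rule real_distribution_fejer)
  have ig: "integrable fejer (\<lambda>x. iexp (t * x))"
    by (intro integrable_const_bound[of _ 1]) auto
  \<comment> \<open>\<open>(1 - cos x) cos (t x)\<close> is a combination of functions \<open>1 - cos (a x)\<close>\<close>
  have "has_bochner_integral lborel (\<lambda>x::real. (1 - cos ((1 + t) * x)) / x\<^sup>2 + (1 - cos ((1 - t) * x)) / x\<^sup>2
            - 2 * ((1 - cos (t * x)) / x\<^sup>2)) (pi * \<bar>1 + t\<bar> + pi * \<bar>1 - t\<bar> - 2 * (pi * \<bar>t\<bar>))"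
    by (intro has_bochner_integral_diff has_bochner_integral_add has_bochner_integral_mult_right
         has_bochner_integral_one_minus_cos_scaled)
  from has_bochner_integral_mult_right[OF this, of "1 / (2 * pi)"]
  have *: "has_bochner_integral lborel (\<lambda>x. fejer_density x * cos (t * x)) (max 0 (1 - \<bar>t\<bar>))"
  proof (rule has_bochner_integral_cong[THEN iffD1, rotated 3])
    fix x :: real
    show "1 / (2 * pi) * ((1 - cos ((1 + t) * x)) / x\<^sup>2 + (1 - cos ((1 - t) * x)) / x\<^sup>2
            - 2 * ((1 - cos (t * x)) / x\<^sup>2)) = fejer_density x * cos (t * x)"
      by (cases "x = 0") (simp_all add: fejer_density_def field_simps cos_add cos_diff)
    show "1 / (2 * pi) * (pi * \<bar>1 + t\<bar> + pi * \<bar>1 - t\<bar> - 2 * (pi * \<bar>t\<bar>)) = max 0 (1 - \<bar>t\<bar>)"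
      by (auto simp: field_simps max_def abs_if)
  qed simp
  have Re: "Re (char fejer t) = max 0 (1 - \<bar>t\<bar>)"
  proof -
    have "Re (char fejer t) = (\<integral>x. cos (t * x) \<partial>fejer)"
      unfolding char_def using ig by (subst integral_Re[symmetric]) (auto simp: Re_exp)
    also have "\<dots> = (\<integral>x. fejer_density x * cos (t * x) \<partial>lborel)"
      unfolding fejer_def by (subst integral_density) auto
    finally show ?thesis using * by (simp add: has_bochner_integral_iff)
  qed
  have Im: "Im (char fejer t) = 0"
  proof -
    have "Im (char fejer t) = (\<integral>x. sin (t * x) \<partial>fejer)"
      unfolding char_def using ig by (subst integral_Im[symmetric]) (auto simp: Im_exp)
    also have "\<dots> = (\<integral>x. fejer_density x * sin (t * x) \<partial>lborel)" (is "_ = ?I")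
      unfolding fejer_def by (subst integral_density) auto
    finally have 1: "Im (char fejer t) = ?I" .
    have "?I = (\<integral>x. fejer_density (0 + -1 * x) * sin (t * (0 + -1 * x)) \<partial>lborel)"
      by (subst lborel_integral_real_affine[of "-1" _ 0]) auto
    also have "\<dots> = - ?I"
      by (simp add: fejer_density_def)
    finally have "?I = - ?I" .
    with 1 show ?thesis by simp
  qed
  show ?thesis using Re Im by (simp add: complex_eq_iff)
qed

lemma fejer_no_atoms: "measure fejer {x} = 0"
  unfolding fejer_def by (rule density_lborel_no_atoms) simp

lemma fejer_quantile_exists: "\<exists>c>0. 3 / 4 \<le> measure fejer {-c..c}"
proof -
  interpret real_distribution fejer by (rule real_distribution_fejer)
  have "(\<lambda>n. measure fejer {-real n..real n}) \<longlonglongrightarrow> measure fejer (\<Union>n. {-real n..real n})"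
    by (rule finite_Lim_measure_incseq) (auto simp: incseq_def)
  also have "(\<Union>n. {-real n..real n}) = UNIV"
  proof (intro equalityI subsetI)
    fix x :: real
    obtain n :: nat where "\<bar>x\<bar> \<le> real n" using real_arch_simple by blast
    then show "x \<in> (\<Union>n. {-real n..real n})" by (auto intro!: exI[of _ n])
  qed simp
  finally have "(\<lambda>n. measure fejer {-real n..real n}) \<longlonglongrightarrow> 1"
    using prob_space by simp
  then have "eventually (\<lambda>n. 3 / 4 < measure fejer {-real n..real n}) sequentially"
    by (rule order_tendstoD) simp
  then have "eventually (\<lambda>n. 3 / 4 < measure fejer {-real n..real n} \<and> 0 < n) sequentially"
    using eventually_gt_at_top by (rule eventually_conj)
  then obtain n where "3 / 4 < measure fejer {-real n..real n}" "0 < n"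
    using eventually_happens'[OF sequentially_bot] by blast
  then show ?thesis by (intro exI[of _ "real n"]) auto
qed

definition fejer_quantile :: real where
  "fejer_quantile = (SOME c. 0 < c \<and> 3 / 4 \<le> measure fejer {-c..c})"

lemma fejer_quantile: "0 < fejer_quantile" "3 / 4 \<le> measure fejer {-fejer_quantile..fejer_quantile}"
  using someI_ex[OF fejer_quantile_exists] unfolding fejer_quantile_def by auto

section \<open>Convolution and Esseen smoothing\<close>

lemma real_distribution_convolution:
  assumes "real_distribution F" "real_distribution G"
  shows "real_distribution (F \<star> G)"
proof -
  interpret F: real_distribution F by fact
  interpret G: real_distribution G by fact
  interpret FG: pair_prob_space F G ..
  have "prob_space (F \<star> G)"
    unfolding convolution_def by (rule FG.prob_space_distr) measurable
  then show ?thesis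
    by (simp add: real_distribution_def real_distribution_axioms_def)
qed

lemma char_convolution:
  assumes "real_distribution F" "real_distribution G"
  shows "char (F \<star> G) t = char F t * char G t"
proof -
  interpret F: real_distribution F by fact
  interpret G: real_distribution G by fact
  interpret FG: pair_prob_space F G ..
  have "char (F \<star> G) t = (\<integral>p. iexp (t * fst p) * iexp (t * snd p) \<partial>(F \<Otimes>\<^sub>M G))"
    unfolding char_def convolution_def
    by (subst integral_distr) (auto simp: case_prod_beta distrib_left exp_add)
  also have "\<dots> = (\<integral>x. \<integral>y. iexp (t * x) * iexp (t * y) \<partial>G \<partial>F)"
  proof (subst FG.integral_fst'[symmetric])
    show "complex_integrable (F \<Otimes>\<^sub>M G) (\<lambda>p. iexp (t * fst p) * iexp (t * snd p))"
      by (intro FG.integrable_const_bound[of _ 1]) (auto simp: norm_mult)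
  qed simp
  also have "\<dots> = char F t * char G t"
    unfolding char_def by simp
  finally show ?thesis .
qed

lemma convolution_no_atoms:
  assumes "real_distribution F" "real_distribution K" "\<And>x. measure K {x} = 0"
  shows "measure (F \<star> K) {x} = 0"
proof -
  interpret F: real_distribution F by fact
  interpret K: real_distribution K by fact
  have 1: "{a. a + y = x} = {x - y}" for y by auto
  have "emeasure (F \<star> K) {x} = (\<integral>\<^sup>+y. emeasure K {a. a + y \<in> {x}} \<partial>F)"
    by (rule convolution_emeasure) (auto intro: F.finite_measure_axioms K.finite_measure_axioms)
  also have "\<dots> = 0"
    using assms(3) by (simp add: 1 K.emeasure_eq_measure)
  finally show ?thesis by (simp add: measure_def)
qed

lemma (in real_distribution) cdf_measurable [measurable]: "cdf M \<in> borel_measurable borel"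
  by (intro borel_measurable_mono monoI cdf_nondecreasing)

lemma cdf_convolution:
  assumes "real_distribution F" "real_distribution K"
  shows "cdf (F \<star> K) b = (\<integral>v. cdf F (b - v) \<partial>K)"
proof -
  interpret F: real_distribution F by fact
  interpret K: real_distribution K by fact
  have 1: "{a. a + v \<in> {..b}} = {..b - v}" for v :: real by auto
  have "emeasure (F \<star> K) {..b} = emeasure (K \<star> F) {..b}"
    by (subst convolution_commutative)
       (auto intro: F.finite_measure_axioms K.finite_measure_axioms)
  also have "\<dots> = (\<integral>\<^sup>+v. emeasure F {a. a + v \<in> {..b}} \<partial>K)"
    by (rule convolution_emeasure) (auto intro: F.finite_measure_axioms K.finite_measure_axioms)
  also have "\<dots> = (\<integral>\<^sup>+v. ennreal (cdf F (b - v)) \<partial>K)"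
    by (simp only: 1 F.emeasure_eq_measure cdf_def2)
  also have "\<dots> = ennreal (\<integral>v. cdf F (b - v) \<partial>K)"
    by (intro nn_integral_eq_integral K.integrable_const_bound[of _ 1])
       (auto simp: F.cdf_nonneg F.cdf_bounded_prob)
  finally show ?thesis
    by (simp add: cdf_def2 measure_def F.cdf_nonneg)
qed

text \<open>
  Only the difference of the characteristic functions enters, which is small near \<open>0\<close>; for a single one the
  kernel of the inversion formula would not be integrable there uniformly in \<open>a\<close> and \<open>b\<close>.
\<close>
lemma Levy_inversion_difference_bound:
  assumes "real_distribution P" "real_distribution Q"
    and atP: "\<And>x. measure P {x} = 0" and atQ: "\<And>x. measure Q {x} = 0"
    and w: "integrable lborel w" "\<And>t. 0 \<le> w t"
    and close: "\<And>t. cmod (char P t - char Q t) \<le> \<bar>t\<bar> * w t"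
    and "a \<le> b"
  shows "\<bar>measure P {a<..b} - measure Q {a<..b}\<bar> \<le> (\<integral>t. w t \<partial>lborel) / pi"
proof -
  interpret P: real_distribution P by fact
  interpret Q: real_distribution Q by fact
  let ?k = "\<lambda>t::real. (iexp (-(t * a)) - iexp (-(t * b))) / (\<i> * t)"
  define J where "J c n = 1 / (2 * pi) * (CLBINT t=-(real n)..real n. ?k t * c t)" for c :: "real \<Rightarrow> complex" and n
  have lim: "(\<lambda>n. J (char P) n - J (char Q) n) \<longlonglongrightarrow>
      complex_of_real (measure P {a<..b}) - complex_of_real (measure Q {a<..b})"
    unfolding J_def using P.Levy_Inversion[of a b] Q.Levy_Inversion[of a b] atP atQ \<open>a \<le> b\<close>
    by (intro tendsto_diff) auto
  have int: "complex_integrable lborel (\<lambda>t. indicator {-real n<..<real n} t *\<^sub>R (?k t * c t))"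
    if c: "c \<in> borel_measurable borel" "\<And>t. cmod (c t) \<le> 1" for c n
  proof (rule integrableI_bounded_set[where A="{-real n<..<real n}" and B="b - a"])
    show "AE t in lborel. t \<in> {-real n<..<real n} \<longrightarrow>
       cmod (indicator {-real n<..<real n} t *\<^sub>R (?k t * c t)) \<le> b - a"
    proof (rule AE_mp[OF AE_lborel_singleton[of 0]], intro always_eventually allI impI)
      fix t :: real assume "t \<noteq> 0" "t \<in> {-real n<..<real n}"
      have "cmod (?k t) \<le> -a - (-b)"
        using Levy_Inversion_aux2[of "-b" "-a" t] \<open>a \<le> b\<close> \<open>t \<noteq> 0\<close> by simp
      then have "cmod (?k t) * cmod (c t) \<le> (b - a) * 1"
        using c(2)[of t] \<open>a \<le> b\<close> by (intro mult_mono) auto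
      then show "cmod (indicator {-real n<..<real n} t *\<^sub>R (?k t * c t)) \<le> b - a"
        using \<open>t \<in> _\<close> by (simp only: indicator_simps scaleR_one norm_mult mult_1_right)
    qed
    show "emeasure lborel {-real n<..<real n} < \<infinity>"
      by simp
  qed (use c in \<open>auto split: split_indicator\<close>)
  \<comment> \<open>both exponentials in the kernel have modulus \<open>1\<close>, so it is at most \<open>2 / |t|\<close> and the factor \<open>|t|\<close> cancels\<close>
  have bound: "cmod (J (char P) n - J (char Q) n) \<le> (\<integral>t. w t \<partial>lborel) / pi" for n
  proof -
    let ?I = "{-real n<..<real n}"
    have "J (char P) n - J (char Q) n = 1 / (2 * pi) *
      ((\<integral>t. indicator ?I t *\<^sub>R (?k t * char P t) \<partial>lborel) - (\<integral>t. indicator ?I t *\<^sub>R (?k t * char Q t) \<partial>lborel))"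
      unfolding J_def
      by (simp add: interval_lebesgue_integral_def set_lebesgue_integral_def right_diff_distrib)
    also have "(\<integral>t. indicator ?I t *\<^sub>R (?k t * char P t) \<partial>lborel) - (\<integral>t. indicator ?I t *\<^sub>R (?k t * char Q t) \<partial>lborel)
      = (\<integral>t. indicator ?I t *\<^sub>R (?k t * char P t) - indicator ?I t *\<^sub>R (?k t * char Q t) \<partial>lborel)" (is "?X = integral\<^sup>L lborel ?d")
      by (rule Bochner_Integration.integral_diff[symmetric]; rule int)
         (auto intro: P.cmod_char_le_1 Q.cmod_char_le_1)
    finally have eq: "J (char P) n - J (char Q) n = 1 / (2 * pi) * integral\<^sup>L lborel ?d" .
    have "cmod (integral\<^sup>L lborel ?d) \<le> (\<integral>t. 2 * w t \<partial>lborel)"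
    proof (rule Bochner_Integration.integral_norm_bound_integral)
      show "complex_integrable lborel ?d"
        by (intro Bochner_Integration.integrable_diff; rule int) (auto intro: P.cmod_char_le_1 Q.cmod_char_le_1)
      fix t :: real
      have "cmod (?d t) \<le> cmod (?k t * (char P t - char Q t))"
        by (cases "t \<in> ?I") (simp_all only: indicator_simps scaleR_one scaleR_zero_left right_diff_distrib, simp_all)
      also have "\<dots> \<le> 2 * w t"
      proof (cases "t = 0")
        case False
        have "cmod (iexp (-(t * a)) - iexp (-(t * b))) \<le> 1 + 1"
          by (rule order_trans[OF norm_triangle_ineq4]) (simp del: of_real_mult of_real_minus)
        then have "cmod (?k t) \<le> 2 / \<bar>t\<bar>"
          using False by (simp add: norm_divide norm_mult divide_right_mono)
        then have "cmod (?k t) * cmod (char P t - char Q t) \<le> 2 / \<bar>t\<bar> * (\<bar>t\<bar> * w t)"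
          by (intro mult_mono close) auto
        also have "2 / \<bar>t\<bar> * (\<bar>t\<bar> * w t) = 2 * w t" using False by simp
        finally show ?thesis by (simp only: norm_mult)
      qed (simp add: w)
      finally show "cmod (?d t) \<le> 2 * w t" .
    qed (use w in auto)
    then have "cmod (integral\<^sup>L lborel ?d) \<le> 2 * (\<integral>t. w t \<partial>lborel)"
      by simp
    moreover have "cmod (complex_of_real (1 / (2 * pi)) * Z) \<le> L / pi" if "cmod Z \<le> 2 * L" for Z :: complex and L
      using that by (simp add: norm_mult norm_divide field_simps)
    ultimately show ?thesis
      unfolding eq by blast
  qed
  have "cmod (complex_of_real (measure P {a<..b}) - complex_of_real (measure Q {a<..b})) \<le> (\<integral>t. w t \<partial>lborel) / pi"
    by (rule Lim_bounded[OF tendsto_norm[OF lim], of 0]) (use bound in auto)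
  then show ?thesis
    by (metis norm_of_real of_real_diff)
qed

lemma cdf_difference_bound:
  assumes "real_distribution P" "real_distribution Q"
    and "\<And>x. measure P {x} = 0" and "\<And>x. measure Q {x} = 0"
    and "integrable lborel w" "\<And>t. 0 \<le> w t"
    and "\<And>t. cmod (char P t - char Q t) \<le> \<bar>t\<bar> * w t"
  shows "\<bar>cdf P b - cdf Q b\<bar> \<le> (\<integral>t. w t \<partial>lborel) / pi"
proof -
  interpret P: real_distribution P by fact
  interpret Q: real_distribution Q by fact
  have "(\<lambda>n. \<bar>(cdf P b - cdf P (- real n)) - (cdf Q b - cdf Q (- real n))\<bar>) \<longlonglongrightarrow> \<bar>(cdf P b - 0) - (cdf Q b - 0)\<bar>"
    by (intro tendsto_intros P.cdf_lim_neg_infty Q.cdf_lim_neg_infty)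
  moreover obtain N :: nat where N: "-b < real N"
    using reals_Archimedean2 by blast
  have "\<bar>(cdf P b - cdf P (- real n)) - (cdf Q b - cdf Q (- real n))\<bar> \<le> (\<integral>t. w t \<partial>lborel) / pi" if "n \<ge> N" for n
  proof -
    have "- real n < b" using N that by linarith
    then show ?thesis
      using Levy_inversion_difference_bound[OF assms, of "- real n" b]
      by (simp add: P.cdf_diff_eq Q.cdf_diff_eq)
  qed
  ultimately show ?thesis
    using Lim_bounded[of _ "\<bar>(cdf P b - 0) - (cdf Q b - 0)\<bar>" N] by simp
qed

text \<open>
  Smoothing by \<open>K\<close> cannot hide a large discrepancy when \<open>G\<close> is Lipschitz and most of the mass of \<open>K\<close> lies within
  \<open>r\<close> of \<open>0\<close>: at the right translate, most of the average is taken where the discrepancy is still large.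
\<close>
lemma smoothing_inequality:
  assumes "real_distribution F" "real_distribution G" "real_distribution K"
    and Lip: "\<And>x y. x \<le> y \<Longrightarrow> cdf G y - cdf G x \<le> L * (y - x)"
    and r: "0 < r" "3 / 4 \<le> measure K {-r..r}" and "0 \<le> L"
    and E: "\<And>b. \<bar>cdf (F \<star> K) b - cdf (G \<star> K) b\<bar> \<le> E"
  shows "\<bar>cdf F x - cdf G x\<bar> \<le> 2 * E + 3 * L * r"
proof -
  interpret F: real_distribution F by fact
  interpret G: real_distribution G by fact
  interpret K: real_distribution K by fact
  define D where "D x = cdf F x - cdf G x" for x
  have [measurable]: "D \<in> borel_measurable borel" unfolding D_def[abs_def] by measurable
  define \<Delta> where "\<Delta> = (SUP x. \<bar>D x\<bar>)"
  have D1: "\<bar>D x\<bar> \<le> 1" for x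
    unfolding D_def using F.cdf_nonneg[of x] F.cdf_bounded_prob[of x] G.cdf_nonneg[of x] G.cdf_bounded_prob[of x]
    by linarith
  have bdd: "bdd_above (range (\<lambda>x. \<bar>D x\<bar>))"
    by (intro bdd_aboveI[of _ 1]) (auto simp: D1)
  have D\<Delta>: "\<bar>D x\<bar> \<le> \<Delta>" for x
    unfolding \<Delta>_def by (rule cSUP_upper[OF _ bdd]) simp
  then have \<Delta>0: "0 \<le> \<Delta>" using abs_ge_zero order_trans by blast
  have E0: "0 \<le> E" using E[of 0] abs_ge_zero order_trans by blast
  have conv: "\<bar>\<integral>v. D (y - v) \<partial>K\<bar> \<le> E" for y
  proof -
    have "(\<integral>v. D (y - v) \<partial>K) = cdf (F \<star> K) y - cdf (G \<star> K) y"
      unfolding D_def cdf_convolution[OF assms(1,3)] cdf_convolution[OF assms(2,3)]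
      by (intro Bochner_Integration.integral_diff K.integrable_const_bound[of _ 1])
         (auto simp: F.cdf_nonneg F.cdf_bounded_prob G.cdf_nonneg G.cdf_bounded_prob)
    then show ?thesis using E by simp
  qed
  \<comment> \<open>if \<open>s * D\<close> is at least \<open>d\<close> on a window of \<open>K\<close>-mass at least \<open>3/4\<close>, its average over \<open>K\<close> is at least
    \<open>3/4 * (d + \<Delta>) - \<Delta>\<close>, because \<open>s * D \<ge> - \<Delta>\<close> elsewhere\<close>
  have side: "3 / 4 * (d + \<Delta>) - \<Delta> \<le> E"
    if s: "\<bar>s\<bar> = 1" and d: "\<And>v. v \<in> {-r..r} \<Longrightarrow> d \<le> s * D (y - v)" for s d y
  proof (cases "0 \<le> d + \<Delta>")
    case True
    have "3 / 4 * (d + \<Delta>) - \<Delta> \<le> (d + \<Delta>) * measure K {-r..r} - \<Delta>"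
      using mult_left_mono[OF r(2) True] by (simp add: mult.commute)
    also have "\<dots> = (\<integral>v. (d + \<Delta>) * indicator {-r..r} v - \<Delta> \<partial>K)"
      using K.prob_space
      by (subst Bochner_Integration.integral_diff) (auto intro!: K.integrable_const_bound[of _ 1])
    also have "\<dots> \<le> (\<integral>v. s * D (y - v) \<partial>K)"
    proof (rule integral_mono)
      show "integrable K (\<lambda>v. s * D (y - v))"
        using s D1 by (intro K.integrable_const_bound[of _ 1]) (auto simp: abs_mult)
      show "(d + \<Delta>) * indicator {-r..r} v - \<Delta> \<le> s * D (y - v)" for v
      proof -
        have "- \<Delta> \<le> s * D (y - v)"
          using D\<Delta>[of "y - v"] s by (metis abs_le_D2 abs_mult minus_le_iff mult_1)
        then show ?thesis using d[of v] by (auto simp: indicator_def)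
      qed
    qed (intro Bochner_Integration.integrable_diff integrable_mult_right, auto intro!: K.integrable_const_bound[of _ 1])
    also have "\<dots> = s * (\<integral>v. D (y - v) \<partial>K)" by simp
    also have "\<dots> \<le> \<bar>s\<bar> * \<bar>\<integral>v. D (y - v) \<partial>K\<bar>"
      by (metis abs_ge_self abs_mult)
    also have "\<dots> \<le> E" using s conv[of y] by simp
    finally show ?thesis .
  next
    case False
    then have "3 / 4 * (d + \<Delta>) \<le> 0" by simp
    with \<Delta>0 E0 show ?thesis by linarith
  qed
  \<comment> \<open>\<open>F\<close> is monotone and \<open>G\<close> is Lipschitz, so a large \<open>D x0\<close> persists on an interval to the right of \<open>x0\<close>,
    a large \<open>- D x0\<close> on one to the left\<close>
  have *: "\<bar>D x0\<bar> \<le> 4 / 3 * E + \<Delta> / 3 + 2 * L * r" for x0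
  proof (cases "0 \<le> D x0")
    case True
    have "3 / 4 * ((D x0 - 2 * L * r) + \<Delta>) - \<Delta> \<le> E"
    proof (rule side[of 1 _ "x0 + r"])
      fix v assume v: "v \<in> {-r..r}"
      have "cdf G (x0 + r - v) - cdf G x0 \<le> L * (x0 + r - v - x0)"
        using v by (intro Lip) auto
      also have "\<dots> \<le> L * (2 * r)" using v \<open>0 \<le> L\<close> by (intro mult_left_mono) auto
      finally show "D x0 - 2 * L * r \<le> 1 * D (x0 + r - v)"
        using F.cdf_nondecreasing[of x0 "x0 + r - v"] v unfolding D_def by auto
    qed simp
    then show ?thesis using True by (simp add: field_simps)
  next
    case False
    have "3 / 4 * ((- D x0 - 2 * L * r) + \<Delta>) - \<Delta> \<le> E"
    proof (rule side[of "-1" _ "x0 - r"])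
      fix v assume v: "v \<in> {-r..r}"
      have "cdf G x0 - cdf G (x0 - r - v) \<le> L * (x0 - (x0 - r - v))"
        using v by (intro Lip) auto
      also have "\<dots> \<le> L * (2 * r)" using v \<open>0 \<le> L\<close> by (intro mult_left_mono) auto
      finally show "- D x0 - 2 * L * r \<le> -1 * D (x0 - r - v)"
        using F.cdf_nondecreasing[of "x0 - r - v" x0] v unfolding D_def by auto
    qed simp
    then show ?thesis using False by (simp add: field_simps)
  qed
  have "\<Delta> \<le> 4 / 3 * E + \<Delta> / 3 + 2 * L * r"
    unfolding \<Delta>_def by (rule cSUP_least) (use * in \<open>auto simp: \<Delta>_def\<close>)
  then show ?thesis using D\<Delta>[of x] unfolding D_def by (simp add: field_simps)
qed

lemma char_affine:
  assumes "real_distribution F"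
  shows "char (distr F borel (\<lambda>x. (x - m) / c)) t = iexp (- (t / c * m)) * char F (t / c)"
proof -
  interpret real_distribution F by fact
  have "char (distr F borel (\<lambda>x. (x - m) / c)) t = (\<integral>x. iexp (- (t / c * m)) * iexp (t / c * x) \<partial>F)"
    unfolding char_def
    by (subst integral_distr) (auto simp: exp_add[symmetric] algebra_simps diff_divide_distrib)
  then show ?thesis unfolding char_def by simp
qed

text \<open>
  The noise is a Fejer variable divided by \<open>T\<close>, so that frequencies beyond \<open>T\<close> do not matter and the smoothing
  scale is \<open>1 / T\<close>.
\<close>
lemma esseen_inequality:
  assumes FG: "real_distribution F" "real_distribution G"
    and Lip: "\<And>x y. x \<le> y \<Longrightarrow> cdf G y - cdf G x \<le> L * (y - x)" and "0 \<le> L" "0 < T"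
    and w: "integrable lborel w" "\<And>t. 0 \<le> w t"
    and close: "\<And>t. \<bar>t\<bar> \<le> T \<Longrightarrow> cmod (char F t - char G t) \<le> \<bar>t\<bar> * w t"
  shows "\<bar>cdf F x - cdf G x\<bar> \<le> 2 * ((\<integral>t. w t \<partial>lborel) / pi) + 3 * L * (fejer_quantile / T)"
proof -
  define K where "K = distr fejer borel (\<lambda>x. (x - 0) / T)"
  interpret fejer: real_distribution fejer by (rule real_distribution_fejer)
  have K: "real_distribution K" unfolding K_def by simp
  interpret K: real_distribution K by fact
  have charK: "char K t = of_real (max 0 (1 - \<bar>t / T\<bar>))" for t
    unfolding K_def char_affine[OF real_distribution_fejer] by (simp add: char_fejer)
  have K_atoms: "measure K {x} = 0" for x
  proof -
    have "measure K {x} = measure fejer {T * x}"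
      unfolding K_def using \<open>0 < T\<close>
      by (subst measure_distr) (auto intro!: arg_cong[where f="measure fejer"] simp: field_simps)
    then show ?thesis by (simp add: fejer_no_atoms)
  qed
  have K_quantile: "3 / 4 \<le> measure K {-(fejer_quantile / T)..fejer_quantile / T}"
  proof -
    have "measure K {-(fejer_quantile / T)..fejer_quantile / T} = measure fejer {-fejer_quantile..fejer_quantile}"
      unfolding K_def using \<open>0 < T\<close>
      by (subst measure_distr) (auto intro!: arg_cong[where f="measure fejer"] simp: field_simps)
    then show ?thesis using fejer_quantile by simp
  qed
  have smooth: "\<bar>cdf (F \<star> K) b - cdf (G \<star> K) b\<bar> \<le> (\<integral>t. w t \<partial>lborel) / pi" for b
  proof (rule cdf_difference_bound)
    fix t
    have "cmod (char (F \<star> K) t - char (G \<star> K) t) = cmod (char F t - char G t) * \<bar>max 0 (1 - \<bar>t / T\<bar>)\<bar>"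
      unfolding char_convolution[OF FG(1) K] char_convolution[OF FG(2) K] charK
      by (simp only: left_diff_distrib[symmetric] norm_mult norm_of_real)
    also have "\<dots> \<le> \<bar>t\<bar> * w t"
    proof (cases "\<bar>t\<bar> \<le> T")
      case True
      have "cmod (char F t - char G t) * \<bar>max 0 (1 - \<bar>t / T\<bar>)\<bar> \<le> (\<bar>t\<bar> * w t) * 1"
        using True close[of t] w(2)[of t] by (intro mult_mono) auto
      then show ?thesis by simp
    next
      case False
      then have "max 0 (1 - \<bar>t / T\<bar>) = 0" using \<open>0 < T\<close> by (auto simp: field_simps)
      then show ?thesis using w(2) by simp
    qed
    finally show "cmod (char (F \<star> K) t - char (G \<star> K) t) \<le> \<bar>t\<bar> * w t" .
  qed (intro real_distribution_convolution convolution_no_atoms FG K K_atoms w)+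
  show ?thesis
    by (rule smoothing_inequality[OF FG K Lip _ K_quantile \<open>0 \<le> L\<close> smooth])
       (use fejer_quantile \<open>0 < T\<close> in auto)
qed

section \<open>The normal tail\<close>

definition normal_tail :: "real \<Rightarrow> real" where
  "normal_tail x = 1 - std_normal_cdf x"

lemma measure_std_normal_Ioi: "measure std_normal_distribution {x<..} = normal_tail x"
proof -
  interpret N: real_distribution std_normal_distribution by (rule real_dist_normal_dist)
  have "{x<..} = space std_normal_distribution - {..x}" by auto
  then show ?thesis
    unfolding normal_tail_def cdf_def2 using N.prob_compl[of "{..x}"] by simp
qed

lemma ennreal_std_normal_cdf_diff:
  assumes "x \<le> y"
  shows "ennreal (std_normal_cdf y - std_normal_cdf x)
     = (\<integral>\<^sup>+z. ennreal (std_normal_density z) * indicator {x<..y} z \<partial>lborel)"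
proof -
  interpret N: real_distribution std_normal_distribution by (rule real_dist_normal_dist)
  have "ennreal (std_normal_cdf y - std_normal_cdf x) = emeasure std_normal_distribution {x<..y}"
    using N.emeasure_Ioc[OF assms] by simp
  then show ?thesis by (simp add: emeasure_density)
qed

lemma std_normal_cdf_diff_le:
  assumes "x \<le> y" "0 \<le> c" "\<And>z. x < z \<Longrightarrow> z \<le> y \<Longrightarrow> std_normal_density z \<le> c"
  shows "std_normal_cdf y - std_normal_cdf x \<le> c * (y - x)"
proof -
  have "(\<integral>\<^sup>+z. ennreal (std_normal_density z) * indicator {x<..y} z \<partial>lborel)
      \<le> (\<integral>\<^sup>+z. ennreal c * indicator {x<..y} z \<partial>lborel)"
    using assms(3) by (intro nn_integral_mono) (auto split: split_indicator intro!: ennreal_leI)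
  also have "\<dots> = ennreal (c * (y - x))"
    using assms by (simp add: nn_integral_cmult ennreal_mult)
  finally show ?thesis
    unfolding ennreal_std_normal_cdf_diff[OF assms(1), symmetric] using assms by (subst (asm) ennreal_le_iff) auto
qed

lemma std_normal_cdf_diff_ge:
  assumes "x \<le> y" "0 \<le> c" "\<And>z. x < z \<Longrightarrow> z \<le> y \<Longrightarrow> c \<le> std_normal_density z"
  shows "c * (y - x) \<le> std_normal_cdf y - std_normal_cdf x"
proof -
  interpret N: real_distribution std_normal_distribution by (rule real_dist_normal_dist)
  have "ennreal (c * (y - x)) = (\<integral>\<^sup>+z. ennreal c * indicator {x<..y} z \<partial>lborel)"
    using assms by (simp add: nn_integral_cmult ennreal_mult)
  also have "\<dots> \<le> (\<integral>\<^sup>+z. ennreal (std_normal_density z) * indicator {x<..y} z \<partial>lborel)"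
    using assms(3) by (intro nn_integral_mono) (auto split: split_indicator intro!: ennreal_leI)
  finally show ?thesis
    unfolding ennreal_std_normal_cdf_diff[OF assms(1), symmetric]
    using N.cdf_nondecreasing[OF assms(1)] by (subst (asm) ennreal_le_iff) auto
qed

lemma std_normal_cdf_Lipschitz:
  assumes "x \<le> y"
  shows "std_normal_cdf y - std_normal_cdf x \<le> y - x"
proof -
  have "std_normal_density z \<le> 1" for z
  proof -
    have "1 \<le> sqrt (2 * pi)" using pi_gt3 by simp
    moreover have "exp (- z\<^sup>2 / 2) \<le> 1" by simp
    ultimately have "1 / sqrt (2 * pi) * exp (- z\<^sup>2 / 2) \<le> 1 * 1" by (intro mult_mono) auto
    then show ?thesis by (simp add: std_normal_density_def)
  qed
  then show ?thesis using std_normal_cdf_diff_le[OF assms, of 1] by simp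
qed

lemma std_normal_density_antimono:
  assumes "0 \<le> x" "x \<le> y" shows "std_normal_density y \<le> std_normal_density x"
  using assms by (simp add: std_normal_density_def divide_right_mono)

text \<open>
  A lower bound of Mills type for the tail, in the form in which relative errors are measured.
\<close>
lemma std_normal_density_le_normal_tail:
  assumes "0 \<le> z"
  shows "std_normal_density z \<le> exp (3 / 2) * (1 + z) * normal_tail z"
proof -
  interpret N: real_distribution std_normal_distribution by (rule real_dist_normal_dist)
  \<comment> \<open>on \<open>[z, z + 1 / (1 + z)]\<close> the exponent \<open>- x^2 / 2\<close> decreases by at most \<open>3 / 2\<close>\<close>
  define d where "d = 1 / (1 + z)"
  have d: "0 < d" "d \<le> 1" "z * d \<le> 1" using assms by (auto simp: d_def field_simps)
  have "exp (- (3 / 2)) * std_normal_density z \<le> std_normal_density (z + d)"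
  proof -
    have "d\<^sup>2 \<le> 1" using d by (intro power_le_one) auto
    then have "- (3 / 2) + - z\<^sup>2 / 2 \<le> - (z + d)\<^sup>2 / 2"
      using d by (simp add: power2_sum field_simps)
    then have "exp (- (3 / 2) + - z\<^sup>2 / 2) \<le> exp (- (z + d)\<^sup>2 / 2)" by simp
    then show ?thesis
      unfolding std_normal_density_def exp_add by (simp add: field_simps)
  qed
  then have "exp (- (3 / 2)) * std_normal_density z * (z + d - z)
      \<le> std_normal_cdf (z + d) - std_normal_cdf z"
    using d assms
    by (intro std_normal_cdf_diff_ge) (auto intro: order_trans[OF _ std_normal_density_antimono])
  also have "\<dots> \<le> normal_tail z"
    unfolding normal_tail_def using N.cdf_bounded_prob[of "z + d"] by simp
  finally have "exp (- (3 / 2)) * std_normal_density z \<le> (1 + z) * normal_tail z"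
    using assms by (simp add: d_def field_simps)
  then have "exp (3 / 2) * (exp (- (3 / 2)) * std_normal_density z) \<le> exp (3 / 2) * ((1 + z) * normal_tail z)"
    by (intro mult_left_mono) auto
  then show ?thesis by (simp add: mult.assoc[symmetric] exp_add[symmetric])
qed

lemma normal_tail_pos: "0 \<le> z \<Longrightarrow> 0 < normal_tail z"
  using std_normal_density_le_normal_tail[of z] normal_density_pos[of 1 0 z]
  by (smt (verit) exp_gt_zero mult_nonneg_nonpos mult_pos_pos)

lemma normal_tail_antimono: "x \<le> y \<Longrightarrow> normal_tail y \<le> normal_tail x"
proof -
  interpret N: real_distribution std_normal_distribution by (rule real_dist_normal_dist)
  show "x \<le> y \<Longrightarrow> normal_tail y \<le> normal_tail x"
    unfolding normal_tail_def using N.cdf_nondecreasing[of x y] by simp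
qed

text \<open>
  The logarithmic derivative of the tail is \<open>O(1 + z)\<close>, so a shift \<open>e\<close> of the argument has the relative effect
  \<open>O((1 + z) \<bar>e\<bar>)\<close>.
\<close>
lemma normal_tail_ratio:
  assumes "0 \<le> z"
  shows "\<bar>normal_tail (z + e) / normal_tail z - 1\<bar> \<le> exp (3 / 2) * (1 + z) * \<bar>e\<bar> * exp (z * \<bar>e\<bar>)"
proof -
  define c where "c = std_normal_density z * exp (z * \<bar>e\<bar>)"
  have c0: "0 \<le> c" by (simp add: c_def)
  have dens: "std_normal_density y \<le> c" if "z - \<bar>e\<bar> \<le> y" for y
  proof -
    have "z\<^sup>2 - 2 * z * \<bar>e\<bar> \<le> y\<^sup>2"
    proof (cases "z \<le> \<bar>e\<bar>")
      case True
      then have "z * z \<le> z * (2 * \<bar>e\<bar>)" using assms by (intro mult_left_mono) auto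
      then have "z\<^sup>2 - 2 * z * \<bar>e\<bar> \<le> 0" by (simp add: power2_eq_square)
      also have "0 \<le> y\<^sup>2" by simp
      finally show ?thesis .
    next
      case False
      have "z\<^sup>2 - 2 * z * \<bar>e\<bar> \<le> (z - \<bar>e\<bar>)\<^sup>2" by (simp add: power2_diff)
      also have "\<dots> \<le> y\<^sup>2" using False that by (intro power_mono) auto
      finally show ?thesis .
    qed
    then have "- y\<^sup>2 / 2 \<le> - z\<^sup>2 / 2 + z * \<bar>e\<bar>" by simp
    then have "exp (- y\<^sup>2 / 2) \<le> exp (- z\<^sup>2 / 2) * exp (z * \<bar>e\<bar>)" by (simp add: exp_add[symmetric])
    then show ?thesis unfolding c_def std_normal_density_def by (simp add: divide_right_mono)
  qed
  have "\<bar>normal_tail (z + e) - normal_tail z\<bar> \<le> c * \<bar>e\<bar>"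
  proof (cases "0 \<le> e")
    case True
    have "std_normal_cdf (z + e) - std_normal_cdf z \<le> c * (z + e - z)"
      using True c0 by (intro std_normal_cdf_diff_le dens) auto
    moreover have "0 * (z + e - z) \<le> std_normal_cdf (z + e) - std_normal_cdf z"
      using True by (intro std_normal_cdf_diff_ge) auto
    ultimately show ?thesis unfolding normal_tail_def using True by simp
  next
    case False
    have "std_normal_cdf z - std_normal_cdf (z + e) \<le> c * (z - (z + e))"
      using False c0 by (intro std_normal_cdf_diff_le dens) auto
    moreover have "0 * (z - (z + e)) \<le> std_normal_cdf z - std_normal_cdf (z + e)"
      using False by (intro std_normal_cdf_diff_ge) auto
    ultimately show ?thesis unfolding normal_tail_def using False by simp
  qed
  also have "c * \<bar>e\<bar> \<le> (exp (3 / 2) * (1 + z) * normal_tail z) * exp (z * \<bar>e\<bar>) * \<bar>e\<bar>"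
    unfolding c_def by (intro mult_right_mono std_normal_density_le_normal_tail assms) auto
  finally have 1: "\<bar>normal_tail (z + e) - normal_tail z\<bar> \<le> (exp (3 / 2) * (1 + z) * \<bar>e\<bar> * exp (z * \<bar>e\<bar>)) * normal_tail z"
    by (simp add: mult_ac)
  have "normal_tail (z + e) / normal_tail z - 1 = (normal_tail (z + e) - normal_tail z) / normal_tail z"
    using normal_tail_pos[OF assms] by (simp add: field_simps)
  then show ?thesis
    using 1 normal_tail_pos[OF assms] by (simp add: divide_le_eq)
qed

text \<open>
  Completing the square: \<open>exp (- t x)\<close> times the normal density is \<open>exp (t^2 / 2)\<close> times its translate by \<open>- t\<close>.
\<close>
lemma integral_exp_std_normal_Ioi:
  "(\<integral>x. exp (- t * x) * indicator {d<..} x \<partial>std_normal_distribution) = exp (t\<^sup>2 / 2) * normal_tail (t + d)"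
proof -
  interpret N: real_distribution std_normal_distribution by (rule real_dist_normal_dist)
  have "(\<integral>x. exp (- t * x) * indicator {d<..} x \<partial>std_normal_distribution)
      = (\<integral>x. std_normal_density x * (exp (- t * x) * indicator {d<..} x) \<partial>lborel)"
    by (subst integral_density) auto
  also have "\<dots> = (\<integral>x. exp (t\<^sup>2 / 2) * (std_normal_density (t + 1 * x) * indicator {t + d<..} (t + 1 * x)) \<partial>lborel)"
  proof (intro Bochner_Integration.integral_cong refl)
    fix x
    have "exp (- x\<^sup>2 / 2) * exp (- t * x) = exp (t\<^sup>2 / 2) * exp (- (t + x)\<^sup>2 / 2)"
      unfolding exp_add[symmetric] by (simp add: power2_sum field_simps)
    then have "std_normal_density x * exp (- t * x) = exp (t\<^sup>2 / 2) * std_normal_density (t + x)"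
      unfolding std_normal_density_def by simp
    then show "std_normal_density x * (exp (- t * x) * indicator {d<..} x)
       = exp (t\<^sup>2 / 2) * (std_normal_density (t + 1 * x) * indicator {t + d<..} (t + 1 * x))"
      by (simp add: mult.assoc[symmetric] indicator_def)
  qed
  also have "\<dots> = exp (t\<^sup>2 / 2) * (\<integral>x. std_normal_density (t + 1 * x) * indicator {t + d<..} (t + 1 * x) \<partial>lborel)"
    by simp
  also have "(\<integral>x. std_normal_density (t + 1 * x) * indicator {t + d<..} (t + 1 * x) \<partial>lborel)
      = (\<integral>x. std_normal_density x * indicator {t + d<..} x \<partial>lborel)"
    by (subst lborel_integral_real_affine[of 1 _ t]) auto
  also have "\<dots> = (\<integral>x. indicator {t + d<..} x \<partial>std_normal_distribution)"
    by (subst integral_density) auto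
  also have "\<dots> = normal_tail (t + d)"
    using measure_std_normal_Ioi[of "t + d"] by simp
  finally show ?thesis .
qed

lemma std_normal_no_atoms: "measure std_normal_distribution {x} = 0"
  by (rule density_lborel_no_atoms) simp

lemma integral_exp_std_normal_Ici:
  "(\<integral>x. exp (- t * x) * indicator {d..} x \<partial>std_normal_distribution) = exp (t\<^sup>2 / 2) * normal_tail (t + d)"
proof -
  interpret N: real_distribution std_normal_distribution by (rule real_dist_normal_dist)
  have "AE x in std_normal_distribution. x \<noteq> d"
    using N.prob_eq_0[of "{d}"] std_normal_no_atoms[of d] by auto
  then have "(\<integral>x. exp (- t * x) * indicator {d..} x \<partial>std_normal_distribution)
    = (\<integral>x. exp (- t * x) * indicator {d<..} x \<partial>std_normal_distribution)"
    by (intro integral_cong_AE) (auto split: split_indicator)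
  then show ?thesis using integral_exp_std_normal_Ioi by simp
qed

section \<open>The Berry-Esseen theorem\<close>

text \<open>
  The law of a sum of \<open>n\<close> independent variables with law \<open>\<nu>\<close>.  On the level of laws a change of
  measure is simply a density.
\<close>
primrec conv_power :: "real measure \<Rightarrow> nat \<Rightarrow> real measure" where
  "conv_power \<nu> 0 = return borel 0"
| "conv_power \<nu> (Suc n) = (\<nu> \<star> conv_power \<nu> n)"

lemma real_distribution_return: "real_distribution (return borel (c::real))"
  by (simp add: real_distribution_def real_distribution_axioms_def prob_space_return)

lemma real_distribution_conv_power:
  "real_distribution \<nu> \<Longrightarrow> real_distribution (conv_power \<nu> n)"
  by (induction n) (auto intro: real_distribution_convolution simp: real_distribution_return)

lemma char_conv_power: "real_distribution \<nu> \<Longrightarrow> char (conv_power \<nu> n) t = char \<nu> t ^ n"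
proof (induction n)
  case 0 then show ?case by (simp add: char_def integral_return)
next
  case (Suc n)
  then show ?case by (simp add: char_convolution real_distribution_conv_power)
qed

text \<open>
  For \<open>\<bar>t\<bar> \<le> T\<close> the third-order Taylor remainder of the characteristic function of one summand is at most a
  third of its quadratic term.  Hence the characteristic function of a summand and the Gaussian factor
  \<open>exp (- t^2 / (2 n))\<close> are both at most \<open>exp (- t^2 / (3 n))\<close> in modulus, and \<open>n - 1\<close> such factors remain in each
  term of the telescoped difference of the \<open>n\<close>-th powers.
\<close>
lemma (in real_distribution) char_power_gaussian_bound:
  assumes int: "integrable M (\<lambda>x. \<bar>x\<bar> ^ 3)" "integrable M (\<lambda>x. x\<^sup>2)" "integrable M (\<lambda>x. x)"
    and m: "expectation (\<lambda>x. x) = 0" "expectation (\<lambda>x. x\<^sup>2) = s\<^sup>2" "expectation (\<lambda>x. \<bar>x\<bar> ^ 3) = \<rho>"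
    and "0 < s" "2 \<le> n" and T: "T = s ^ 3 * sqrt (real n) / \<rho>" and t: "\<bar>t\<bar> \<le> T"
  shows "cmod (char M (t / (s * sqrt (real n))) ^ n - of_real (exp (- t\<^sup>2 / 2))) \<le> \<bar>t\<bar> ^ 3 / (3 * T) * exp (- t\<^sup>2 / 6)"
proof -
  define N where "N = real n"
  have N: "2 \<le> N" using \<open>2 \<le> n\<close> by (simp add: N_def)
  have \<rho>s: "s ^ 3 \<le> \<rho>" using third_moment_ge[OF int(1,2) \<open>0 < s\<close> m(2)] m(3) by simp
  moreover have "0 < s ^ 3" using \<open>0 < s\<close> by simp
  ultimately have \<rho>: "0 < \<rho>" by linarith
  have T0: "0 < T" unfolding T using \<open>0 < s\<close> \<rho> \<open>2 \<le> n\<close> by simp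
  have "T \<le> sqrt N"
    unfolding T N_def[symmetric] using \<rho>s \<rho> N by (simp add: field_simps)
  then have TN: "T\<^sup>2 \<le> N" using T0 N by (metis less_eq_real_def power2_le_iff_abs_le abs_of_nonneg real_sqrt_ge_zero real_sqrt_pow2 zero_le_numeral order_trans power_mono)
  define v where "v = t / (s * sqrt N)"
  have v2: "v\<^sup>2 * s\<^sup>2 = t\<^sup>2 / N"
    unfolding v_def using \<open>0 < s\<close> N by (simp add: field_simps power_mult_distrib power_divide)
  have v3: "\<bar>v\<bar> ^ 3 * \<rho> = \<bar>t\<bar> ^ 3 / (N * T)"
  proof -
    have "sqrt N * sqrt N = N" using N by simp
    then show ?thesis
      unfolding v_def T N_def[symmetric] using \<open>0 < s\<close> N \<rho> 
      by (simp add: abs_mult power_mult_distrib power_divide power3_eq_cube field_simps)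
  qed
  define a where "a = char M v"
  define b where "b = complex_of_real (exp (- (t\<^sup>2 / (2 * N))))"
  have "cmod (a - (1 - v\<^sup>2 * s\<^sup>2 / 2)) \<le> (v\<^sup>2 / 6) * expectation (\<lambda>x. min (6 * x\<^sup>2) (\<bar>v\<bar> * \<bar>x\<bar> ^ 3))"
    unfolding a_def by (rule char_approx3) (use int m in auto)
  also have "expectation (\<lambda>x. min (6 * x\<^sup>2) (\<bar>v\<bar> * \<bar>x\<bar> ^ 3)) \<le> expectation (\<lambda>x. \<bar>v\<bar> * \<bar>x\<bar> ^ 3)"
    using int by (intro integral_mono integrable_min) auto
  also have "\<dots> = \<bar>v\<bar> * \<rho>" using m by simp
  finally have "cmod (a - (1 - v\<^sup>2 * s\<^sup>2 / 2)) \<le> (v\<^sup>2 / 6) * (\<bar>v\<bar> * \<rho>)"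
    by (simp add: mult_left_mono)
  also have "\<dots> = \<bar>v\<bar> ^ 3 * \<rho> / 6" by (simp add: power2_eq_square power3_eq_cube)
  finally have a1: "cmod (a - of_real (1 - t\<^sup>2 / (2 * N))) \<le> \<bar>t\<bar> ^ 3 / (6 * (N * T))"
    unfolding v2 v3 by (simp add: mult.commute mult.assoc)
  have t3: "\<bar>t\<bar> ^ 3 / (N * T) \<le> t\<^sup>2 / N"
  proof -
    have "\<bar>t\<bar> ^ 3 = t\<^sup>2 * \<bar>t\<bar>" by (simp add: power3_eq_cube power2_eq_square)
    also have "\<dots> \<le> t\<^sup>2 * T" using t by (intro mult_left_mono) auto
    finally show ?thesis using T0 N by (simp add: field_simps)
  qed
  have "t\<^sup>2 \<le> T\<^sup>2" using t T0 by (metis abs_of_pos abs_le_square_iff)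
  then have tN: "t\<^sup>2 / N \<le> 1" using TN N by (simp add: field_simps)
  have b1: "cmod (b - of_real (1 - t\<^sup>2 / (2 * N))) \<le> \<bar>t\<bar> ^ 3 / (8 * (N * T))"
  proof -
    have "cmod (b - of_real (1 - t\<^sup>2 / (2 * N))) = \<bar>exp (- (t\<^sup>2 / (2 * N))) - (1 - t\<^sup>2 / (2 * N))\<bar>"
      unfolding b_def by (simp only: of_real_diff[symmetric] norm_of_real)
    also have "\<dots> \<le> (t\<^sup>2 / (2 * N))\<^sup>2 / 2" using N by (intro exp_minus_quadratic) simp
    also have "\<dots> = \<bar>t\<bar> ^ 3 * \<bar>t\<bar> / (8 * (N * N))"
      by (simp add: power2_eq_square power3_eq_cube)
    also have "\<dots> \<le> \<bar>t\<bar> ^ 3 / (8 * (N * T))"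
    proof -
      have "\<bar>t\<bar> * T \<le> T * T" using t T0 by (intro mult_right_mono) auto
      then have "\<bar>t\<bar> * T \<le> N" using TN by (simp add: power2_eq_square)
      then have "\<bar>t\<bar> ^ 3 * (\<bar>t\<bar> * T) \<le> \<bar>t\<bar> ^ 3 * N" by (intro mult_left_mono) auto
      then show ?thesis using T0 N by (simp add: field_simps)
    qed
    finally show ?thesis .
  qed
  define m where "m = exp (- (t\<^sup>2 / (3 * N)))"
  have bm: "cmod b \<le> m" unfolding b_def m_def norm_of_real using N by (simp add: field_simps)
  have "cmod a \<le> cmod (of_real (1 - t\<^sup>2 / (2 * N))) + cmod (a - of_real (1 - t\<^sup>2 / (2 * N)))"
    using norm_triangle_ineq[of "of_real (1 - t\<^sup>2 / (2 * N))" "a - of_real (1 - t\<^sup>2 / (2 * N))"] by simp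
  also have "\<dots> \<le> (1 - t\<^sup>2 / (2 * N)) + \<bar>t\<bar> ^ 3 / (6 * (N * T))"
    using a1 tN by (simp only: norm_of_real)
  also have "\<dots> \<le> 1 - t\<^sup>2 / (3 * N)"
  proof -
    have "\<bar>t\<bar> ^ 3 / (6 * (N * T)) = \<bar>t\<bar> ^ 3 / (N * T) / 6" "t\<^sup>2 / (2 * N) = t\<^sup>2 / N / 2" "t\<^sup>2 / (3 * N) = t\<^sup>2 / N / 3"
      by simp_all
    then show ?thesis using t3 by linarith
  qed
  also have "\<dots> \<le> m" using exp_ge_add_one_self[of "- (t\<^sup>2 / (3 * N))"] by (simp add: m_def)
  finally have am: "cmod a \<le> m" .
  have ab: "cmod (a - b) \<le> \<bar>t\<bar> ^ 3 / (3 * (N * T))"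
  proof -
    have "cmod (a - b) \<le> cmod (a - of_real (1 - t\<^sup>2 / (2 * N))) + cmod (b - of_real (1 - t\<^sup>2 / (2 * N)))"
      using norm_triangle_ineq4[of "a - of_real (1 - t\<^sup>2 / (2 * N))" "b - of_real (1 - t\<^sup>2 / (2 * N))"] by simp
    also have "\<dots> \<le> \<bar>t\<bar> ^ 3 / (6 * (N * T)) + \<bar>t\<bar> ^ 3 / (8 * (N * T))" using a1 b1 by (rule add_mono)
    also have "\<dots> \<le> \<bar>t\<bar> ^ 3 / (3 * (N * T))"
      using T0 N by (simp add: field_simps)
    finally show ?thesis .
  qed
  have m_pow: "m ^ (n - 1) \<le> exp (- t\<^sup>2 / 6)"
  proof -
    have "m ^ (n - 1) = exp (- (t\<^sup>2 / (3 * N)) * real (n - 1))"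
      unfolding m_def by (simp add: exp_of_nat_mult[symmetric] mult.commute)
    also have "\<dots> \<le> exp (- t\<^sup>2 / 6)"
    proof -
      have "N / 2 \<le> real (n - 1)" using \<open>2 \<le> n\<close> by (simp add: N_def of_nat_diff)
      then have "t\<^sup>2 / (3 * N) * (N / 2) \<le> t\<^sup>2 / (3 * N) * real (n - 1)" using N by (intro mult_left_mono) auto
      then show ?thesis using N by simp
    qed
    finally show ?thesis .
  qed
  have bn: "b ^ n = of_real (exp (- t\<^sup>2 / 2))"
    unfolding b_def using N by (simp only: of_real_power[symmetric] exp_of_nat_mult[symmetric]) (simp add: N_def)
  have "cmod (a ^ n - b ^ n) \<le> real n * cmod (a - b) * m ^ (n - 1)"
    by (rule norm_power_diff_le[OF am bm])
  also have "\<dots> \<le> N * (\<bar>t\<bar> ^ 3 / (3 * (N * T))) * exp (- t\<^sup>2 / 6)"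
    unfolding N_def[symmetric] using ab m_pow N T0 by (intro mult_mono) (auto simp: m_def)
  also have "\<dots> = \<bar>t\<bar> ^ 3 / (3 * T) * exp (- t\<^sup>2 / 6)" using N by (simp add: field_simps)
  finally show ?thesis unfolding bn a_def v_def N_def .
qed

lemma integrable_square_gaussian: "integrable lborel (\<lambda>t::real. t\<^sup>2 * exp (- t\<^sup>2 / 6))"
proof -
  have "integrable lborel (\<lambda>t. sqrt (2 * pi * 3) * (normal_density 0 (sqrt 3) t * (t - 0) ^ 2))"
    by (intro integrable_mult_right integrable_normal_moment) simp
  then show ?thesis
    by (simp add: normal_density_def mult.commute)
qed

definition berry_esseen_const :: real where
  "berry_esseen_const = 1 + 2 * (\<integral>(t::real). t\<^sup>2 * exp (- t\<^sup>2 / 6) \<partial>lborel) / (3 * pi) + 3 * fejer_quantile"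

lemma berry_esseen_const_ge_1: "1 \<le> berry_esseen_const"
proof -
  have "0 \<le> (\<integral>(t::real). t\<^sup>2 * exp (- t\<^sup>2 / 6) \<partial>lborel)" by (intro integral_nonneg_AE) auto
  then show ?thesis unfolding berry_esseen_const_def using fejer_quantile by simp
qed

lemma berry_esseen_const_pos: "0 < berry_esseen_const"
  using berry_esseen_const_ge_1 by linarith

text \<open>
  Esseen's inequality with \<open>T = s^3 sqrt n / \<rho>\<close>, the cut-off up to which the cubic Taylor term is at most a
  third of the quadratic one.
\<close>
theorem berry_esseen:
  assumes \<nu>: "real_distribution \<nu>" and int3: "integrable \<nu> (\<lambda>x. \<bar>x\<bar> ^ 3)" and \<mu>: "(\<integral>x. x \<partial>\<nu>) = \<mu>"
    and s2: "(\<integral>x. (x - \<mu>)\<^sup>2 \<partial>\<nu>) = s\<^sup>2" and "0 < s" "1 \<le> n"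
  shows "\<bar>cdf (distr (conv_power \<nu> n) borel (\<lambda>x. (x - real n * \<mu>) / (s * sqrt (real n)))) x - std_normal_cdf x\<bar>
       \<le> berry_esseen_const * (\<integral>x. \<bar>x - \<mu>\<bar> ^ 3 \<partial>\<nu>) / (s ^ 3 * sqrt (real n))"
proof -
  interpret \<nu>: real_distribution \<nu> by fact
  define I where "I = (\<integral>(t::real). t\<^sup>2 * exp (- t\<^sup>2 / 6) \<partial>lborel)"
  define K where "K = berry_esseen_const"
  have K1: "1 \<le> K" unfolding K_def by (rule berry_esseen_const_ge_1)
  define \<rho> where "\<rho> = (\<integral>x. \<bar>x - \<mu>\<bar> ^ 3 \<partial>\<nu>)"
  define \<nu>c where "\<nu>c = distr \<nu> borel (\<lambda>x. (x - \<mu>) / 1)"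
  have \<nu>c: "real_distribution \<nu>c" unfolding \<nu>c_def by simp
  interpret c: real_distribution \<nu>c by fact
  have int1: "integrable \<nu> (\<lambda>x. x)" and int2: "integrable \<nu> (\<lambda>x. x\<^sup>2)"
    by (rule \<nu>.integrable_of_third_moment, simp, rule int3)+
  note int3c = \<nu>.third_central_moment(1)[OF int3, of \<mu>]
  have int2c: "integrable \<nu> (\<lambda>x. (x - \<mu>)\<^sup>2)"
    unfolding power2_diff using int1 int2 by auto
  have mc: "(\<lambda>x. (x - \<mu>) / 1) \<in> \<nu> \<rightarrow>\<^sub>M borel" by simp
  have ci: "integrable \<nu>c (\<lambda>x. \<bar>x\<bar> ^ 3)" "integrable \<nu>c (\<lambda>x. x\<^sup>2)" "integrable \<nu>c (\<lambda>x. x)"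
    unfolding \<nu>c_def by (subst integrable_distr_eq[OF mc], simp, use int1 int2c int3c in simp)+
  have c1: "(\<integral>x. f x \<partial>\<nu>c) = (\<integral>x. f (x - \<mu>) \<partial>\<nu>)" if "f \<in> borel_measurable borel" for f :: "real \<Rightarrow> real"
    unfolding \<nu>c_def by (subst integral_distr[OF mc that]) simp
  have "(\<integral>x. x - \<mu> \<partial>\<nu>) = 0"
    using int1 \<mu> \<nu>.prob_space by (subst Bochner_Integration.integral_diff) auto
  then have cm: "c.expectation (\<lambda>x. x) = 0" "c.expectation (\<lambda>x. x\<^sup>2) = s\<^sup>2" "c.expectation (\<lambda>x. \<bar>x\<bar> ^ 3) = \<rho>"
    using s2 by (subst c1; simp add: \<rho>_def)+
  have \<rho>s: "s ^ 3 \<le> \<rho>" using c.third_moment_ge[OF ci(1,2) \<open>0 < s\<close> cm(2)] cm(3) by simp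
  moreover have s3: "0 < s ^ 3" using \<open>0 < s\<close> by simp
  ultimately have \<rho>: "0 < \<rho>" by linarith
  define T where "T = s ^ 3 * sqrt (real n) / \<rho>"
  have T0: "0 < T" unfolding T_def using \<open>0 < s\<close> \<rho> \<open>1 \<le> n\<close> by simp
  interpret cp: real_distribution "conv_power \<nu> n" by (rule real_distribution_conv_power[OF \<nu>])
  define F where "F = distr (conv_power \<nu> n) borel (\<lambda>x. (x - real n * \<mu>) / (s * sqrt (real n)))"
  have F: "real_distribution F" unfolding F_def by simp
  interpret F: real_distribution F by fact
  interpret N: real_distribution std_normal_distribution by (rule real_dist_normal_dist)
  have bound: "\<bar>cdf F x - std_normal_cdf x\<bar> \<le> K / T"
  proof (cases "2 \<le> n \<and> 1 \<le> T")
    \<comment> \<open>the right-hand side is at least \<open>1\<close>; \<open>n = 1\<close> falls here by \<open>s^3 \<le> \<rho>\<close>\<close>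
    case False
    have "T \<le> 1"
    proof (cases "2 \<le> n")
      case n: False
      with \<open>1 \<le> n\<close> have "n = 1" by simp
      then show ?thesis using \<rho>s \<rho> by (simp add: T_def)
    qed (use False in simp)
    then have "1 \<le> K / T" using K1 T0 by (simp add: field_simps)
    moreover have "\<bar>cdf F x - std_normal_cdf x\<bar> \<le> 1"
      using F.cdf_nonneg[of x] F.cdf_bounded_prob[of x] N.cdf_nonneg[of x] N.cdf_bounded_prob[of x] by linarith
    ultimately show ?thesis by linarith
  next
    case True
    define w where "w t = 1 / (3 * T) * (t\<^sup>2 * exp (- t\<^sup>2 / 6))" for t
    have "\<bar>cdf F x - std_normal_cdf x\<bar> \<le> 2 * ((\<integral>t. w t \<partial>lborel) / pi) + 3 * 1 * (fejer_quantile / T)"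
    proof (rule esseen_inequality[OF F real_dist_normal_dist _ _ T0])
      show "integrable lborel w"
        unfolding w_def[abs_def] by (intro integrable_mult_right integrable_square_gaussian)
      show "0 \<le> w t" for t unfolding w_def using T0 by simp
      fix t assume t: "\<bar>t\<bar> \<le> T"
      have "char F t = char \<nu>c (t / (s * sqrt (real n))) ^ n"
      proof -
        have "char \<nu>c v = iexp (- (v * \<mu>)) * char \<nu> v" for v
          unfolding \<nu>c_def by (subst char_affine[OF \<nu>]) simp
        then show ?thesis
          unfolding F_def char_affine[OF cp.real_distribution_axioms] char_conv_power[OF \<nu>]
          by (simp add: power_mult_distrib exp_of_nat_mult[symmetric] algebra_simps)
      qed
      then have "cmod (char F t - char std_normal_distribution t) \<le> \<bar>t\<bar> ^ 3 / (3 * T) * exp (- t\<^sup>2 / 6)"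
        using c.char_power_gaussian_bound[OF ci cm \<open>0 < s\<close> _ T_def t] True
        by (simp add: char_std_normal_distribution)
      also have "\<dots> = \<bar>t\<bar> * w t"
        by (simp add: w_def power3_eq_cube power2_eq_square)
      finally show "cmod (char F t - char std_normal_distribution t) \<le> \<bar>t\<bar> * w t" .
    qed (use std_normal_cdf_Lipschitz in auto)
    also have "(\<integral>t. w t \<partial>lborel) = I / (3 * T)"
      unfolding w_def I_def by simp
    also have "2 * (I / (3 * T) / pi) + 3 * 1 * (fejer_quantile / T) \<le> K / T"
      unfolding K_def berry_esseen_const_def I_def[symmetric] using T0 by (simp add: field_simps)
    finally show ?thesis .
  qed
  have "K * \<rho> / (s ^ 3 * sqrt (real n)) = K / T"
    unfolding T_def by simp
  then show ?thesis using bound unfolding F_def \<rho>_def K_def by simp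
qed

section \<open>Exponential integrals over half-lines\<close>

lemma (in real_distribution) integral_layer_cake:
  assumes g[measurable]: "g \<in> borel_measurable borel" and "\<And>x. 0 \<le> g x" "\<And>x. g x \<le> c"
  shows "has_bochner_integral lborel (\<lambda>r. indicator {0..c} r * measure M {x. r < g x}) (expectation g)"
proof (rule has_bochner_integral_nn_integral)
  interpret P: pair_sigma_finite M lborel ..
  have "mono (\<lambda>r. - measure M {x. r < g x})"
    by (intro monoI) (auto intro!: finite_measure_mono)
  then have "(\<lambda>r. - (- measure M {x. r < g x})) \<in> borel_measurable borel"
    by (intro borel_measurable_uminus borel_measurable_mono)
  then have [measurable]: "(\<lambda>r. measure M {x. r < g x}) \<in> borel_measurable borel" by simp
  show "(\<lambda>r. indicator {0..c} r * measure M {x. r < g x}) \<in> borel_measurable lborel" by measurable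
  have "ennreal (expectation g) = (\<integral>\<^sup>+x. ennreal (g x) \<partial>M)"
    using assms by (intro nn_integral_eq_integral[symmetric] integrable_const_bound[of _ c]) auto
  also have "\<dots> = (\<integral>\<^sup>+x. \<integral>\<^sup>+r. indicator {0..} r * (if r < g x then 1 else 0) \<partial>lborel \<partial>M)"
  proof (intro nn_integral_cong)
    fix x
    have "(\<integral>\<^sup>+r. indicator {0..} r * (if r < g x then 1 else 0) \<partial>lborel) = (\<integral>\<^sup>+r. indicator {0..<g x} r \<partial>lborel)"
      by (intro nn_integral_cong) (auto split: split_indicator)
    then show "ennreal (g x) = (\<integral>\<^sup>+r. indicator {0..} r * (if r < g x then 1 else 0) \<partial>lborel)"
      using assms(2) by simp
  qed
  also have "\<dots> = (\<integral>\<^sup>+r. \<integral>\<^sup>+x. indicator {0..} r * (if r < g x then 1 else 0) \<partial>M \<partial>lborel)"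
    by (rule P.Fubini'[symmetric]) measurable
  also have "\<dots> = (\<integral>\<^sup>+r. ennreal (indicator {0..c} r * measure M {x. r < g x}) \<partial>lborel)"
  proof (rule nn_integral_cong_AE, rule AE_mp[OF AE_lborel_singleton[of c]], intro always_eventually allI impI)
    fix r :: real assume "r \<noteq> c"
    have "(\<integral>\<^sup>+x. indicator {0..} r * (if r < g x then 1 else 0) \<partial>M) = indicator {0..} r * (\<integral>\<^sup>+x. indicator {x. r < g x} x \<partial>M)"
    proof -
      have "(\<integral>\<^sup>+x. indicator {0..} r * (if r < g x then 1 else 0) \<partial>M) = (\<integral>\<^sup>+x. indicator {0..} r * indicator {x. r < g x} x \<partial>M)"
        by (intro nn_integral_cong) (auto split: split_indicator)
      also have "\<dots> = indicator {0..} r * (\<integral>\<^sup>+x. indicator {x. r < g x} x \<partial>M)"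
        by (intro nn_integral_cmult) measurable
      finally show ?thesis .
    qed
    also have "(\<integral>\<^sup>+x. indicator {x. r < g x} x \<partial>M) = ennreal (measure M {x. r < g x})"
      by (simp add: emeasure_eq_measure)
    also have "indicator {0..} r * ennreal (measure M {x. r < g x}) = ennreal (indicator {0..c} r * measure M {x. r < g x})"
    proof (cases "r < c")
      case False
      then have "{x. r < g x} = {}" using assms(3) \<open>r \<noteq> c\<close> by (auto simp: not_less intro: order_trans)
      then show ?thesis by simp
    qed (auto split: split_indicator)
    finally show "(\<integral>\<^sup>+x. indicator {0..} r * (if r < g x then 1 else 0) \<partial>M)
        = ennreal (indicator {0..c} r * measure M {x. r < g x})" .
  qed
  finally show "(\<integral>\<^sup>+r. ennreal (indicator {0..c} r * measure M {x. r < g x}) \<partial>lborel) = ennreal (expectation g)" ..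
  show "AE r in lborel. 0 \<le> indicator {0..c} r * measure M {x. r < g x}" by simp
  show "0 \<le> expectation g" using assms by simp
qed

lemma integral_difference_layer_cake:
  assumes "real_distribution F" "real_distribution G"
    and g: "g \<in> borel_measurable borel" "\<And>x. 0 \<le> g x" "\<And>x. g x \<le> c" and "0 \<le> c"
    and \<eta>: "\<And>r. 0 \<le> r \<Longrightarrow> \<bar>measure F {x. r < g x} - measure G {x. r < g x}\<bar> \<le> \<eta>"
  shows "\<bar>(\<integral>x. g x \<partial>F) - (\<integral>x. g x \<partial>G)\<bar> \<le> \<eta> * c"
proof -
  interpret F: real_distribution F by fact
  interpret G: real_distribution G by fact
  have 1: "has_bochner_integral lborel (\<lambda>r. indicator {0..c} r * measure F {x. r < g x} - indicator {0..c} r * measure G {x. r < g x})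
      ((\<integral>x. g x \<partial>F) - (\<integral>x. g x \<partial>G))"
    by (intro has_bochner_integral_diff F.integral_layer_cake G.integral_layer_cake g)
  have 2: "has_bochner_integral lborel (\<lambda>r. \<eta> * indicator {0..c} r) (\<eta> * c)"
    using has_bochner_integral_mult_right[OF has_bochner_integral_real_indicator[of "{0..c}" lborel], of \<eta>] \<open>0 \<le> c\<close> by simp
  have "norm (\<integral>r. indicator {0..c} r * measure F {x. r < g x} - indicator {0..c} r * measure G {x. r < g x} \<partial>lborel)
     \<le> (\<integral>r. \<eta> * indicator {0..c} r \<partial>lborel)"
    using 1 2 \<eta> by (intro Bochner_Integration.integral_norm_bound_integral)
      (auto simp: has_bochner_integral_iff split: split_indicator)
  then show ?thesis using 1 2 \<open>0 \<le> c\<close> by (simp add: has_bochner_integral_iff)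
qed

lemma measure_lessThan_diff_le:
  assumes "real_distribution F" "real_distribution G" "\<And>x. \<bar>cdf F x - cdf G x\<bar> \<le> \<epsilon>"
  shows "\<bar>measure F {..<x} - measure G {..<x}\<bar> \<le> \<epsilon>"
proof -
  interpret F: real_distribution F by fact
  interpret G: real_distribution G by fact
  have "((\<lambda>x. \<bar>cdf F x - cdf G x\<bar>) \<longlongrightarrow> \<bar>measure F {..<x} - measure G {..<x}\<bar>) (at_left x)"
    by (intro tendsto_intros F.cdf_at_left G.cdf_at_left)
  then show ?thesis
    by (rule tendsto_upperbound) (use assms(3) in \<open>auto intro: always_eventually\<close>)
qed

text \<open>
  The downward closed sets of reals, whose probabilities are controlled directly by distribution functions.
\<close>
definition lower_interval :: "real set \<Rightarrow> bool" where
  "lower_interval D \<longleftrightarrow> D = {} \<or> D = UNIV \<or> (\<exists>x. D = {..x}) \<or> (\<exists>x. D = {..<x})"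

lemma measure_lower_interval_diff:
  assumes "real_distribution F" "real_distribution G" and close: "\<And>x. \<bar>cdf F x - cdf G x\<bar> \<le> \<epsilon>"
    and D: "lower_interval D" "lower_interval D'"
  shows "\<bar>measure F (D' - D) - measure G (D' - D)\<bar> \<le> 2 * \<epsilon>"
proof -
  interpret F: real_distribution F by fact
  interpret G: real_distribution G by fact
  have \<epsilon>: "0 \<le> \<epsilon>" using close[of 0] abs_ge_zero order_trans by blast
  have low: "\<bar>measure F D - measure G D\<bar> \<le> \<epsilon>" if "lower_interval D" for D
    using that measure_lessThan_diff_le[OF assms(1-3)] close \<epsilon> F.prob_space G.prob_space
    unfolding lower_interval_def cdf_def2 by auto
  have sets: "D \<in> sets borel" "D' \<in> sets borel" using D unfolding lower_interval_def by auto
  have down: "y \<in> E" if "lower_interval E" "x \<in> E" "y \<le> x" for x y and E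
    using that unfolding lower_interval_def by auto
  show ?thesis
  proof (cases "D \<subseteq> D'")
    case True
    then show ?thesis
      using low[OF D(1)] low[OF D(2)] sets by (simp add: F.finite_measure_Diff G.finite_measure_Diff)
  next
    case False
    then obtain x where x: "x \<in> D" "x \<notin> D'" by auto
    have "D' - D = {}"
    proof -
      have "y \<in> D" if "y \<in> D'" for y
        using down[OF D(2) that, of x] x down[OF D(1) x(1), of y] by fastforce
      then show ?thesis by auto
    qed
    then have "measure F (D' - D) = 0" "measure G (D' - D) = 0" by (simp_all only: measure_empty)
    then show ?thesis using \<epsilon> by simp
  qed
qed

lemma lower_interval_exp_superlevel:
  fixes t :: real assumes "0 \<le> t" shows "lower_interval {x. r < exp (- t * x)}"
proof (cases "r \<le> 0")
  case True
  then have "{x. r < exp (- t * x)} = UNIV" by (auto intro: le_less_trans)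
  then show ?thesis by (simp add: lower_interval_def)
next
  case r: False
  show ?thesis
  proof (cases "t = 0")
    case True then show ?thesis by (cases "r < 1") (auto simp: lower_interval_def)
  next
    case False
    have "r < exp (- t * x) \<longleftrightarrow> x < - ln r / t" for x
      using r False assms by (subst ln_less_cancel_iff[symmetric]) (auto simp: field_simps)
    then have "{x. r < exp (- t * x)} = {..<- ln r / t}" by auto
    then show ?thesis by (auto simp: lower_interval_def)
  qed
qed

text \<open>
  The superlevel sets of the integrand are differences of two downward closed sets, and the integrand is at
  most \<open>exp (- t d)\<close>.
\<close>
lemma integral_exp_upper_interval_diff:
  assumes "real_distribution F" "real_distribution G" and close: "\<And>x. \<bar>cdf F x - cdf G x\<bar> \<le> \<epsilon>"
    and "0 \<le> t" and A: "A = {d<..} \<or> A = {d..}"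
  shows "\<bar>(\<integral>x. exp (- t * x) * indicator A x \<partial>F) - (\<integral>x. exp (- t * x) * indicator A x \<partial>G)\<bar>
     \<le> 2 * \<epsilon> * exp (- t * d)"
proof (rule integral_difference_layer_cake[OF assms(1,2)])
  have [measurable]: "A \<in> sets borel" using A by auto
  show "(\<lambda>x. exp (- t * x) * indicator A x) \<in> borel_measurable borel" by measurable
  show "exp (- t * x) * indicator A x \<le> exp (- t * d)" for x
    using A \<open>0 \<le> t\<close> by (auto simp: indicator_def intro!: mult_left_mono)
  fix r :: real assume "0 \<le> r"
  have D: "lower_interval (- A)"
    using A by (auto simp: lower_interval_def)
  have "{x. r < exp (- t * x) * indicator A x} = {x. r < exp (- t * x)} - (- A)"
    using \<open>0 \<le> r\<close> by (auto simp: indicator_def)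
  then show "\<bar>measure F {x. r < exp (- t * x) * indicator A x} - measure G {x. r < exp (- t * x) * indicator A x}\<bar> \<le> 2 * \<epsilon>"
    using measure_lower_interval_diff[OF assms(1-3) D lower_interval_exp_superlevel[OF \<open>0 \<le> t\<close>, of r]] by simp
qed auto

section \<open>Exponential tilting\<close>

definition mgf :: "real measure \<Rightarrow> real \<Rightarrow> real" where
  "mgf \<nu> h = (\<integral>x. exp (h * x) \<partial>\<nu>)"

definition tilt :: "real measure \<Rightarrow> real \<Rightarrow> real measure" where
  "tilt \<nu> h = density \<nu> (\<lambda>x. ennreal (exp (h * x) / mgf \<nu> h))"

lemma (in real_distribution) mgf_pos:
  assumes "integrable M (\<lambda>x. exp (h * x))"
  shows "0 < mgf M h"
proof -
  have "(\<integral>\<^sup>+x. ennreal (exp (h * x)) \<partial>M) \<noteq> 0"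
    using emeasure_space_1 by (subst nn_integral_0_iff) (auto simp: ennreal_eq_0_iff)
  then have "ennreal (mgf M h) \<noteq> 0"
    unfolding mgf_def using assms by (subst (asm) nn_integral_eq_integral) auto
  then show ?thesis by (simp add: ennreal_eq_0_iff)
qed

lemma integral_tilt:
  fixes f :: "real \<Rightarrow> real"
  assumes "real_distribution \<nu>" "integrable \<nu> (\<lambda>x. exp (h * x))" "f \<in> borel_measurable borel"
  shows "(\<integral>x. f x \<partial>tilt \<nu> h) = (\<integral>x. exp (h * x) * f x \<partial>\<nu>) / mgf \<nu> h"
    and "integrable (tilt \<nu> h) f \<longleftrightarrow> integrable \<nu> (\<lambda>x. exp (h * x) * f x)"
proof -
  interpret real_distribution \<nu> by fact
  have m: "0 < mgf \<nu> h" by (rule mgf_pos) fact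
  have "(\<integral>x. f x \<partial>tilt \<nu> h) = (\<integral>x. (1 / mgf \<nu> h) * (exp (h * x) * f x) \<partial>\<nu>)"
    unfolding tilt_def using m assms(3) by (subst integral_density) auto
  then show "(\<integral>x. f x \<partial>tilt \<nu> h) = (\<integral>x. exp (h * x) * f x \<partial>\<nu>) / mgf \<nu> h" by simp
  have "integrable (tilt \<nu> h) f \<longleftrightarrow> integrable \<nu> (\<lambda>x. (1 / mgf \<nu> h) * (exp (h * x) * f x))"
    unfolding tilt_def using m assms(3) by (subst integrable_density) auto
  also have "\<dots> \<longleftrightarrow> integrable \<nu> (\<lambda>x. exp (h * x) * f x)"
  proof
    assume "integrable \<nu> (\<lambda>x. (1 / mgf \<nu> h) * (exp (h * x) * f x))"
    then have "integrable \<nu> (\<lambda>x. mgf \<nu> h * ((1 / mgf \<nu> h) * (exp (h * x) * f x)))"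
      by (rule integrable_mult_right)
    then show "integrable \<nu> (\<lambda>x. exp (h * x) * f x)" using m by simp
  qed (rule integrable_mult_right)
  finally show "integrable (tilt \<nu> h) f \<longleftrightarrow> integrable \<nu> (\<lambda>x. exp (h * x) * f x)" .
qed

lemma real_distribution_tilt:
  assumes "real_distribution \<nu>" "integrable \<nu> (\<lambda>x. exp (h * x))"
  shows "real_distribution (tilt \<nu> h)"
proof -
  interpret real_distribution \<nu> by fact
  have m: "0 < mgf \<nu> h" by (rule mgf_pos) fact
  have "emeasure (tilt \<nu> h) (space (tilt \<nu> h)) = (\<integral>\<^sup>+x. ennreal (exp (h * x) / mgf \<nu> h) \<partial>\<nu>)"
    unfolding tilt_def by (simp add: emeasure_density)
  also have "\<dots> = ennreal (\<integral>x. exp (h * x) / mgf \<nu> h \<partial>\<nu>)"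
    using m assms(2) by (intro nn_integral_eq_integral) auto
  also have "\<dots> = 1" using m by (simp add: mgf_def)
  finally have "prob_space (tilt \<nu> h)" by (rule prob_spaceI)
  then show ?thesis
    by (simp add: real_distribution_def real_distribution_axioms_def tilt_def)
qed

lemma conv_power_tilt:
  assumes "real_distribution \<nu>" "integrable \<nu> (\<lambda>x. exp (h * x))"
  shows "conv_power (tilt \<nu> h) n = density (conv_power \<nu> n) (\<lambda>x. ennreal (exp (h * x) / mgf \<nu> h ^ n))"
proof (induction n)
  case 0
  show ?case
  proof (rule measure_eqI)
    fix A :: "real set" assume "A \<in> sets (conv_power (tilt \<nu> h) 0)"
    then have [measurable]: "A \<in> sets borel" by simp
    have "emeasure (density (return borel 0) (\<lambda>x. ennreal (exp (h * x) / mgf \<nu> h ^ 0))) A = indicator A 0"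
      by (subst emeasure_density) (auto simp: nn_integral_return)
    then show "emeasure (conv_power (tilt \<nu> h) 0) A
        = emeasure (density (conv_power \<nu> 0) (\<lambda>x. ennreal (exp (h * x) / mgf \<nu> h ^ 0))) A" by simp
  qed simp
next
  \<comment> \<open>the factor \<open>exp (h x)\<close> turns sums into products, so it commutes with convolution\<close>
  case (Suc n)
  interpret \<nu>: real_distribution \<nu> by fact
  interpret t: real_distribution "tilt \<nu> h" by (rule real_distribution_tilt) fact+
  interpret tc: real_distribution "conv_power (tilt \<nu> h) n" by (rule real_distribution_conv_power) unfold_locales
  interpret c: real_distribution "conv_power \<nu> n" by (rule real_distribution_conv_power) unfold_locales
  have m: "0 < mgf \<nu> h" by (rule \<nu>.mgf_pos) fact
  show ?case
  proof (rule measure_eqI)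
    fix A :: "real set" assume "A \<in> sets (conv_power (tilt \<nu> h) (Suc n))"
    then have [measurable]: "A \<in> sets borel" by simp
    have "emeasure (conv_power (tilt \<nu> h) (Suc n)) A
       = (\<integral>\<^sup>+x. \<integral>\<^sup>+y. indicator A (x + y) \<partial>conv_power (tilt \<nu> h) n \<partial>tilt \<nu> h)"
      by (simp add: convolution_emeasure' t.finite_measure_axioms tc.finite_measure_axioms)
    also have "\<dots> = (\<integral>\<^sup>+x. ennreal (exp (h * x) / mgf \<nu> h) *
        (\<integral>\<^sup>+y. ennreal (exp (h * y) / mgf \<nu> h ^ n) * indicator A (x + y) \<partial>conv_power \<nu> n) \<partial>\<nu>)"
      unfolding Suc by (subst tilt_def, subst nn_integral_density) (auto simp: nn_integral_density)
    also have "\<dots> = (\<integral>\<^sup>+x. \<integral>\<^sup>+y. ennreal (exp (h * (x + y)) / mgf \<nu> h ^ Suc n) * indicator A (x + y) \<partial>conv_power \<nu> n \<partial>\<nu>)"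
    proof (intro nn_integral_cong)
      fix x
      have "ennreal (exp (h * x) / mgf \<nu> h) * (\<integral>\<^sup>+y. ennreal (exp (h * y) / mgf \<nu> h ^ n) * indicator A (x + y) \<partial>conv_power \<nu> n)
        = (\<integral>\<^sup>+y. ennreal (exp (h * x) / mgf \<nu> h) * (ennreal (exp (h * y) / mgf \<nu> h ^ n) * indicator A (x + y)) \<partial>conv_power \<nu> n)"
        by (rule nn_integral_cmult[symmetric]) measurable
      also have "\<dots> = (\<integral>\<^sup>+y. ennreal (exp (h * (x + y)) / mgf \<nu> h ^ Suc n) * indicator A (x + y) \<partial>conv_power \<nu> n)"
        using m by (intro nn_integral_cong)
          (auto simp: mult.assoc[symmetric] ennreal_mult[symmetric] exp_add distrib_left)
      finally show "ennreal (exp (h * x) / mgf \<nu> h) * (\<integral>\<^sup>+y. ennreal (exp (h * y) / mgf \<nu> h ^ n) * indicator A (x + y) \<partial>conv_power \<nu> n)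
        = (\<integral>\<^sup>+y. ennreal (exp (h * (x + y)) / mgf \<nu> h ^ Suc n) * indicator A (x + y) \<partial>conv_power \<nu> n)" .
    qed
    also have "\<dots> = (\<integral>\<^sup>+z. ennreal (exp (h * z) / mgf \<nu> h ^ Suc n) * indicator A z \<partial>conv_power \<nu> (Suc n))"
      by (simp only: conv_power.simps, subst nn_integral_convolution)
         (auto simp: \<nu>.finite_measure_axioms c.finite_measure_axioms)
    also have "\<dots> = emeasure (density (conv_power \<nu> (Suc n)) (\<lambda>x. ennreal (exp (h * x) / mgf \<nu> h ^ Suc n))) A"
      by (rule emeasure_density[symmetric]) (auto simp del: power_Suc)
    finally show "emeasure (conv_power (tilt \<nu> h) (Suc n)) A
        = emeasure (density (conv_power \<nu> (Suc n)) (\<lambda>x. ennreal (exp (h * x) / mgf \<nu> h ^ Suc n))) A" .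
  qed simp
qed

lemma measure_conv_power_tilt:
  assumes "real_distribution \<nu>" "integrable \<nu> (\<lambda>x. exp (h * x))" "A \<in> sets borel"
  shows "measure (conv_power \<nu> n) A = mgf \<nu> h ^ n * (\<integral>x. exp (- h * x) * indicator A x \<partial>conv_power (tilt \<nu> h) n)"
proof -
  interpret \<nu>: real_distribution \<nu> by fact
  interpret c: real_distribution "conv_power \<nu> n" by (rule real_distribution_conv_power) unfold_locales
  have m: "0 < mgf \<nu> h" by (rule \<nu>.mgf_pos) fact
  have [measurable]: "A \<in> sets borel" by fact
  have "(\<integral>x. exp (- h * x) * indicator A x \<partial>conv_power (tilt \<nu> h) n)
     = (\<integral>x. exp (h * x) / mgf \<nu> h ^ n * (exp (- h * x) * indicator A x) \<partial>conv_power \<nu> n)"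
    unfolding conv_power_tilt[OF assms(1,2)] using m by (subst integral_density) auto
  also have "\<dots> = (\<integral>x. (1 / mgf \<nu> h ^ n) * indicator A x \<partial>conv_power \<nu> n)"
    by (intro Bochner_Integration.integral_cong) (auto simp: exp_minus)
  also have "\<dots> = (1 / mgf \<nu> h ^ n) * measure (conv_power \<nu> n) A"
    by simp
  finally show ?thesis using m by simp
qed

text \<open>
  The change of measure turns the tail of the original sum into an integral of \<open>exp (- h x)\<close> under the tilted sum,
  to which the Berry-Esseen theorem applies.  In terms of the standardized tilted sum the half-line starts at
  \<open>d = - sqrt n * \<mu> / s\<close> and the exponent is \<open>h s sqrt n\<close>; the factors \<open>exp (- h n \<mu>)\<close> and \<open>exp (- h s sqrt n d)\<close>
  cancel in the error term.
\<close>
lemma tilted_tail_approximation: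
  assumes \<nu>: "real_distribution \<nu>" and h: "0 \<le> h" "integrable \<nu> (\<lambda>x. exp (h * x))"
    and int3: "integrable (tilt \<nu> h) (\<lambda>x. \<bar>x\<bar> ^ 3)" and \<mu>: "(\<integral>x. x \<partial>tilt \<nu> h) = \<mu>"
    and s: "(\<integral>x. (x - \<mu>)\<^sup>2 \<partial>tilt \<nu> h) = s\<^sup>2" "0 < s" and n: "1 \<le> n"
    and A: "A = {0<..} \<or> A = {0..}"
  shows "\<bar>measure (conv_power \<nu> n) A - mgf \<nu> h ^ n * exp (- h * (real n * \<mu>)) *
       (exp ((h * s * sqrt (real n))\<^sup>2 / 2) * normal_tail (h * s * sqrt (real n) - sqrt (real n) * \<mu> / s))\<bar>
     \<le> mgf \<nu> h ^ n * (2 * (berry_esseen_const * (\<integral>x. \<bar>x - \<mu>\<bar> ^ 3 \<partial>tilt \<nu> h) / (s ^ 3 * sqrt (real n))))"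
proof -
  interpret \<nu>: real_distribution \<nu> by fact
  have m: "0 < mgf \<nu> h" by (rule \<nu>.mgf_pos) fact
  have t: "real_distribution (tilt \<nu> h)" by (rule real_distribution_tilt) fact+
  interpret C: real_distribution "conv_power (tilt \<nu> h) n" by (rule real_distribution_conv_power) fact
  define r where "r = sqrt (real n)"
  have r: "0 < r" "r * r = real n" using n by (simp_all add: r_def)
  define F where "F = distr (conv_power (tilt \<nu> h) n) borel (\<lambda>x. (x - real n * \<mu>) / (s * r))"
  have F: "real_distribution F" unfolding F_def by simp
  define \<epsilon> where "\<epsilon> = berry_esseen_const * (\<integral>x. \<bar>x - \<mu>\<bar> ^ 3 \<partial>tilt \<nu> h) / (s ^ 3 * sqrt (real n))"
  have close: "\<bar>cdf F x - std_normal_cdf x\<bar> \<le> \<epsilon>" for x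
    unfolding F_def r_def \<epsilon>_def by (rule berry_esseen[OF t int3 \<mu> s n])
  define d where "d = - (r * \<mu> / s)"
  define A' where "A' = (if A = {0<..} then {d<..} else {d..})"
  have A': "A' = {d<..} \<or> A' = {d..}" by (auto simp: A'_def)
  have [measurable]: "A \<in> sets borel" "A' \<in> sets borel" using A A' by auto
  have ne: "{0<..} \<noteq> {0::real..}" by (metis atLeast_iff greaterThan_iff order_refl less_irrefl)
  have inA: "(x - real n * \<mu>) / (s * r) \<in> A' \<longleftrightarrow> x \<in> A" for x
  proof -
    have "d < (x - real n * \<mu>) / (s * r) \<longleftrightarrow> 0 < x" "d \<le> (x - real n * \<mu>) / (s * r) \<longleftrightarrow> 0 \<le> x"
    proof -
      have "(x - real n * \<mu>) / (s * r) = x / (s * r) + d"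
        unfolding d_def r(2)[symmetric] using s r(1) by (simp add: field_simps)
      then show "d < (x - real n * \<mu>) / (s * r) \<longleftrightarrow> 0 < x" "d \<le> (x - real n * \<mu>) / (s * r) \<longleftrightarrow> 0 \<le> x"
        using mult_pos_pos[OF s(2) r(1)] by (auto simp: zero_less_divide_iff zero_le_divide_iff)
    qed
    then show ?thesis using A ne by (auto simp: A'_def)
  qed
  have "(\<integral>x. exp (- h * x) * indicator A x \<partial>conv_power (tilt \<nu> h) n)
    = (\<integral>x. exp (- h * (real n * \<mu>)) * (exp (- (h * s * r) * ((x - real n * \<mu>) / (s * r))) * indicator A' ((x - real n * \<mu>) / (s * r))) \<partial>conv_power (tilt \<nu> h) n)"
  proof (intro Bochner_Integration.integral_cong refl)
    fix x
    have "- (h * s * r) * ((x - real n * \<mu>) / (s * r)) = - h * (x - real n * \<mu>)"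
      using s r(1) by simp
    moreover have "exp (- h * x) = exp (- h * (real n * \<mu>)) * exp (- h * (x - real n * \<mu>))"
      by (simp add: exp_add[symmetric] algebra_simps)
    moreover have "indicator A' ((x - real n * \<mu>) / (s * r)) = (indicator A x :: real)"
      using inA by (simp add: indicator_def)
    ultimately show "exp (- h * x) * indicator A x = exp (- h * (real n * \<mu>)) * (exp (- (h * s * r) * ((x - real n * \<mu>) / (s * r))) * indicator A' ((x - real n * \<mu>) / (s * r)))"
      by (simp only: mult.assoc)
  qed
  also have "\<dots> = exp (- h * (real n * \<mu>)) * (\<integral>x. exp (- (h * s * r) * x) * indicator A' x \<partial>F)"
    unfolding F_def by (subst integral_distr) auto
  finally have eq: "measure (conv_power \<nu> n) A = mgf \<nu> h ^ n * exp (- h * (real n * \<mu>)) * (\<integral>x. exp (- (h * s * r) * x) * indicator A' x \<partial>F)"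
    using measure_conv_power_tilt[OF \<nu> h(2), of A n] by simp
  have gauss: "(\<integral>x. exp (- (h * s * r) * x) * indicator A' x \<partial>std_normal_distribution) = exp ((h * s * r)\<^sup>2 / 2) * normal_tail (h * s * r + d)"
    using A' integral_exp_std_normal_Ioi[of "h * s * r" d] integral_exp_std_normal_Ici[of "h * s * r" d] by auto
  have "\<bar>measure (conv_power \<nu> n) A - mgf \<nu> h ^ n * exp (- h * (real n * \<mu>)) * (exp ((h * s * r)\<^sup>2 / 2) * normal_tail (h * s * r + d))\<bar>
     = mgf \<nu> h ^ n * exp (- h * (real n * \<mu>)) * \<bar>(\<integral>x. exp (- (h * s * r) * x) * indicator A' x \<partial>F)
         - (\<integral>x. exp (- (h * s * r) * x) * indicator A' x \<partial>std_normal_distribution)\<bar>"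
    unfolding eq gauss[symmetric] using m by (simp only: right_diff_distrib[symmetric] abs_mult) simp
  also have "\<dots> \<le> mgf \<nu> h ^ n * exp (- h * (real n * \<mu>)) * (2 * \<epsilon> * exp (- (h * s * r) * d))"
    using m h s r(1) by (intro mult_left_mono integral_exp_upper_interval_diff[OF F real_dist_normal_dist close _ A']) auto
  also have "\<dots> = mgf \<nu> h ^ n * (2 * \<epsilon>)"
  proof -
    have "- h * (real n * \<mu>) + - (h * s * r) * d = 0"
      unfolding d_def r(2)[symmetric] using s by simp
    then have "exp (- h * (real n * \<mu>)) * exp (- (h * s * r) * d) = 1"
      unfolding exp_add[symmetric] by simp
    then show ?thesis by (simp add: mult.assoc mult.left_commute)
  qed
  finally show ?thesis unfolding \<epsilon>_def r_def d_def by simp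
qed

text \<open>
  The hypothesis bounds the third absolute moment with the weight \<open>exp (h \<bar>x\<bar>)\<close>, which dominates the Taylor
  remainders of the exponential moments of order \<open>0\<close>, \<open>1\<close> and \<open>2\<close> all at once.
\<close>
lemma (in real_distribution) exponential_moment_expansions:
  assumes h: "0 \<le> h" and int: "integrable M (\<lambda>x. exp (h * \<bar>x\<bar>))" "integrable M (\<lambda>x. \<bar>x\<bar> ^ 3 * exp (h * \<bar>x\<bar>))"
    and B: "expectation (\<lambda>x. \<bar>x\<bar> ^ 3 * exp (h * \<bar>x\<bar>)) \<le> B"
  shows "integrable M (\<lambda>x. exp (h * x))" (is ?I0)
    and "integrable M (\<lambda>x. exp (h * x) * x)" (is ?I1)
    and "integrable M (\<lambda>x. exp (h * x) * x\<^sup>2)" (is ?I2)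
    and "integrable M (\<lambda>x. exp (h * x) * \<bar>x\<bar> ^ 3)" (is ?I3)
    and "\<bar>expectation (\<lambda>x. exp (h * x)) - (1 + h * expectation (\<lambda>x. x) + h\<^sup>2 / 2 * expectation (\<lambda>x. x\<^sup>2))\<bar> \<le> h ^ 3 * B" (is ?E0)
    and "\<bar>expectation (\<lambda>x. exp (h * x) * x) - (expectation (\<lambda>x. x) + h * expectation (\<lambda>x. x\<^sup>2))\<bar> \<le> h\<^sup>2 * B" (is ?E1)
    and "\<bar>expectation (\<lambda>x. exp (h * x) * x\<^sup>2) - expectation (\<lambda>x. x\<^sup>2)\<bar> \<le> h * B" (is ?E2)
    and "expectation (\<lambda>x. exp (h * x) * \<bar>x\<bar> ^ 3) \<le> B" (is ?E3)
proof -
  let ?W = "\<lambda>x. \<bar>x\<bar> ^ 3 * exp (h * \<bar>x\<bar>)"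
  let ?V = "\<lambda>x. exp (h * \<bar>x\<bar>) + ?W x"
  have V: "integrable M ?V" using int by auto
  have hx: "exp (h * x) \<le> exp (h * \<bar>x\<bar>)" for x using h by (simp add: mult_left_mono)
  have one: "1 \<le> exp (h * \<bar>x\<bar>)" for x using h by simp
  note pw = abs_power_le_one_plus_cube
  have dom: "exp (h * x) * \<bar>x\<bar> ^ k \<le> ?V x" "\<bar>x\<bar> ^ k \<le> ?V x" if "k \<le> 3" for x k
  proof -
    have "exp (h * x) * \<bar>x\<bar> ^ k \<le> exp (h * \<bar>x\<bar>) * (1 + \<bar>x\<bar> ^ 3)"
      by (intro mult_mono hx pw that) auto
    then show "exp (h * x) * \<bar>x\<bar> ^ k \<le> ?V x" by (simp add: algebra_simps)
    have "1 * \<bar>x\<bar> ^ k \<le> exp (h * \<bar>x\<bar>) * (1 + \<bar>x\<bar> ^ 3)"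
      by (intro mult_mono one pw that) auto
    then show "\<bar>x\<bar> ^ k \<le> ?V x" by (simp add: algebra_simps)
  qed
  have V0: "0 \<le> ?V x" for x by (intro add_nonneg_nonneg) auto
  have intk: "integrable M (\<lambda>x. exp (h * x) * x ^ k)" "integrable M (\<lambda>x. x ^ k)" if "k \<le> 3" for k
    by (rule Bochner_Integration.integrable_bound[OF V];
        use dom[OF that] V0 in \<open>auto simp: abs_mult power_abs\<close>)+
  show I0: ?I0 using intk(1)[of 0] by simp
  show I1: ?I1 using intk(1)[of 1] by simp
  show I2: ?I2 using intk(1)[of 2] by simp
  show I3: ?I3
    by (rule Bochner_Integration.integrable_bound[OF V]) (use dom[of 3] V0 in \<open>auto simp: abs_mult power_abs\<close>)
  have J1: "integrable M (\<lambda>x. x)" using intk(2)[of 1] by simp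
  have J2: "integrable M (\<lambda>x. x\<^sup>2)" using intk(2)[of 2] by simp
  have bnd: "\<bar>expectation f\<bar> \<le> c * B" if "integrable M f" "\<And>x. \<bar>f x\<bar> \<le> c * ?W x" "0 \<le> c" for f c
  proof -
    have "\<bar>expectation f\<bar> \<le> expectation (\<lambda>x. \<bar>f x\<bar>)" by (rule integral_abs_bound)
    also have "\<dots> \<le> expectation (\<lambda>x. c * ?W x)" using that int by (intro integral_mono) auto
    also have "\<dots> = c * expectation ?W" by simp
    also have "\<dots> \<le> c * B" using B that by (intro mult_left_mono) auto
    finally show ?thesis .
  qed
  have absh: "\<bar>h * x\<bar> = h * \<bar>x\<bar>" for x using h by (simp add: abs_mult)
  have "\<bar>expectation (\<lambda>x. exp (h * x) - (1 + h * x + h\<^sup>2 / 2 * x\<^sup>2))\<bar> \<le> h ^ 3 * B"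
  proof (rule bnd)
    show "\<bar>exp (h * x) - (1 + h * x + h\<^sup>2 / 2 * x\<^sup>2)\<bar> \<le> h ^ 3 * ?W x" for x
      using exp_Taylor_bound[of "h * x" 3] unfolding absh
      by (simp add: eval_nat_numeral power_mult_distrib mult_ac)
  qed (use I0 J1 J2 h in auto)
  then show ?E0 using I0 J1 J2 prob_space by simp
  have "\<bar>expectation (\<lambda>x. exp (h * x) * x - (x + h * x\<^sup>2))\<bar> \<le> h\<^sup>2 * B"
  proof (rule bnd)
    show "\<bar>exp (h * x) * x - (x + h * x\<^sup>2)\<bar> \<le> h\<^sup>2 * ?W x" for x
    proof -
      have "\<bar>exp (h * x) * x - (x + h * x\<^sup>2)\<bar> = \<bar>exp (h * x) - (1 + h * x)\<bar> * \<bar>x\<bar>"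
      proof -
        have "exp (h * x) * x - (x + h * x\<^sup>2) = (exp (h * x) - (1 + h * x)) * x"
          by (simp add: algebra_simps power2_eq_square)
        then show ?thesis by (simp only: abs_mult)
      qed
      also have "\<dots> \<le> ((h * \<bar>x\<bar>)\<^sup>2 * exp (h * \<bar>x\<bar>)) * \<bar>x\<bar>"
        using exp_Taylor_bound[of "h * x" 2] unfolding absh
        by (intro mult_right_mono) (auto simp: eval_nat_numeral)
      finally show ?thesis by (simp add: power2_eq_square power3_eq_cube mult_ac)
    qed
  qed (use I1 J1 J2 h in auto)
  then show ?E1 using I1 J1 J2 by simp
  have "\<bar>expectation (\<lambda>x. exp (h * x) * x\<^sup>2 - x\<^sup>2)\<bar> \<le> h * B"
  proof (rule bnd)
    show "\<bar>exp (h * x) * x\<^sup>2 - x\<^sup>2\<bar> \<le> h * ?W x" for x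
    proof -
      have "\<bar>exp (h * x) * x\<^sup>2 - x\<^sup>2\<bar> = \<bar>exp (h * x) - 1\<bar> * x\<^sup>2"
      proof -
        have "exp (h * x) * x\<^sup>2 - x\<^sup>2 = (exp (h * x) - 1) * x\<^sup>2" by (simp add: algebra_simps)
        then show ?thesis by (simp add: abs_mult)
      qed
      also have "\<dots> \<le> (h * \<bar>x\<bar> * exp (h * \<bar>x\<bar>)) * x\<^sup>2"
        using exp_Taylor_bound[of "h * x" 1] unfolding absh
        by (intro mult_right_mono) (auto simp: eval_nat_numeral)
      finally show ?thesis by (simp add: power2_eq_square power3_eq_cube mult_ac)
    qed
  qed (use I2 J2 h in auto)
  then show ?E2 using I2 J2 by simp
  have "expectation (\<lambda>x. exp (h * x) * \<bar>x\<bar> ^ 3) \<le> expectation ?W"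
    using I3 int hx by (intro integral_mono) (auto simp: mult.commute[of "_ ^ 3"] intro!: mult_right_mono)
  then show ?E3 using B by simp
qed

section \<open>Saddle-point expansion\<close>

text \<open>
  The arithmetic of Cramer's method for summands of approximate mean \<open>- z r\<close> and second moment \<open>1\<close>, where
  \<open>r = 1 / sqrt n\<close> and the tilt is \<open>h = z r\<close>.  Here \<open>m1\<close>, \<open>m2\<close> are the moments, \<open>M\<close>, \<open>M1\<close>, \<open>M2\<close> the moments of
  order \<open>0\<close>, \<open>1\<close>, \<open>2\<close> weighted by \<open>exp (h x)\<close>, and \<open>\<mu>\<close>, \<open>s2\<close> the tilted mean and variance.  The errors are compared
  with the target rate \<open>\<epsilon>\<close>.  The numerical constants are not optimized; it matters only that they depend on \<open>B\<close>
  alone.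
\<close>
locale saddle_point_expansion =
  fixes B r z m1 m2 M M1 M2 \<epsilon> \<mu> s2 :: real
  assumes B: "1 \<le> B" and r: "0 < r" "r \<le> 1 / (100 * B\<^sup>2)"
    and z: "0 \<le> z" "z * r \<le> 1 / (100 * B\<^sup>2)" "z ^ 3 * r \<le> 1"
    and m1: "\<bar>m1 + z * r\<bar> \<le> B * r\<^sup>2" and m2: "\<bar>m2 - 1\<bar> \<le> B * ((1 + z) * r)"
    and M: "\<bar>M - (1 + (z * r) * m1 + (z * r)\<^sup>2 / 2 * m2)\<bar> \<le> (z * r) ^ 3 * B"
    and M1: "\<bar>M1 - (m1 + (z * r) * m2)\<bar> \<le> (z * r)\<^sup>2 * B"
    and M2: "\<bar>M2 - m2\<bar> \<le> (z * r) * B"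
    and \<epsilon>: "\<epsilon> = (1 + z ^ 3) * r" and \<mu>: "\<mu> = M1 / M" and s2: "s2 = M2 / M - \<mu>\<^sup>2"
begin

lemma B_square_ge: "B \<le> B\<^sup>2" "1 \<le> B\<^sup>2"
  using B by (auto simp: power2_eq_square intro: order_trans[OF _ mult_mono[of 1 B 1 B]])

lemma r_h_small: "r \<le> 1 / 100" "z * r \<le> 1 / 100"
proof -
  have "1 / (100 * B\<^sup>2) \<le> 1 / 100" using B_square_ge by (intro divide_left_mono) auto
  then show "r \<le> 1 / 100" "z * r \<le> 1 / 100" using r z by auto
qed

lemma z_powers: "z \<le> 1 + z ^ 3" "z\<^sup>2 \<le> 1 + z ^ 3" "0 \<le> z ^ 3" "z \<le> 1 + z\<^sup>2"
proof -
  have "z ^ k \<le> 1 + z ^ 3" if "k \<le> 3" for k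
    using abs_power_le_one_plus_cube[OF that, of z] z(1) by simp
  from this[of 1] this[of 2] show "z \<le> 1 + z ^ 3" "z\<^sup>2 \<le> 1 + z ^ 3" by auto
  show "0 \<le> z ^ 3" using z by simp
  show "z \<le> 1 + z\<^sup>2" using sum_squares_bound[of z 1] z(1) by (simp add: power2_eq_square)
qed

lemma \<epsilon>_bounds: "0 < \<epsilon>" "r \<le> \<epsilon>" "z * r \<le> \<epsilon>" "z\<^sup>2 * r \<le> \<epsilon>" "z ^ 3 * r \<le> \<epsilon>" "\<epsilon> \<le> 2"
proof -
  show "0 < \<epsilon>" unfolding \<epsilon> using r z_powers by (intro mult_pos_pos add_pos_nonneg) auto
  show "z * r \<le> \<epsilon>" "z\<^sup>2 * r \<le> \<epsilon>" unfolding \<epsilon> using r z_powers by (intro mult_right_mono; simp)+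
  show "r \<le> \<epsilon>" "z ^ 3 * r \<le> \<epsilon>" unfolding \<epsilon> using r z_powers by (auto simp: algebra_simps)
  show "\<epsilon> \<le> 2" unfolding \<epsilon> using r_h_small z by (simp add: algebra_simps)
qed

text \<open>
  With \<open>h = z r\<close> the first moment contributes \<open>- h^2\<close> and the second \<open>h^2 / 2\<close>, which leaves \<open>- h^2 / 2\<close>.
\<close>
lemma mgf_remainder: "\<bar>M - 1 + (z * r)\<^sup>2 / 2\<bar> \<le> 3 * B * (r\<^sup>2 * \<epsilon>)"
proof -
  let ?h = "z * r"
  have h: "0 \<le> ?h" using z r by simp
  have eq: "M - 1 + ?h\<^sup>2 / 2 = (M - (1 + ?h * m1 + ?h\<^sup>2 / 2 * m2)) + ?h * (m1 + z * r) + ?h\<^sup>2 / 2 * (m2 - 1)"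
    by (simp add: field_simps power2_eq_square)
  have "\<bar>M - 1 + ?h\<^sup>2 / 2\<bar> \<le> \<bar>M - (1 + ?h * m1 + ?h\<^sup>2 / 2 * m2)\<bar> + \<bar>?h * (m1 + z * r)\<bar> + \<bar>?h\<^sup>2 / 2 * (m2 - 1)\<bar>"
    unfolding eq by linarith
  also have "\<dots> \<le> ?h ^ 3 * B + ?h * (B * r\<^sup>2) + ?h\<^sup>2 / 2 * (B * ((1 + z) * r))"
    unfolding abs_mult using h r z m1 m2 M by (intro add_mono mult_mono) auto
  also have "\<dots> = B * (r\<^sup>2 * (3 / 2 * (z ^ 3 * r) + z * r + 1 / 2 * (z\<^sup>2 * r)))"
    by (simp add: field_simps power2_eq_square power3_eq_cube)
  also have "\<dots> \<le> B * (r\<^sup>2 * (3 * \<epsilon>))"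
    using B \<epsilon>_bounds by (intro mult_left_mono) auto
  finally show ?thesis by (simp add: mult_ac)
qed

lemma B_r_small: "B * r\<^sup>2 \<le> 1 / 100 * r" "B\<^sup>2 * r \<le> 1 / 100" "B * r \<le> 1 / 100"
proof -
  show 1: "B\<^sup>2 * r \<le> 1 / 100" using mult_left_mono[OF r(2), of "B\<^sup>2"] B by simp
  have "B * r \<le> B\<^sup>2 * r" using B_square_ge r by (intro mult_right_mono) auto
  with 1 show 2: "B * r \<le> 1 / 100" by simp
  have "B * r * r \<le> 1 / 100 * r" using 2 r by (intro mult_right_mono) auto
  then show "B * r\<^sup>2 \<le> 1 / 100 * r" by (simp add: power2_eq_square)
qed

lemma remainder_small: "3 * B * (r\<^sup>2 * \<epsilon>) \<le> 6 / 100 * r"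
proof -
  have "B * r\<^sup>2 * \<epsilon> \<le> B * r\<^sup>2 * 2" using B \<epsilon>_bounds by (intro mult_left_mono) auto
  also have "\<dots> \<le> (1 / 100 * r) * 2" using B_r_small by simp
  finally show ?thesis by (simp add: mult_ac)
qed

lemma h_square_small: "(z * r)\<^sup>2 \<le> z * r / 100" 
  using mult_left_mono[OF r_h_small(2), of "z * r"] z r by (simp add: power2_eq_square)

lemma M_near_1: "\<bar>M - 1\<bar> \<le> (1 + z) * r / 10" "\<bar>M - 1\<bar> \<le> 1 / 100" "1 / 2 \<le> M"
proof -
  have "\<bar>M - 1\<bar> \<le> 3 * B * (r\<^sup>2 * \<epsilon>) + (z * r)\<^sup>2 / 2"
    using mgf_remainder zero_le_power2[of "z * r"] by linarith
  also have "\<dots> \<le> 6 / 100 * r + z * r / 100 / 2" using h_square_small remainder_small by linarith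
  finally have *: "\<bar>M - 1\<bar> \<le> 6 / 100 * r + z * r / 200" by simp
  have "0 \<le> z * r" using z r by simp
  then show "\<bar>M - 1\<bar> \<le> (1 + z) * r / 10" 
  proof -
    have "(1 + z) * r / 10 = r / 10 + z * r / 10" by (simp add: algebra_simps add_divide_distrib)
    then show ?thesis using * r \<open>0 \<le> z * r\<close> by linarith
  qed
  show 2: "\<bar>M - 1\<bar> \<le> 1 / 100" using * r_h_small by simp
  then show "1 / 2 \<le> M" by linarith
qed

text \<open>
  As \<open>n = 1 / r^2\<close>, the first term is \<open>n\<close> times the cumulant generating function at \<open>h\<close>: the source of the
  Gaussian factor \<open>exp (- z^2 / 2)\<close>.
\<close>
lemma log_mgf: "\<bar>ln M / r\<^sup>2 + z\<^sup>2 / 2\<bar> \<le> 5 * B * \<epsilon>"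
proof -
  define x where "x = M - 1"
  define E where "E = x + (z * r)\<^sup>2 / 2"
  have E: "\<bar>E\<bar> \<le> 3 * B * (r\<^sup>2 * \<epsilon>)" using mgf_remainder by (simp add: E_def x_def)
  have x: "\<bar>x\<bar> \<le> 1 / 2" using M_near_1 by (simp add: x_def)
  have "\<bar>ln (1 + x) - x\<bar> \<le> 2 * x\<^sup>2" by (rule abs_ln_one_plus_x_minus_x_bound[OF x])
  also have "\<dots> \<le> 2 * (B * (r\<^sup>2 * \<epsilon>))"
  proof -
    have "0 \<le> (E + (z * r)\<^sup>2 / 2)\<^sup>2" by simp
    then have "x\<^sup>2 \<le> 2 * E\<^sup>2 + ((z * r)\<^sup>2)\<^sup>2 / 2"
      unfolding E_def by (simp add: power2_eq_square field_simps)
    also have "\<dots> \<le> 2 * (3 * B * (r\<^sup>2 * \<epsilon>) * (6 / 100 * r)) + r\<^sup>2 * \<epsilon> / 100 / 2"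
    proof -
      have "\<bar>E\<bar> \<le> 6 / 100 * r" "0 \<le> 3 * B * (r\<^sup>2 * \<epsilon>)" using E remainder_small abs_ge_zero[of E] by linarith+
      have "E\<^sup>2 = \<bar>E\<bar> * \<bar>E\<bar>" by (simp add: power2_eq_square)
      also have "\<dots> \<le> (3 * B * (r\<^sup>2 * \<epsilon>)) * (6 / 100 * r)"
        by (intro mult_mono) (use \<open>\<bar>E\<bar> \<le> 6 / 100 * r\<close> \<open>0 \<le> 3 * B * (r\<^sup>2 * \<epsilon>)\<close> E in auto)
      finally have 1: "E\<^sup>2 \<le> 3 * B * (r\<^sup>2 * \<epsilon>) * (6 / 100 * r)" .
      have "((z * r)\<^sup>2)\<^sup>2 = r\<^sup>2 * ((z ^ 3 * r) * (z * r))" by (simp add: power2_eq_square power3_eq_cube)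
      also have "\<dots> \<le> r\<^sup>2 * (\<epsilon> * (1 / 100))"
        using \<epsilon>_bounds r_h_small z r z_powers by (intro mult_left_mono mult_mono) auto
      finally show ?thesis using 1 by linarith
    qed
    also have "\<dots> \<le> B * (r\<^sup>2 * \<epsilon>)"
    proof -
      have p: "0 \<le> r\<^sup>2 * \<epsilon>" using \<epsilon>_bounds by simp
      then have q: "0 \<le> B * (r\<^sup>2 * \<epsilon>)" "r\<^sup>2 * \<epsilon> \<le> B * (r\<^sup>2 * \<epsilon>)" using B by (auto simp: mult_le_cancel_right1)
      have "3 * B * (r\<^sup>2 * \<epsilon>) * (6 / 100 * r) \<le> 3 * B * (r\<^sup>2 * \<epsilon>) * (6 / 100)"
        using r_h_small(1) q(1) by (intro mult_left_mono) (auto simp: mult.assoc mult.commute)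
      then show ?thesis using q by linarith
    qed
    finally show ?thesis by simp
  qed
  finally have "\<bar>ln M + (z * r)\<^sup>2 / 2\<bar> \<le> 5 * B * (r\<^sup>2 * \<epsilon>)"
    using E unfolding E_def x_def by simp
  moreover have "ln M / r\<^sup>2 + z\<^sup>2 / 2 = (ln M + (z * r)\<^sup>2 / 2) / r\<^sup>2"
    using r by (simp add: field_simps)
  moreover have "5 * B * (r\<^sup>2 * \<epsilon>) = (5 * B * \<epsilon>) * r\<^sup>2" by simp
  ultimately show ?thesis using r by (simp add: pos_divide_le_eq)
qed

text \<open>
  The tilt by \<open>h = z r\<close> moves the mean by about \<open>h\<close>, which cancels the initial drift \<open>- z r\<close>.
\<close>
lemma tilted_mean: "\<bar>\<mu>\<bar> \<le> 6 * B * (r\<^sup>2 * (1 + z\<^sup>2))"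
proof -
  let ?h = "z * r"
  have h: "0 \<le> ?h" using z r by simp
  have eq: "M1 = (M1 - (m1 + ?h * m2)) + (m1 + z * r) + ?h * (m2 - 1)"
    by (simp add: algebra_simps)
  have "\<bar>M1\<bar> \<le> \<bar>M1 - (m1 + ?h * m2)\<bar> + \<bar>m1 + z * r\<bar> + \<bar>?h * (m2 - 1)\<bar>"
    by (subst eq) linarith
  also have "\<dots> \<le> ?h\<^sup>2 * B + B * r\<^sup>2 + ?h * (B * ((1 + z) * r))"
    unfolding abs_mult[of ?h] using h r z m1 m2 M1 by (intro add_mono mult_mono) auto
  also have "\<dots> = B * (r\<^sup>2 * (1 + z + 2 * z\<^sup>2))"
    by (simp add: algebra_simps power2_eq_square)
  also have "\<dots> \<le> B * (r\<^sup>2 * (3 * (1 + z\<^sup>2)))"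
    using B z_powers by (intro mult_left_mono) auto
  finally have 1: "\<bar>M1\<bar> \<le> 3 * B * (r\<^sup>2 * (1 + z\<^sup>2))" by (simp add: algebra_simps)
  have "\<bar>\<mu>\<bar> = \<bar>M1\<bar> / M" using M_near_1 by (simp add: \<mu>)
  also have "\<dots> \<le> (3 * B * (r\<^sup>2 * (1 + z\<^sup>2))) / (1 / 2)"
    using 1 M_near_1 by (intro frac_le) auto
  finally show ?thesis by simp
qed

lemma r_z_small: "r\<^sup>2 * (1 + z\<^sup>2) \<le> r * (1 + z) / 100" "B\<^sup>2 * (r * (1 + z)) \<le> 2 / 100"
proof -
  have "r * r \<le> 1 / 100 * r" "(z * r) * (z * r) \<le> (1 / 100) * (z * r)"
    using mult_right_mono[OF r_h_small(1), of r] mult_right_mono[OF r_h_small(2), of "z * r"] r z by auto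
  then show "r\<^sup>2 * (1 + z\<^sup>2) \<le> r * (1 + z) / 100"
    by (simp add: power2_eq_square algebra_simps)
  have "B\<^sup>2 * (z * r) \<le> 1 / 100" using mult_left_mono[OF z(2), of "B\<^sup>2"] B by simp
  then show "B\<^sup>2 * (r * (1 + z)) \<le> 2 / 100" using B_r_small by (simp add: algebra_simps)
qed

lemma tilted_mean_small: "\<bar>\<mu>\<bar> \<le> B * (r * (1 + z)) / 10" "\<bar>\<mu>\<bar> \<le> 1"
proof -
  have "6 * B * (r\<^sup>2 * (1 + z\<^sup>2)) \<le> 6 * B * (r * (1 + z) / 100)"
    using r_z_small B by (intro mult_left_mono) auto
  also have "\<dots> \<le> B * (r * (1 + z)) / 10" using B r z by simp
  finally show 1: "\<bar>\<mu>\<bar> \<le> B * (r * (1 + z)) / 10" using tilted_mean by linarith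
  have "B * (r * (1 + z)) \<le> B\<^sup>2 * (r * (1 + z))" using B_square_ge r z by (intro mult_right_mono) auto
  then show "\<bar>\<mu>\<bar> \<le> 1" using 1 r_z_small by linarith
qed

lemma drift: "\<bar>z * r * \<mu> / r\<^sup>2\<bar> \<le> 12 * B * \<epsilon>"
proof -
  have "\<bar>z * r * \<mu> / r\<^sup>2\<bar> = z * \<bar>\<mu>\<bar> / r"
    using z r by (simp add: abs_mult power2_eq_square)
  also have "\<dots> \<le> z * (6 * B * (r\<^sup>2 * (1 + z\<^sup>2))) / r"
    using z r tilted_mean by (intro divide_right_mono mult_left_mono) auto
  also have "\<dots> = 6 * B * (z * r + z ^ 3 * r)"
    using r by (simp add: power2_eq_square power3_eq_cube field_simps)
  also have "\<dots> \<le> 6 * B * (\<epsilon> + \<epsilon>)" using B \<epsilon>_bounds by (intro mult_left_mono add_mono) auto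
  finally show ?thesis by simp
qed

lemma tilted_variance: "\<bar>s2 - 1\<bar> \<le> 10 * B\<^sup>2 * (r * (1 + z))" "1 / 4 \<le> s2"
proof -
  let ?q = "r * (1 + z)"
  have q: "0 \<le> ?q" using r z by simp
  have Bq: "?q \<le> B\<^sup>2 * ?q" "B * ?q \<le> B\<^sup>2 * ?q" using q B_square_ge by (auto intro: mult_right_mono simp: mult_le_cancel_right1)
  have "\<bar>M2 - 1\<bar> \<le> \<bar>M2 - m2\<bar> + \<bar>m2 - 1\<bar>" by linarith
  also have "\<dots> \<le> (z * r) * B + B * ((1 + z) * r)" using M2 m2 by (rule add_mono)
  also have "\<dots> \<le> 2 * (B * ?q)" using B r z by (simp add: algebra_simps)
  finally have a: "\<bar>M2 - 1\<bar> \<le> 2 * (B * ?q)" .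
  have MM: "\<bar>M2 - M\<bar> \<le> 2 * (B * ?q) + ?q / 10"
    using a M_near_1(1) by (simp only: mult.commute[of "1 + z"])
  have "M2 / M - 1 = (M2 - M) / M"
    using M_near_1 by (simp add: field_simps)
  then have "\<bar>M2 / M - 1\<bar> = \<bar>M2 - M\<bar> / M"
    using M_near_1 by simp
  also have "\<dots> \<le> (2 * (B * ?q) + ?q / 10) / (1 / 2)"
    using M_near_1(3) MM order_trans[OF abs_ge_zero MM] by (intro frac_le) auto
  finally have b: "\<bar>M2 / M - 1\<bar> \<le> 4 * (B * ?q) + ?q / 5" by simp
  have "\<mu>\<^sup>2 = \<bar>\<mu>\<bar> * \<bar>\<mu>\<bar>" by (simp add: power2_eq_square)
  also have "\<dots> \<le> 1 * (B * ?q / 10)" using tilted_mean_small by (intro mult_mono) auto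
  finally have "\<bar>s2 - 1\<bar> \<le> 4 * (B * ?q) + ?q / 5 + B * ?q / 10"
    using b zero_le_power2[of \<mu>] unfolding s2 by linarith
  then show 1: "\<bar>s2 - 1\<bar> \<le> 10 * B\<^sup>2 * ?q" using Bq q by linarith
  then show "1 / 4 \<le> s2" using r_z_small by linarith
qed

text \<open>
  The tilted sum, standardized, is compared with a normal variable at the argument in the second claim; it
  differs from \<open>z\<close> by the error of the tilted standard deviation and by the standardized tilted mean.
\<close>
lemma normal_argument:
  shows "\<bar>(z * r * sqrt s2 / r)\<^sup>2 / 2 - z\<^sup>2 / 2\<bar> \<le> 10 * B\<^sup>2 * \<epsilon>"
    and "\<bar>z * r * sqrt s2 / r - \<mu> / (r * sqrt s2) - z\<bar> \<le> 40 * B\<^sup>2 * ((1 + z\<^sup>2) * r)"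
    and "1 / 2 \<le> sqrt s2"
proof -
  define s where "s = sqrt s2"
  have ss: "s\<^sup>2 = s2" "1 / 2 \<le> s"
    using tilted_variance real_sqrt_le_mono[OF tilted_variance(2)] by (auto simp: s_def real_sqrt_divide)
  then show "1 / 2 \<le> sqrt s2" by (simp add: s_def)
  have "\<bar>(z * r * s / r)\<^sup>2 / 2 - z\<^sup>2 / 2\<bar> = z\<^sup>2 * \<bar>s2 - 1\<bar> / 2"
  proof -
    have "(z * r * s / r)\<^sup>2 / 2 - z\<^sup>2 / 2 = z\<^sup>2 * (s2 - 1) / 2"
      using r unfolding ss(1)[symmetric] by (simp add: power_mult_distrib algebra_simps)
    then show ?thesis by (simp only: abs_mult abs_divide abs_power2)
  qed
  also have "\<dots> \<le> z\<^sup>2 * (10 * B\<^sup>2 * (r * (1 + z))) / 2"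
    using tilted_variance by (intro divide_right_mono mult_left_mono) auto
  also have "\<dots> = 5 * B\<^sup>2 * (z\<^sup>2 * r + z ^ 3 * r)" by (simp add: algebra_simps power2_eq_square power3_eq_cube)
  also have "\<dots> \<le> 5 * B\<^sup>2 * (\<epsilon> + \<epsilon>)" using \<epsilon>_bounds by (intro mult_left_mono add_mono) auto
  finally show "\<bar>(z * r * sqrt s2 / r)\<^sup>2 / 2 - z\<^sup>2 / 2\<bar> \<le> 10 * B\<^sup>2 * \<epsilon>" by (simp add: s_def)
  have "\<bar>s - 1\<bar> \<le> \<bar>s - 1\<bar> * (s + 1)" using ss(2) by (simp add: mult_le_cancel_left1)
  also have "\<dots> = \<bar>s2 - 1\<bar>" 
  proof -
    have "s2 - 1 = (s - 1) * (s + 1)" unfolding ss(1)[symmetric] by (simp add: power2_eq_square algebra_simps)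
    then show ?thesis using ss(2) by (simp add: abs_mult)
  qed
  also note tilted_variance(1)
  finally have s1: "\<bar>s - 1\<bar> \<le> 10 * B\<^sup>2 * (r * (1 + z))" .
  have "\<bar>z * s - z\<bar> = z * \<bar>s - 1\<bar>" 
  proof -
    have "z * s - z = z * (s - 1)" by (simp add: algebra_simps)
    then show ?thesis using z by (simp add: abs_mult)
  qed
  also have "\<dots> \<le> z * (10 * B\<^sup>2 * (r * (1 + z)))" using s1 z by (intro mult_left_mono) auto
  also have "\<dots> = 10 * B\<^sup>2 * ((z + z\<^sup>2) * r)" by (simp add: algebra_simps power2_eq_square)
  also have "\<dots> \<le> 10 * B\<^sup>2 * ((2 * (1 + z\<^sup>2)) * r)" using z_powers r by (intro mult_left_mono mult_right_mono) auto
  finally have 1: "\<bar>z * s - z\<bar> \<le> 20 * B\<^sup>2 * ((1 + z\<^sup>2) * r)" by (simp add: algebra_simps)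
  have "\<bar>\<mu> / (r * s)\<bar> = \<bar>\<mu>\<bar> / r / s" using r ss by (simp add: abs_mult)
  also have "\<dots> \<le> (6 * B * (r\<^sup>2 * (1 + z\<^sup>2))) / r / (1 / 2)"
    using ss r tilted_mean by (intro frac_le) (auto intro!: divide_right_mono)
  also have "\<dots> = 12 * B * ((1 + z\<^sup>2) * r)" using r by (simp add: power2_eq_square)
  also have "\<dots> \<le> 12 * B\<^sup>2 * ((1 + z\<^sup>2) * r)" using B_square_ge r by (intro mult_right_mono) auto
  finally have 2: "\<bar>\<mu> / (r * s)\<bar> \<le> 12 * B\<^sup>2 * ((1 + z\<^sup>2) * r)" .
  have "0 \<le> B\<^sup>2 * ((1 + z\<^sup>2) * r)" using r by (intro mult_nonneg_nonneg) auto
  with 1 2 have "\<bar>z * s - \<mu> / (r * s) - z\<bar> \<le> 40 * B\<^sup>2 * ((1 + z\<^sup>2) * r)" by linarith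
  then show "\<bar>z * r * sqrt s2 / r - \<mu> / (r * sqrt s2) - z\<bar> \<le> 40 * B\<^sup>2 * ((1 + z\<^sup>2) * r)"
    using r by (simp add: s_def)
qed

end

text \<open>
  An admissible constant for \<open>cramer_unit_variance_bound\<close>: the first summand comes from the Berry-Esseen error,
  the second from the exponent and from the shift of the argument of the normal tail.
\<close>
definition cramer_const :: "real \<Rightarrow> real" where
  "cramer_const B = (let K = exp (3 / 2) * (160 * B\<^sup>2) * exp (320 * B\<^sup>2)
     in 1152 * exp (10 * B + 3 / 2) * berry_esseen_const * B + (27 * B\<^sup>2 * exp (54 * B\<^sup>2) * (1 + 2 * K) + K))"

text \<open>
  The normal approximation of the tilted tail is \<open>exp a\<close> times the normal tail at \<open>z + e\<close>, and the Taylor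
  expansions show that \<open>a = O(\<epsilon>)\<close> and \<open>(1 + z) e = O(\<epsilon>)\<close>.  The Berry-Esseen error carries the factor
  \<open>mgf^n \<approx> exp (- z^2 / 2)\<close>, which is at most a multiple of \<open>1 + z\<close> times the normal tail.
\<close>
lemma cramer_unit_variance_bound:
  fixes B r z :: real
  assumes \<nu>: "real_distribution \<nu>" and B: "1 \<le> B" and n: "1 \<le> n" and r_def: "r = 1 / sqrt (real n)"
    and r: "r \<le> 1 / (100 * B\<^sup>2)"
    and z: "0 \<le> z" "z * r \<le> 1 / (100 * B\<^sup>2)" "z ^ 3 * r \<le> 1"
    and int: "integrable \<nu> (\<lambda>x. exp (z * r * \<bar>x\<bar>))" "integrable \<nu> (\<lambda>x. \<bar>x\<bar> ^ 3 * exp (z * r * \<bar>x\<bar>))"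
    and le_B: "(\<integral>x. \<bar>x\<bar> ^ 3 * exp (z * r * \<bar>x\<bar>) \<partial>\<nu>) \<le> B"
    and m1: "\<bar>(\<integral>x. x \<partial>\<nu>) + z * r\<bar> \<le> B * r\<^sup>2" and m2: "\<bar>(\<integral>x. x\<^sup>2 \<partial>\<nu>) - 1\<bar> \<le> B * ((1 + z) * r)"
    and A: "A = {0<..} \<or> A = {0..}"
  shows "\<bar>measure (conv_power \<nu> n) A / normal_tail z - 1\<bar> \<le> cramer_const B * ((1 + z ^ 3) * r)"
proof -
  interpret \<nu>: real_distribution \<nu> by fact
  define K2 where "K2 = exp (3 / 2) * (160 * B\<^sup>2) * exp (320 * B\<^sup>2)"
  define C where "C = 1152 * exp (10 * B + 3 / 2) * berry_esseen_const * B + (27 * B\<^sup>2 * exp (54 * B\<^sup>2) * (1 + 2 * K2) + K2)"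
  have C: "C = cramer_const B" by (simp add: C_def K2_def cramer_const_def)
  define h where "h = z * r"
  have r0: "0 < r" using n by (simp add: r_def)
  have sqrtn: "sqrt (real n) = 1 / r" "real n = 1 / r\<^sup>2"
    using n by (simp_all add: r_def power_divide)
  have h0: "0 \<le> h" using z r0 by (simp add: h_def)
  note ex = \<nu>.exponential_moment_expansions[of h B, OF h0 int[folded h_def] le_B[folded h_def]]
  define m1' where "m1' = (\<integral>x. x \<partial>\<nu>)"
  define m2' where "m2' = (\<integral>x. x\<^sup>2 \<partial>\<nu>)"
  define M where "M = mgf \<nu> h"
  define M1 where "M1 = (\<integral>x. exp (h * x) * x \<partial>\<nu>)"
  define M2 where "M2 = (\<integral>x. exp (h * x) * x\<^sup>2 \<partial>\<nu>)"
  define \<epsilon> where "\<epsilon> = (1 + z ^ 3) * r"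
  define \<mu> where "\<mu> = M1 / M"
  define s2 where "s2 = M2 / M - \<mu>\<^sup>2"
  interpret saddle_point_expansion B r z m1' m2' M M1 M2 \<epsilon> \<mu> s2
    by unfold_locales (use B r0 r z m1 m2 ex(5-7) in \<open>simp_all add: m1'_def m2'_def M_def mgf_def M1_def M2_def \<epsilon>_def \<mu>_def s2_def h_def\<close>)
  have M0: "0 < M" using M_near_1 by linarith
  have t: "real_distribution (tilt \<nu> h)" by (rule real_distribution_tilt[OF \<nu> ex(1)])
  interpret t: real_distribution "tilt \<nu> h" by fact
  note tilt = integral_tilt[OF \<nu> ex(1)]
  have ti: "integrable (tilt \<nu> h) (\<lambda>x. x)" "integrable (tilt \<nu> h) (\<lambda>x. x\<^sup>2)" "integrable (tilt \<nu> h) (\<lambda>x. \<bar>x\<bar> ^ 3)"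
    using ex(2-4) by (simp_all add: tilt(2))
  have tm: "(\<integral>x. x \<partial>tilt \<nu> h) = \<mu>" "(\<integral>x. x\<^sup>2 \<partial>tilt \<nu> h) = M2 / M"
    by (simp_all add: tilt(1) \<mu>_def M1_def M2_def M_def)
  have "(\<integral>x. (x - \<mu>)\<^sup>2 \<partial>tilt \<nu> h) = s2"
    unfolding power2_diff s2_def using ti tm t.prob_space by (simp add: power2_eq_square)
  define s where "s = sqrt s2"
  have s: "1 / 2 \<le> s" "s\<^sup>2 = s2" using normal_argument(3) tilted_variance(2) by (simp_all add: s_def)
  define \<rho> where "\<rho> = (\<integral>x. \<bar>x - \<mu>\<bar> ^ 3 \<partial>tilt \<nu> h)"
  have \<rho>: "0 \<le> \<rho>" "\<rho> \<le> 12 * B"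
  proof -
    show "0 \<le> \<rho>" unfolding \<rho>_def by simp
    have "(\<integral>x. \<bar>x\<bar> ^ 3 \<partial>tilt \<nu> h) = (\<integral>x. exp (h * x) * \<bar>x\<bar> ^ 3 \<partial>\<nu>) / M"
      by (simp add: tilt(1) M_def)
    also have "\<dots> \<le> B / (1 / 2)" using ex(8) M_near_1 B by (intro frac_le) auto
    finally have "(\<integral>x. \<bar>x\<bar> ^ 3 \<partial>tilt \<nu> h) \<le> 2 * B" by simp
    moreover have "\<bar>\<mu>\<bar> ^ 3 \<le> 1" using tilted_mean_small by (intro power_le_one) auto
    ultimately show "\<rho> \<le> 12 * B" using t.third_central_moment(2)[OF ti(3), of \<mu>] B unfolding \<rho>_def by linarith
  qed
  let ?K = berry_esseen_const
  define tt where "tt = h * s * sqrt (real n)"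
  define e where "e = tt - sqrt (real n) * \<mu> / s - z"
  define main where "main = M ^ n * exp (- h * (real n * \<mu>)) * (exp (tt\<^sup>2 / 2) * normal_tail (z + e))"
  define P where "P = measure (conv_power \<nu> n) A"
  define Q where "Q = normal_tail z"
  have Q: "0 < Q" unfolding Q_def by (rule normal_tail_pos[OF z(1)])
  have tt: "tt = z * r * sqrt s2 / r" by (simp add: tt_def h_def s_def sqrtn(1))
  have e: "\<bar>e\<bar> \<le> 40 * B\<^sup>2 * ((1 + z\<^sup>2) * r)"
    using normal_argument(2) by (simp add: e_def tt s_def sqrtn(1))
  have "\<bar>P - main\<bar> \<le> M ^ n * (2 * (?K * \<rho> / (s ^ 3 * sqrt (real n))))"
    using tilted_tail_approximation[OF \<nu> h0 ex(1) ti(3) tm(1) _ _ n A, of s] s \<open>(\<integral>x. (x - \<mu>)\<^sup>2 \<partial>tilt \<nu> h) = s2\<close>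
    unfolding P_def main_def e_def tt_def \<rho>_def M_def by simp
  also have "?K * \<rho> / (s ^ 3 * sqrt (real n)) \<le> ?K * (12 * B) / ((1 / 2) ^ 3 * sqrt (real n))"
    using s \<rho> berry_esseen_const_pos n
    by (intro frac_le mult_left_mono mult_right_mono power_mono mult_nonneg_nonneg mult_pos_pos) auto
  also have "\<dots> = 96 * ?K * B * r" unfolding sqrtn(1) by (simp add: field_simps)
  finally have err: "\<bar>P - main\<bar> \<le> M ^ n * (192 * ?K * B * r)"
    using M0 by simp
  have Mn: "M ^ n = exp (ln M / r\<^sup>2)"
  proof -
    have "ln M / r\<^sup>2 = real n * ln M" by (simp add: sqrtn(2))
    then show ?thesis using M0 by (simp add: exp_of_nat_mult)
  qed
  have \<epsilon>2: "B * \<epsilon> \<le> 2 * B" "B\<^sup>2 * \<epsilon> \<le> 2 * B\<^sup>2" "B * \<epsilon> \<le> B\<^sup>2 * \<epsilon>"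
    using \<epsilon>_bounds B B_square_ge by (auto intro!: mult_right_mono)
  have "M ^ n / Q \<le> 3 * exp (10 * B + 3 / 2) * (1 + z)"
  proof -
    have "ln M / r\<^sup>2 \<le> - z\<^sup>2 / 2 + 10 * B"
      using log_mgf \<epsilon>2(1) by (simp add: abs_le_iff)
    then have "M ^ n \<le> exp (- z\<^sup>2 / 2) * exp (10 * B)"
      unfolding Mn by (simp add: exp_add[symmetric])
    also have "exp (- z\<^sup>2 / 2) = sqrt (2 * pi) * std_normal_density z"
      by (simp add: std_normal_density_def)
    also have "\<dots> \<le> 3 * (exp (3 / 2) * (1 + z) * Q)"
    proof (rule mult_mono)
      have "2 * pi \<le> 3\<^sup>2" using pi_less_4 by simp
      then show "sqrt (2 * pi) \<le> 3" by (intro real_le_lsqrt) auto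
    qed (use std_normal_density_le_normal_tail[OF z(1)] in \<open>auto simp: Q_def\<close>)
    finally have "M ^ n \<le> (3 * exp (10 * B + 3 / 2) * (1 + z)) * Q"
      by (simp add: exp_add mult_ac)
    then show ?thesis using Q by (simp add: divide_le_eq)
  qed
  then have "M ^ n / Q * (192 * ?K * B * r) \<le> 3 * exp (10 * B + 3 / 2) * (1 + z) * (192 * ?K * B * r)"
    using berry_esseen_const_pos B r0 by (intro mult_right_mono) auto
  also have "\<dots> = 576 * exp (10 * B + 3 / 2) * ?K * B * (r + z * r)" by (simp add: algebra_simps)
  also have "\<dots> \<le> 576 * exp (10 * B + 3 / 2) * ?K * B * (2 * \<epsilon>)"
    using \<epsilon>_bounds berry_esseen_const_pos B by (intro mult_left_mono) auto
  finally have err2: "\<bar>P - main\<bar> / Q \<le> 1152 * exp (10 * B + 3 / 2) * ?K * B * \<epsilon>"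
    using divide_right_mono[OF err, of Q] Q by simp
  define q where "q = normal_tail (z + e) / Q"
  have K2: "0 \<le> K2" unfolding K2_def by simp
  have q1: "\<bar>q - 1\<bar> \<le> K2 * \<epsilon>"
  proof -
    have ze: "(1 + z) * \<bar>e\<bar> \<le> 160 * B\<^sup>2 * \<epsilon>"
    proof -
      have "(1 + z) * \<bar>e\<bar> \<le> (1 + z) * (40 * B\<^sup>2 * ((1 + z\<^sup>2) * r))"
        using e z by (intro mult_left_mono) auto
      also have "\<dots> = 40 * B\<^sup>2 * (r + z * r + z\<^sup>2 * r + z ^ 3 * r)"
        by (simp add: algebra_simps power2_eq_square power3_eq_cube)
      also have "\<dots> \<le> 40 * B\<^sup>2 * (4 * \<epsilon>)" using \<epsilon>_bounds by (intro mult_left_mono) auto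
      finally show ?thesis by simp
    qed
    have "z * \<bar>e\<bar> \<le> (1 + z) * \<bar>e\<bar>" by (intro mult_right_mono) auto
    then have ze2: "z * \<bar>e\<bar> \<le> 320 * B\<^sup>2" using ze \<epsilon>2(2) by linarith
    have "\<bar>q - 1\<bar> \<le> exp (3 / 2) * ((1 + z) * \<bar>e\<bar>) * exp (z * \<bar>e\<bar>)"
      using normal_tail_ratio[OF z(1), of e] by (simp add: q_def Q_def mult.assoc)
    also have "\<dots> \<le> exp (3 / 2) * (160 * B\<^sup>2 * \<epsilon>) * exp (320 * B\<^sup>2)"
      by (rule mult_mono[OF mult_left_mono[OF ze]]) (use ze2 \<epsilon>_bounds in auto)
    finally show ?thesis by (simp add: K2_def mult_ac)
  qed
  have q2: "\<bar>q\<bar> \<le> 1 + 2 * K2"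
    using q1 mult_left_mono[OF \<epsilon>_bounds(6) K2] by linarith
  \<comment> \<open>the total exponent of the main term: the three parts cancel up to \<open>O(\<epsilon>)\<close>\<close>
  define a where "a = (ln M / r\<^sup>2 + z\<^sup>2 / 2) - z * r * \<mu> / r\<^sup>2 + (tt\<^sup>2 / 2 - z\<^sup>2 / 2)"
  have a: "\<bar>a\<bar> \<le> 27 * B\<^sup>2 * \<epsilon>"
  proof -
    have "\<bar>a\<bar> \<le> \<bar>ln M / r\<^sup>2 + z\<^sup>2 / 2\<bar> + \<bar>z * r * \<mu> / r\<^sup>2\<bar> + \<bar>tt\<^sup>2 / 2 - z\<^sup>2 / 2\<bar>"
    proof -
      have "\<bar>u - v + w\<bar> \<le> \<bar>u\<bar> + \<bar>v\<bar> + \<bar>w\<bar>" for u v w :: real by linarith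
      then show ?thesis unfolding a_def .
    qed
    also have "\<dots> \<le> 5 * B * \<epsilon> + 12 * B * \<epsilon> + 10 * B\<^sup>2 * \<epsilon>"
      by (intro add_mono log_mgf drift normal_argument(1)[folded tt])
    finally show ?thesis using \<epsilon>2(3) by linarith
  qed
  have "main / Q = exp a * q"
  proof -
    have "M ^ n * exp (- h * (real n * \<mu>)) * exp (tt\<^sup>2 / 2) = exp a"
      unfolding Mn exp_add[symmetric] a_def h_def sqrtn(2) by (simp add: algebra_simps)
    then show ?thesis by (simp add: main_def q_def mult.assoc[symmetric])
  qed
  have exp_a: "\<bar>exp a - 1\<bar> \<le> 27 * B\<^sup>2 * exp (54 * B\<^sup>2) * \<epsilon>"
  proof -
    have "\<bar>exp a - 1\<bar> \<le> \<bar>a\<bar> * exp \<bar>a\<bar>" using exp_Taylor_bound[of a 1] by simp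
    also have "\<dots> \<le> (27 * B\<^sup>2 * \<epsilon>) * exp (54 * B\<^sup>2)"
      using a \<epsilon>2(2) \<epsilon>_bounds by (intro mult_mono) auto
    finally show ?thesis by (simp add: mult_ac)
  qed
  have main1: "\<bar>main / Q - 1\<bar> \<le> (27 * B\<^sup>2 * exp (54 * B\<^sup>2) * (1 + 2 * K2) + K2) * \<epsilon>"
  proof -
    have "main / Q - 1 = (exp a - 1) * q + (q - 1)" unfolding \<open>main / Q = exp a * q\<close> by (simp add: algebra_simps)
    then have "\<bar>main / Q - 1\<bar> \<le> \<bar>exp a - 1\<bar> * \<bar>q\<bar> + \<bar>q - 1\<bar>"
      by (metis abs_mult abs_triangle_ineq)
    also have "\<dots> \<le> (27 * B\<^sup>2 * exp (54 * B\<^sup>2) * \<epsilon>) * (1 + 2 * K2) + K2 * \<epsilon>"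
      using exp_a q1 q2 \<epsilon>_bounds by (intro add_mono mult_mono) auto
    finally show ?thesis by (simp add: algebra_simps)
  qed
  have "P / Q - 1 = (P - main) / Q + (main / Q - 1)" by (simp add: diff_divide_distrib)
  then have "\<bar>P / Q - 1\<bar> \<le> \<bar>P - main\<bar> / Q + \<bar>main / Q - 1\<bar>"
    using abs_triangle_ineq[of "(P - main) / Q" "main / Q - 1"] Q by simp
  also have "\<dots> \<le> 1152 * exp (10 * B + 3 / 2) * ?K * B * \<epsilon> + (27 * B\<^sup>2 * exp (54 * B\<^sup>2) * (1 + 2 * K2) + K2) * \<epsilon>"
    by (intro add_mono err2 main1)
  also have "\<dots> = C * \<epsilon>" by (simp only: C_def distrib_right)
  finally show ?thesis by (simp add: P_def Q_def \<epsilon>_def C)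
qed

section \<open>Truncation under a stretched exponential moment\<close>

definition stretched_const :: "real \<Rightarrow> real" where
  "stretched_const t = fact 6 / (t / 2) ^ 6"

lemma stretched_const_pos: "0 < t \<Longrightarrow> 0 < stretched_const t"
  by (simp add: stretched_const_def)

lemma cube_le_stretched_exp:
  assumes "0 < t"
  shows "\<bar>y\<bar> ^ 3 * exp (t / 2 * sqrt \<bar>y\<bar>) \<le> stretched_const t * exp (t * sqrt \<bar>y\<bar>)"
    and "\<bar>y\<bar> ^ 3 \<le> stretched_const t * exp (t * sqrt \<bar>y\<bar>)"
proof -
  define x where "x = sqrt \<bar>y\<bar>"
  have "x ^ 6 = (x\<^sup>2) ^ 3" by (simp flip: power_mult)
  also have "\<dots> = \<bar>y\<bar> ^ 3" by (simp add: x_def)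
  finally have "\<bar>y\<bar> ^ 3 \<le> stretched_const t * exp (t / 2 * x)"
    using power_le_exp[of x "t / 2" 6] assms by (simp add: x_def stretched_const_def)
  then have "\<bar>y\<bar> ^ 3 * exp (t / 2 * x) \<le> stretched_const t * exp (t / 2 * x) * exp (t / 2 * x)"
    by (rule mult_right_mono) simp
  also have "\<dots> = stretched_const t * exp (t * x)" by (simp add: mult.assoc flip: exp_add)
  finally show 1: "\<bar>y\<bar> ^ 3 * exp (t / 2 * sqrt \<bar>y\<bar>) \<le> stretched_const t * exp (t * sqrt \<bar>y\<bar>)" by (simp add: x_def)
  have "\<bar>y\<bar> ^ 3 * 1 \<le> \<bar>y\<bar> ^ 3 * exp (t / 2 * sqrt \<bar>y\<bar>)" using assms by (intro mult_left_mono) auto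
  with 1 show "\<bar>y\<bar> ^ 3 \<le> stretched_const t * exp (t * sqrt \<bar>y\<bar>)" by simp
qed

definition trunc :: "real \<Rightarrow> real \<Rightarrow> real" where
  "trunc L y = (if \<bar>y\<bar> \<le> L then y else 0)"

lemma trunc_measurable [measurable]: "trunc L \<in> borel_measurable borel"
  unfolding trunc_def[abs_def] by measurable

lemma trunc_error:
  assumes "0 < L"
  shows "\<bar>trunc L y - y\<bar> \<le> \<bar>y\<bar> ^ 3 / L\<^sup>2" "\<bar>(trunc L y)\<^sup>2 - y\<^sup>2\<bar> \<le> \<bar>y\<bar> ^ 3 / L"
proof -
  have "\<bar>y\<bar> * L\<^sup>2 \<le> \<bar>y\<bar> ^ 3" "y\<^sup>2 * L \<le> \<bar>y\<bar> ^ 3" if "L < \<bar>y\<bar>"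
  proof -
    have "L\<^sup>2 \<le> \<bar>y\<bar>\<^sup>2" using assms that by (intro power_mono) auto
    then have "\<bar>y\<bar> * L\<^sup>2 \<le> \<bar>y\<bar> * \<bar>y\<bar>\<^sup>2" by (intro mult_left_mono) auto
    then show "\<bar>y\<bar> * L\<^sup>2 \<le> \<bar>y\<bar> ^ 3" by (simp add: power2_eq_square power3_eq_cube)
    have "\<bar>y\<bar>\<^sup>2 * L \<le> \<bar>y\<bar>\<^sup>2 * \<bar>y\<bar>" using that by (intro mult_left_mono) auto
    then show "y\<^sup>2 * L \<le> \<bar>y\<bar> ^ 3" by (simp add: power2_eq_square power3_eq_cube)
  qed
  then show "\<bar>trunc L y - y\<bar> \<le> \<bar>y\<bar> ^ 3 / L\<^sup>2" "\<bar>(trunc L y)\<^sup>2 - y\<^sup>2\<bar> \<le> \<bar>y\<bar> ^ 3 / L"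
    using assms by (auto simp: trunc_def pos_le_divide_eq)
qed

lemma (in prob_space) stretched_exp_moments:
  assumes [measurable]: "Y \<in> borel_measurable M" and t: "0 < t"
    and int: "integrable M (\<lambda>\<omega>. exp (t * sqrt \<bar>Y \<omega>\<bar>))" and B0: "expectation (\<lambda>\<omega>. exp (t * sqrt \<bar>Y \<omega>\<bar>)) \<le> B0"
  shows "integrable M (\<lambda>\<omega>. \<bar>Y \<omega>\<bar> ^ 3)" "expectation (\<lambda>\<omega>. \<bar>Y \<omega>\<bar> ^ 3) \<le> stretched_const t * B0"
    and "integrable M Y" "integrable M (\<lambda>\<omega>. (Y \<omega>)\<^sup>2)"
proof -
  have int': "integrable M (\<lambda>\<omega>. stretched_const t * exp (t * sqrt \<bar>Y \<omega>\<bar>))" using int by simp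
  show int3: "integrable M (\<lambda>\<omega>. \<bar>Y \<omega>\<bar> ^ 3)"
    by (rule Bochner_Integration.integrable_bound[OF int'])
       (use cube_le_stretched_exp(2)[OF t] stretched_const_pos[OF t] in auto)
  have "expectation (\<lambda>\<omega>. \<bar>Y \<omega>\<bar> ^ 3) \<le> expectation (\<lambda>\<omega>. stretched_const t * exp (t * sqrt \<bar>Y \<omega>\<bar>))"
    using int3 int' cube_le_stretched_exp(2)[OF t] by (intro integral_mono) auto
  also have "\<dots> \<le> stretched_const t * B0"
    using B0 stretched_const_pos[OF t] by (simp add: mult_left_mono)
  finally show "expectation (\<lambda>\<omega>. \<bar>Y \<omega>\<bar> ^ 3) \<le> stretched_const t * B0" .
  show "integrable M Y" "integrable M (\<lambda>\<omega>. (Y \<omega>)\<^sup>2)"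
    by (rule integrable_of_third_moment, measurable, rule int3)+
qed

text \<open>
  On \<open>\<bar>y\<bar> \<le> b^4\<close> one has \<open>h \<bar>y\<bar> \<le> h b^2 sqrt \<bar>y\<bar> \<le> (t / 2) sqrt \<bar>y\<bar>\<close>, so that the weighted third moment of
  the truncated variable is bounded independently of \<open>b\<close> and \<open>h\<close>.
\<close>
lemma (in prob_space) truncated_moments:
  assumes Y[measurable]: "Y \<in> borel_measurable M" and t: "0 < t"
    and int: "integrable M (\<lambda>\<omega>. exp (t * sqrt \<bar>Y \<omega>\<bar>))" and B0: "expectation (\<lambda>\<omega>. exp (t * sqrt \<bar>Y \<omega>\<bar>)) \<le> B0"
    and b: "1 \<le> b" and h: "0 \<le> h" "h * b\<^sup>2 \<le> t / 2"
  defines "Z \<equiv> \<lambda>\<omega>. trunc (b ^ 4) (Y \<omega>)"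
  shows "integrable M (\<lambda>\<omega>. exp (h * \<bar>Z \<omega>\<bar>))" "integrable M (\<lambda>\<omega>. \<bar>Z \<omega>\<bar> ^ 3 * exp (h * \<bar>Z \<omega>\<bar>))"
    and "expectation (\<lambda>\<omega>. \<bar>Z \<omega>\<bar> ^ 3 * exp (h * \<bar>Z \<omega>\<bar>)) \<le> stretched_const t * B0"
    and "\<bar>expectation Z - expectation Y\<bar> \<le> stretched_const t * B0 / b ^ 8"
    and "\<bar>expectation (\<lambda>\<omega>. (Z \<omega>)\<^sup>2) - expectation (\<lambda>\<omega>. (Y \<omega>)\<^sup>2)\<bar> \<le> stretched_const t * B0 / b ^ 4"
    and "prob {\<omega>\<in>space M. b ^ 4 < \<bar>Y \<omega>\<bar>} \<le> B0 * exp (- t * b\<^sup>2)"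
proof -
  define L where "L = b ^ 4"
  have L: "0 < L" "sqrt L = b\<^sup>2" "L\<^sup>2 = b ^ 8"
  proof -
    show "0 < L" using b by (simp add: L_def)
    have "L = (b\<^sup>2)\<^sup>2" by (simp add: L_def flip: power_mult)
    then show "sqrt L = b\<^sup>2" by (simp only: real_sqrt_abs) simp
    show "L\<^sup>2 = b ^ 8" by (simp add: L_def flip: power_mult)
  qed
  have [measurable]: "Z \<in> borel_measurable M" unfolding Z_def by measurable
  note mom = stretched_exp_moments[OF Y t int B0]
  have root: "h * \<bar>trunc L y\<bar> \<le> t / 2 * sqrt \<bar>y\<bar>" for y
  proof (cases "\<bar>y\<bar> \<le> L")
    case True
    then have "sqrt \<bar>y\<bar> \<le> b\<^sup>2" unfolding L(2)[symmetric] by simp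
    then have "h * sqrt \<bar>y\<bar> \<le> h * b\<^sup>2" using h by (intro mult_left_mono) auto
    then have "h * sqrt \<bar>y\<bar> \<le> t / 2" using h by linarith
    then have "h * sqrt \<bar>y\<bar> * sqrt \<bar>y\<bar> \<le> t / 2 * sqrt \<bar>y\<bar>" by (intro mult_right_mono) auto
    then show ?thesis using True by (simp add: trunc_def mult.assoc)
  next
    case False then show ?thesis using t by (simp add: trunc_def)
  qed
  have dom0: "exp (h * \<bar>trunc L y\<bar>) \<le> exp (t * sqrt \<bar>y\<bar>)" for y
  proof -
    have "0 \<le> t / 2 * sqrt \<bar>y\<bar>" using t by simp
    then have "h * \<bar>trunc L y\<bar> \<le> t * sqrt \<bar>y\<bar>" using root[of y] by simp
    then show ?thesis by simp
  qed
  have dom: "\<bar>trunc L y\<bar> ^ 3 * exp (h * \<bar>trunc L y\<bar>) \<le> stretched_const t * exp (t * sqrt \<bar>y\<bar>)" for y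
  proof -
    have "\<bar>trunc L y\<bar> ^ 3 * exp (h * \<bar>trunc L y\<bar>) \<le> \<bar>y\<bar> ^ 3 * exp (t / 2 * sqrt \<bar>y\<bar>)"
      using root[of y] by (intro mult_mono power_mono) (auto simp: trunc_def)
    then show ?thesis using cube_le_stretched_exp(1)[OF t, of y] by linarith
  qed
  show "integrable M (\<lambda>\<omega>. exp (h * \<bar>Z \<omega>\<bar>))"
    by (rule Bochner_Integration.integrable_bound[OF int]) (use dom0 in \<open>auto simp: Z_def L_def[symmetric]\<close>)
  have int': "integrable M (\<lambda>\<omega>. stretched_const t * exp (t * sqrt \<bar>Y \<omega>\<bar>))" using int by simp
  show I3: "integrable M (\<lambda>\<omega>. \<bar>Z \<omega>\<bar> ^ 3 * exp (h * \<bar>Z \<omega>\<bar>))"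
    by (rule Bochner_Integration.integrable_bound[OF int'])
       (use dom stretched_const_pos[OF t] in \<open>auto simp: Z_def L_def[symmetric] abs_mult\<close>)
  have "expectation (\<lambda>\<omega>. \<bar>Z \<omega>\<bar> ^ 3 * exp (h * \<bar>Z \<omega>\<bar>)) \<le> expectation (\<lambda>\<omega>. stretched_const t * exp (t * sqrt \<bar>Y \<omega>\<bar>))"
    using I3 int' dom by (intro integral_mono) (auto simp: Z_def L_def[symmetric])
  also have "\<dots> \<le> stretched_const t * B0"
    using B0 stretched_const_pos[OF t] by (simp add: mult_left_mono)
  finally show "expectation (\<lambda>\<omega>. \<bar>Z \<omega>\<bar> ^ 3 * exp (h * \<bar>Z \<omega>\<bar>)) \<le> stretched_const t * B0" .
  have zb: "norm (Z \<omega>) \<le> L" "norm ((Z \<omega>)\<^sup>2) \<le> L\<^sup>2" for \<omega>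
  proof -
    show 1: "norm (Z \<omega>) \<le> L" using L by (auto simp: Z_def trunc_def L_def)
    show "norm ((Z \<omega>)\<^sup>2) \<le> L\<^sup>2" using power_mono[OF 1, of 2] by simp
  qed
  have IZ: "integrable M Z" "integrable M (\<lambda>\<omega>. (Z \<omega>)\<^sup>2)"
    by (rule integrable_const_bound[of _ L], use zb in auto)
       (rule integrable_const_bound[of _ "L\<^sup>2"], use zb in auto)
  have diff: "\<bar>expectation f - expectation g\<bar> \<le> stretched_const t * B0 / c"
    if "integrable M f" "integrable M g" "\<And>\<omega>. \<bar>f \<omega> - g \<omega>\<bar> \<le> \<bar>Y \<omega>\<bar> ^ 3 / c" "0 < c" for f g c
  proof -
    have "\<bar>expectation f - expectation g\<bar> = \<bar>expectation (\<lambda>\<omega>. f \<omega> - g \<omega>)\<bar>" using that by simp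
    also have "\<dots> \<le> expectation (\<lambda>\<omega>. \<bar>f \<omega> - g \<omega>\<bar>)" by (rule integral_abs_bound)
    also have "\<dots> \<le> expectation (\<lambda>\<omega>. \<bar>Y \<omega>\<bar> ^ 3 / c)" using that mom by (intro integral_mono) auto
    also have "\<dots> \<le> stretched_const t * B0 / c" using mom(2) that(4) by (simp add: divide_right_mono)
    finally show ?thesis .
  qed
  show "\<bar>expectation Z - expectation Y\<bar> \<le> stretched_const t * B0 / b ^ 8"
    using IZ mom trunc_error(1)[OF L(1)] L by (intro diff) (auto simp: Z_def L_def[symmetric])
  show "\<bar>expectation (\<lambda>\<omega>. (Z \<omega>)\<^sup>2) - expectation (\<lambda>\<omega>. (Y \<omega>)\<^sup>2)\<bar> \<le> stretched_const t * B0 / b ^ 4"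
    using IZ mom trunc_error(2)[OF L(1)] L by (intro diff) (auto simp: Z_def L_def[symmetric])
  have "prob {\<omega>\<in>space M. b ^ 4 < \<bar>Y \<omega>\<bar>} \<le> prob {\<omega>\<in>space M. exp (t * b\<^sup>2) \<le> exp (t * sqrt \<bar>Y \<omega>\<bar>)}"
  proof (rule finite_measure_mono)
    show "{\<omega>\<in>space M. b ^ 4 < \<bar>Y \<omega>\<bar>} \<subseteq> {\<omega>\<in>space M. exp (t * b\<^sup>2) \<le> exp (t * sqrt \<bar>Y \<omega>\<bar>)}"
      using t real_sqrt_le_mono[of L] L by (auto simp: L_def[symmetric])
  qed measurable
  also have "\<dots> \<le> expectation (\<lambda>\<omega>. exp (t * sqrt \<bar>Y \<omega>\<bar>)) / exp (t * b\<^sup>2)"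
    by (rule integral_Markov_inequality_measure[where A="{}"]) (use int in auto)
  also have "\<dots> \<le> B0 / exp (t * b\<^sup>2)" using B0 by (simp add: divide_right_mono)
  finally show "prob {\<omega>\<in>space M. b ^ 4 < \<bar>Y \<omega>\<bar>} \<le> B0 * exp (- t * b\<^sup>2)" by (simp add: exp_minus field_simps)
qed

lemma (in prob_space) distr_sum_conv_power:
  assumes "indep_vars (\<lambda>_. borel) Y {1..n}" "\<And>i. i \<in> {1..n} \<Longrightarrow> distr M borel (Y i) = \<nu>"
  shows "distr M borel (\<lambda>\<omega>. \<Sum>i=1..n. Y i \<omega>) = conv_power \<nu> n"
  using assms
proof (induction n)
  case 0
  show ?case by (simp add: distr_const)
next
  case (Suc n)
  have ins: "{1..Suc n} = insert (Suc n) {1..n}" by auto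
  have indep: "indep_vars (\<lambda>_. borel) Y (insert (Suc n) {1..n})" using Suc.prems(1) ins by simp
  have rv: "\<And>i. i \<in> {1..Suc n} \<Longrightarrow> random_variable borel (Y i)"
    using Suc.prems(1) unfolding indep_vars_def by auto
  have "distr M borel (\<lambda>\<omega>. \<Sum>i=1..Suc n. Y i \<omega>) = distr M borel (\<lambda>\<omega>. Y (Suc n) \<omega> + (\<Sum>i=1..n. Y i \<omega>))"
    by (intro distr_cong) (auto simp: ins add.commute)
  also have "\<dots> = (distr M borel (Y (Suc n)) \<star> distr M borel (\<lambda>\<omega>. \<Sum>i=1..n. Y i \<omega>))"
    by (rule sum_indep_random_variable[OF indep_vars_sum[OF _ _ indep]]) (use rv in \<open>auto intro!: borel_measurable_sum\<close>)
  also have "\<dots> = conv_power \<nu> (Suc n)"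
  proof -
    have "indep_vars (\<lambda>_. borel) Y {1..n}" using indep by (rule indep_vars_subset) auto
    then show ?thesis using Suc by simp
  qed
  finally show ?case .
qed

lemma (in prob_space) prob_sum_truncation:
  assumes rv: "\<And>i. i \<in> {1..n} \<Longrightarrow> random_variable borel (Y i)" and A[measurable]: "A \<in> sets borel"
    and p: "\<And>i. i \<in> {1..n} \<Longrightarrow> prob {\<omega>\<in>space M. L < \<bar>Y i \<omega>\<bar>} \<le> p"
  shows "\<bar>prob {\<omega>\<in>space M. (\<Sum>i=1..n. Y i \<omega>) \<in> A} - prob {\<omega>\<in>space M. (\<Sum>i=1..n. trunc L (Y i \<omega>)) \<in> A}\<bar> \<le> real n * p"
proof -
  let ?D = "{\<omega>\<in>space M. (\<Sum>i=1..n. Y i \<omega>) \<in> A}"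
  let ?D' = "{\<omega>\<in>space M. (\<Sum>i=1..n. trunc L (Y i \<omega>)) \<in> A}"
  let ?U = "\<Union>i\<in>{1..n}. {\<omega>\<in>space M. L < \<bar>Y i \<omega>\<bar>}"
  have s1: "(\<lambda>\<omega>. \<Sum>i=1..n. Y i \<omega>) \<in> borel_measurable M" by (intro borel_measurable_sum rv)
  have s2: "(\<lambda>\<omega>. \<Sum>i=1..n. trunc L (Y i \<omega>)) \<in> borel_measurable M"
    by (intro borel_measurable_sum measurable_compose[OF rv trunc_measurable])
  have D: "?D \<in> events" "?D' \<in> events"
    using measurable_sets[OF s1 A] measurable_sets[OF s2 A] by (auto simp: vimage_def Int_def conj_commute)
  have Ui: "{\<omega>\<in>space M. L < \<bar>Y i \<omega>\<bar>} \<in> events" if "i \<in> {1..n}" for i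
    using rv[OF that] by measurable
  have U: "?U \<in> events" using Ui by auto
  have "prob ?U \<le> (\<Sum>i\<in>{1..n}. prob {\<omega>\<in>space M. L < \<bar>Y i \<omega>\<bar>})"
    by (rule finite_measure_subadditive_finite) (use Ui in auto)
  also have "\<dots> \<le> (\<Sum>i\<in>{1..n}. p)" by (intro sum_mono p)
  finally have PU: "prob ?U \<le> real n * p" by simp
  have eq: "(\<Sum>i=1..n. trunc L (Y i \<omega>)) = (\<Sum>i=1..n. Y i \<omega>)" if "\<omega> \<in> space M" "\<omega> \<notin> ?U" for \<omega>
    using that by (intro sum.cong) (auto simp: trunc_def not_less)
  have "prob ?D \<le> prob (?D' \<union> ?U)" by (rule finite_measure_mono) (use eq D U in auto)
  also have "\<dots> \<le> prob ?D' + prob ?U" by (rule measure_Un_le) (use D U in auto)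
  finally have 1: "prob ?D \<le> prob ?D' + prob ?U" .
  have "prob ?D' \<le> prob (?D \<union> ?U)" by (rule finite_measure_mono) (use eq D U in auto)
  also have "\<dots> \<le> prob ?D + prob ?U" by (rule measure_Un_le) (use D U in auto)
  finally show ?thesis using 1 PU by linarith
qed

text \<open>
  The normal tail at \<open>z \<le> c0 b\<close> is at least of order \<open>exp (- t b^2 / 2) / b\<close>; half of the exponent \<open>t b^2\<close> of the
  truncation probability is left to absorb all powers of \<open>b\<close>.
\<close>
lemma stretched_tail_negligible:
  assumes t: "0 < t" and c0: "c0 \<le> 1" "c0\<^sup>2 \<le> t" "0 \<le> c0" and b: "1 \<le> b" and z: "0 \<le> z" "z \<le> c0 * b" and B0: "0 \<le> B0"
  shows "b ^ 6 * (B0 * exp (- t * b\<^sup>2)) / normal_tail z \<le> 720 * exp (3 / 2) * B0 / (t / 2) ^ 5 / b ^ 3"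
proof -
  define Q where "Q = normal_tail z"
  have Q: "0 < Q" unfolding Q_def by (rule normal_tail_pos[OF z(1)])
  have zb: "z \<le> b" using z c0 b by (meson mult_left_le_one_le order_trans zero_le_one)
  have "z\<^sup>2 \<le> (c0 * b)\<^sup>2" using z by (intro power_mono) auto
  also have "\<dots> \<le> t * b\<^sup>2" using c0 by (simp add: power_mult_distrib mult_right_mono)
  finally have z2: "exp (- (t / 2 * b\<^sup>2)) \<le> exp (- z\<^sup>2 / 2)" by simp
  have s3: "sqrt (2 * pi) \<le> 3" using pi_less_4 by (intro real_le_lsqrt) auto
  have "exp (- (t / 2 * b\<^sup>2)) \<le> sqrt (2 * pi) * std_normal_density z"
    using z2 by (simp add: std_normal_density_def)
  also have "\<dots> \<le> 3 * (exp (3 / 2) * (1 + z) * Q)"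
    using s3 std_normal_density_le_normal_tail[OF z(1)] by (intro mult_mono) (auto simp: Q_def)
  also have "\<dots> \<le> 3 * (exp (3 / 2) * (2 * b) * Q)"
    using zb b Q by (intro mult_left_mono mult_right_mono) auto
  finally have gQ: "exp (- (t / 2 * b\<^sup>2)) \<le> 6 * exp (3 / 2) * b * Q" by simp
  have "b ^ 10 * exp (- (t / 2 * b\<^sup>2)) \<le> fact 5 / (t / 2) ^ 5"
  proof -
    have "b ^ 10 = (b\<^sup>2) ^ 5" by (simp flip: power_mult)
    also have "\<dots> \<le> fact 5 / (t / 2) ^ 5 * exp (t / 2 * b\<^sup>2)" using t by (intro power_le_exp) auto
    finally show ?thesis by (simp add: exp_minus field_simps)
  qed
  then have pw: "b ^ 10 * exp (- (t / 2 * b\<^sup>2)) \<le> 120 / (t / 2) ^ 5" by (simp add: eval_nat_numeral fact_numeral)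
  have "b ^ 9 * exp (- t * b\<^sup>2) = (b ^ 9 * exp (- (t / 2 * b\<^sup>2))) * exp (- (t / 2 * b\<^sup>2))"
    by (simp add: mult.assoc flip: exp_add)
  also have "\<dots> \<le> (b ^ 9 * exp (- (t / 2 * b\<^sup>2))) * (6 * exp (3 / 2) * b * Q)"
    using gQ b by (intro mult_left_mono) auto
  also have "\<dots> = (b ^ 10 * exp (- (t / 2 * b\<^sup>2))) * (6 * exp (3 / 2) * Q)"
    by (simp add: eval_nat_numeral mult_ac)
  also have "\<dots> \<le> (120 / (t / 2) ^ 5) * (6 * exp (3 / 2) * Q)"
    using Q by (intro mult_right_mono pw) auto
  finally have "b ^ 9 * exp (- t * b\<^sup>2) \<le> (720 * exp (3 / 2) / (t / 2) ^ 5) * Q" by (simp add: mult_ac)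
  then have "B0 * (b ^ 9 * exp (- t * b\<^sup>2)) \<le> B0 * ((720 * exp (3 / 2) / (t / 2) ^ 5) * Q)"
    using B0 by (intro mult_left_mono)
  then have "(b ^ 6 * (B0 * exp (- t * b\<^sup>2))) * b ^ 3 \<le> (720 * exp (3 / 2) * B0 / (t / 2) ^ 5) * Q"
    by (simp add: mult_ac flip: power_add)
  moreover have frac: "x / y \<le> u / v" if "x * v \<le> u * y" "0 < y" "0 < v" for x y u v :: real
    using that by (simp add: field_simps)
  ultimately show ?thesis unfolding Q_def[symmetric] by (rule_tac frac) (use Q b in auto)
qed

definition row_const :: "real \<Rightarrow> real \<Rightarrow> real" where
  "row_const t B = 1 + B + stretched_const t * B"

text \<open>
  Here \<open>b = n^(1/6)\<close> is the scale of the admissible range of \<open>z\<close>.  The truncation changes the first moment by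
  \<open>O(b^(-8))\<close> and the second by \<open>O(b^(-4))\<close>, which is within the tolerances \<open>r^2 = b^(-6)\<close> and \<open>r = b^(-3)\<close>.
\<close>
lemma (in prob_space) row_moderate_deviation:
  assumes n: "1 \<le> n" and b: "b = real n powr (1 / 6)" and r: "r = 1 / sqrt (real n)"
    and indep: "indep_vars (\<lambda>_. borel) Y {1..n}"
    and ident: "\<And>i. i \<in> {1..n} \<Longrightarrow> distr M borel (Y i) = distr M borel (Y 1)"
    and t: "0 < t" and c0: "0 \<le> c0" "c0 \<le> 1" "c0 \<le> t / 2" "c0\<^sup>2 \<le> t"
    and z: "0 \<le> z" "z \<le> c0 * b"
    and int: "integrable M (\<lambda>\<omega>. exp (t * sqrt \<bar>Y 1 \<omega>\<bar>))" and B0: "expectation (\<lambda>\<omega>. exp (t * sqrt \<bar>Y 1 \<omega>\<bar>)) \<le> B0"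
    and m1: "\<bar>expectation (Y 1) + z * r\<bar> \<le> B0 * r\<^sup>2" and m2: "\<bar>expectation (\<lambda>\<omega>. (Y 1 \<omega>)\<^sup>2) - 1\<bar> \<le> B0 * ((1 + z) * r)"
    and small: "b * r \<le> 1 / (100 * (row_const t B0)\<^sup>2)"
    and A: "A = {0<..} \<or> A = {0..}"
  shows "\<bar>prob {\<omega>\<in>space M. (\<Sum>i=1..n. Y i \<omega>) \<in> A} / normal_tail z - 1\<bar>
     \<le> (cramer_const (row_const t B0) + 720 * exp (3 / 2) * B0 / (t / 2) ^ 5) * ((1 + z ^ 3) * r)"
proof -
  define B where "B = row_const t B0"
  have b1: "1 \<le> b" unfolding b using n by (simp add: ge_one_powr_ge_zero)
  have b6: "b ^ 6 = real n" unfolding b using n by (simp add: powr_realpow[symmetric] powr_powr)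
  have b3: "b ^ 3 = sqrt (real n)"
  proof -
    have "(b ^ 3)\<^sup>2 = real n" using b6 by (simp flip: power_mult)
    then show ?thesis using b1 by (metis real_sqrt_unique zero_le_power order_trans zero_le_one)
  qed
  have rb: "r = 1 / b ^ 3" by (simp add: r b3)
  have r0: "0 < r" using b1 by (simp add: rb)
  have n1: "1 \<in> {1..n}" using n by simp
  have rv: "random_variable borel (Y i)" if "i \<in> {1..n}" for i
    using indep that unfolding indep_vars_def by auto
  have B0': "0 \<le> B0"
  proof -
    have "0 \<le> expectation (\<lambda>\<omega>. exp (t * sqrt \<bar>Y 1 \<omega>\<bar>))" by simp
    then show ?thesis using B0 by linarith
  qed
  have sB: "0 \<le> stretched_const t * B0" using stretched_const_pos[OF t] B0' by simp
  have B: "1 \<le> B" "B0 + stretched_const t * B0 \<le> B" unfolding B_def row_const_def using B0' sB by auto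
  \<comment> \<open>up to the truncation level \<open>b^4 = n^(2/3)\<close> one has \<open>z r |y| \<le> c0 sqrt |y| \<le> (t / 2) sqrt |y|\<close>\<close>
  define Z where "Z i \<omega> = trunc (b ^ 4) (Y i \<omega>)" for i \<omega>
  define \<nu> where "\<nu> = distr (distr M borel (Y 1)) borel (trunc (b ^ 4))"
  have distrZ: "distr M borel (Z i) = \<nu>" if "i \<in> {1..n}" for i
    unfolding \<nu>_def ident[OF that, symmetric] using rv[OF that]
    by (subst distr_distr) (auto simp: Z_def[abs_def] comp_def)
  have rvZ: "random_variable borel (Z i)" if "i \<in> {1..n}" for i
    unfolding Z_def[abs_def] by (rule measurable_compose[OF rv[OF that] trunc_measurable])
  have \<nu>: "real_distribution \<nu>" unfolding distrZ[OF n1, symmetric] using rvZ[OF n1] by simp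
  have indepZ: "indep_vars (\<lambda>_. borel) Z {1..n}"
    unfolding Z_def[abs_def] by (rule indep_vars_compose2[OF indep]) simp
  have sumZ: "distr M borel (\<lambda>\<omega>. \<Sum>i=1..n. Z i \<omega>) = conv_power \<nu> n"
    by (rule distr_sum_conv_power[OF indepZ distrZ])
  have Am: "A \<in> sets borel" using A by auto
  have probZ: "measure (conv_power \<nu> n) A = prob {\<omega>\<in>space M. (\<Sum>i=1..n. Z i \<omega>) \<in> A}"
    unfolding sumZ[symmetric] using Am rvZ
    by (subst measure_distr) (auto intro!: borel_measurable_sum arg_cong[where f=prob])
  have int\<nu>: "(\<integral>x. f x \<partial>\<nu>) = expectation (\<lambda>\<omega>. f (Z 1 \<omega>))" "integrable \<nu> f \<longleftrightarrow> integrable M (\<lambda>\<omega>. f (Z 1 \<omega>))"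
    if "f \<in> borel_measurable borel" for f :: "real \<Rightarrow> real"
    unfolding distrZ[OF n1, symmetric] using that rvZ[OF n1] by (simp_all add: integral_distr integrable_distr_eq)
  have zr: "0 \<le> z * r" "z * r * b\<^sup>2 \<le> t / 2"
  proof -
    show "0 \<le> z * r" using z r0 by simp
    have "z * (r * b\<^sup>2) \<le> (c0 * b) * (r * b\<^sup>2)" using z r0 by (intro mult_right_mono) auto
    also have "\<dots> = c0" using b1 by (simp add: rb power2_eq_square power3_eq_cube)
    finally show "z * r * b\<^sup>2 \<le> t / 2" using c0 by (simp add: mult.assoc)
  qed
  note tm = truncated_moments[OF rv[OF n1] t int B0 b1 zr]
  have zb: "z \<le> b" using z c0 b1 by (meson mult_left_le_one_le order_trans zero_le_one)
  have core: "\<bar>measure (conv_power \<nu> n) A / normal_tail z - 1\<bar> \<le> cramer_const B * ((1 + z ^ 3) * r)"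
  proof (rule cramer_unit_variance_bound[OF \<nu> B(1) n r _ z(1) _ _ _ _ _ _ _ A])
    have "1 * r \<le> b * r" using b1 r0 by (intro mult_right_mono) auto
    then show "r \<le> 1 / (100 * B\<^sup>2)" using small unfolding B_def by simp
    have "z * r \<le> b * r" using zb r0 by (intro mult_right_mono) auto
    then show "z * r \<le> 1 / (100 * B\<^sup>2)" using small unfolding B_def by simp
    have "z ^ 3 \<le> b ^ 3" using zb z by (intro power_mono) auto
    then show "z ^ 3 * r \<le> 1" using b1 by (simp add: rb)
    show "integrable \<nu> (\<lambda>x. exp (z * r * \<bar>x\<bar>))" "integrable \<nu> (\<lambda>x. \<bar>x\<bar> ^ 3 * exp (z * r * \<bar>x\<bar>))"
      using tm(1,2) by (subst int\<nu>; simp add: Z_def)+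
    show "(\<integral>x. \<bar>x\<bar> ^ 3 * exp (z * r * \<bar>x\<bar>) \<partial>\<nu>) \<le> B"
      using tm(3) B(2) B0' by (subst int\<nu>) (simp_all add: Z_def)
    have "stretched_const t * B0 / b ^ 8 \<le> stretched_const t * B0 / b ^ 6"
      using sB b1 by (intro divide_left_mono power_increasing mult_pos_pos) auto
    also have "\<dots> = stretched_const t * B0 * r\<^sup>2" by (simp add: rb power_divide flip: power_mult)
    finally have "\<bar>expectation (Z 1) + z * r\<bar> \<le> stretched_const t * B0 * r\<^sup>2 + B0 * r\<^sup>2"
      using tm(4) m1 unfolding Z_def[abs_def] by linarith
    also have "\<dots> \<le> B * r\<^sup>2" using mult_right_mono[OF B(2), of "r\<^sup>2"] by (simp add: algebra_simps)
    finally show "\<bar>(\<integral>x. x \<partial>\<nu>) + z * r\<bar> \<le> B * r\<^sup>2" by (subst int\<nu>) auto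
    have "stretched_const t * B0 / b ^ 4 \<le> stretched_const t * B0 / b ^ 3"
      using sB b1 by (intro divide_left_mono power_increasing mult_pos_pos) auto
    also have "\<dots> = stretched_const t * B0 * r" by (simp add: rb)
    also have "\<dots> \<le> stretched_const t * B0 * ((1 + z) * r)"
      using sB r0 z by (intro mult_left_mono) auto
    finally have "\<bar>expectation (\<lambda>\<omega>. (Z 1 \<omega>)\<^sup>2) - 1\<bar> \<le> stretched_const t * B0 * ((1 + z) * r) + B0 * ((1 + z) * r)"
      using tm(5) m2 unfolding Z_def by linarith
    also have "\<dots> \<le> B * ((1 + z) * r)"
      using mult_right_mono[OF B(2), of "(1 + z) * r"] z r0 by (simp add: algebra_simps)
    finally show "\<bar>(\<integral>x. x\<^sup>2 \<partial>\<nu>) - 1\<bar> \<le> B * ((1 + z) * r)" by (subst int\<nu>) auto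
  qed
  define P where "P = prob {\<omega>\<in>space M. (\<Sum>i=1..n. Y i \<omega>) \<in> A}"
  define P' where "P' = measure (conv_power \<nu> n) A"
  define Q where "Q = normal_tail z"
  have Q: "0 < Q" unfolding Q_def by (rule normal_tail_pos[OF z(1)])
  have "\<bar>P - P'\<bar> \<le> real n * (B0 * exp (- t * b\<^sup>2))"
    unfolding P_def P'_def probZ Z_def
  proof (rule prob_sum_truncation[OF rv Am])
    fix i assume i: "i \<in> {1..n}"
    have "prob {\<omega>\<in>space M. b ^ 4 < \<bar>Y i \<omega>\<bar>} = measure (distr M borel (Y i)) {y. b ^ 4 < \<bar>y\<bar>}"
      using rv[OF i] by (subst measure_distr) (auto intro!: arg_cong[where f=prob])
    also have "\<dots> = measure (distr M borel (Y 1)) {y. b ^ 4 < \<bar>y\<bar>}" by (simp only: ident[OF i])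
    also have "\<dots> = prob {\<omega>\<in>space M. b ^ 4 < \<bar>Y 1 \<omega>\<bar>}"
      using rv[OF n1] by (subst measure_distr) (auto intro!: arg_cong[where f=prob])
    also note tm(6)
    finally show "prob {\<omega>\<in>space M. b ^ 4 < \<bar>Y i \<omega>\<bar>} \<le> B0 * exp (- t * b\<^sup>2)" .
  qed
  then have "\<bar>P - P'\<bar> / Q \<le> b ^ 6 * (B0 * exp (- t * b\<^sup>2)) / Q"
    using Q by (simp add: b6 divide_right_mono)
  also have "\<dots> \<le> 720 * exp (3 / 2) * B0 / (t / 2) ^ 5 / b ^ 3"
    unfolding Q_def by (rule stretched_tail_negligible[OF t c0(2,4,1) b1 z B0'])
  also have "\<dots> = 720 * exp (3 / 2) * B0 / (t / 2) ^ 5 * (1 * r)" by (simp add: rb)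
  also have "\<dots> \<le> 720 * exp (3 / 2) * B0 / (t / 2) ^ 5 * ((1 + z ^ 3) * r)"
    using B0' t r0 z by (intro mult_left_mono mult_right_mono) auto
  finally have tail: "\<bar>P - P'\<bar> / Q \<le> 720 * exp (3 / 2) * B0 / (t / 2) ^ 5 * ((1 + z ^ 3) * r)" .
  have "P / Q - 1 = (P - P') / Q + (P' / Q - 1)" by (simp add: diff_divide_distrib)
  then have "\<bar>P / Q - 1\<bar> \<le> \<bar>P - P'\<bar> / Q + \<bar>P' / Q - 1\<bar>"
    using abs_triangle_ineq[of "(P - P') / Q" "P' / Q - 1"] Q by simp
  also have "\<dots> \<le> 720 * exp (3 / 2) * B0 / (t / 2) ^ 5 * ((1 + z ^ 3) * r) + cramer_const B * ((1 + z ^ 3) * r)"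
    using tail core by (intro add_mono) (auto simp: P'_def Q_def)
  finally show ?thesis by (simp add: P_def Q_def B_def algebra_simps)
qed

section \<open>The influence function and the estimating equation\<close>

lemma half_quadratic_pos: "0 < 1 + x + x\<^sup>2 / 2" for x :: real
proof -
  have "0 \<le> (1 + x)\<^sup>2" by simp
  then have "0 \<le> 1 + 2 * x + x\<^sup>2" by (simp add: power2_sum add.commute add.left_commute)
  then show ?thesis by linarith
qed

text \<open>
  The logarithm of the second-order Taylor polynomial of \<open>exp\<close> has no quadratic term.
\<close>
lemma ln_quadratic_le_cubic:
  fixes x :: real
  shows "ln (1 + x + x\<^sup>2 / 2) \<le> x + 8 * \<bar>x\<bar> ^ 3"
proof -
  note pos = half_quadratic_pos[of x]
  \<comment> \<open>for \<open>x \<ge> 0\<close> already \<open>x\<close> is a bound, for \<open>x \<le> -1\<close> even \<open>x^2 / 2\<close> is cubic; on \<open>[-1, 0]\<close> the Taylor remainder is to be compared with \<open>exp x\<close>,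
    which costs a factor \<open>exp (2 |x|) \<le> exp 2 < 8\<close> and fixes the constant\<close>
  consider "0 \<le> x" | "x \<le> -1" | "-1 \<le> x" "x \<le> 0" by linarith
  then show ?thesis
  proof cases
    case 1
    then have "1 + x + x\<^sup>2 / 2 \<le> exp x" by (rule exp_lower_Taylor_quadratic)
    then have "ln (1 + x + x\<^sup>2 / 2) \<le> x" using pos by (metis ln_exp ln_mono)
    then show ?thesis using 1 by (simp add: add_increasing2)
  next
    case 2
    have "1 * \<bar>x\<bar>\<^sup>2 \<le> \<bar>x\<bar> * \<bar>x\<bar>\<^sup>2" using 2 by (intro mult_right_mono) auto
    then have "x\<^sup>2 \<le> \<bar>x\<bar> ^ 3" by (simp add: power2_eq_square power3_eq_cube)
    moreover have "ln (1 + (x + x\<^sup>2 / 2)) \<le> x + x\<^sup>2 / 2"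
      using pos by (intro ln_add_one_self_le_self2) linarith
    moreover have "0 \<le> \<bar>x\<bar> ^ 3" by simp
    ultimately have "ln (1 + (x + x\<^sup>2 / 2)) \<le> x + 8 * \<bar>x\<bar> ^ 3" by linarith
    then show ?thesis by (simp add: add.assoc)
  next
    case 3
    define y where "y = \<bar>x\<bar>"
    have y: "0 \<le> y" "y \<le> 1" "x = - y" using 3 by (auto simp: y_def)
    have e8: "exp (2 * y) \<le> 8"
    proof -
      have "exp (2 * y) \<le> exp (1 + 1)" using y by simp
      also have "\<dots> = exp 1 * exp (1::real)" by (rule exp_add)
      also have "\<dots> \<le> (272 / 100) * (272 / 100)" using e_less_272 by (intro mult_mono) auto
      finally show ?thesis by simp
    qed
    have "1 + x + x\<^sup>2 / 2 \<le> exp x + y ^ 3 * exp y"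
      using exp_Taylor_bound[of x 3] by (simp add: y_def eval_nat_numeral)
    also have "\<dots> = exp x * (1 + y ^ 3 * exp (2 * y))"
      by (simp add: y(3) distrib_left mult.left_commute flip: exp_add)
    also have "\<dots> \<le> exp x * (1 + y ^ 3 * 8)"
      using e8 y by (intro mult_left_mono add_left_mono) auto
    also have "\<dots> \<le> exp x * exp (8 * y ^ 3)"
      by (intro mult_left_mono) (auto simp: mult.commute)
    finally have "1 + x + x\<^sup>2 / 2 \<le> exp (x + 8 * y ^ 3)" by (simp add: exp_add)
    then have "ln (1 + x + x\<^sup>2 / 2) \<le> x + 8 * y ^ 3" using pos by (metis ln_exp ln_mono)
    then show ?thesis by (simp add: y_def)
  qed
qed

lemma ln_quadratic_le_abs:
  fixes x :: real shows "ln (1 + x + x\<^sup>2 / 2) \<le> \<bar>x\<bar>"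
proof -
  note pos = half_quadratic_pos[of x]
  have "1 + x + x\<^sup>2 / 2 \<le> 1 + \<bar>x\<bar> + \<bar>x\<bar>\<^sup>2 / 2" by simp
  also have "\<dots> \<le> exp \<bar>x\<bar>" by (rule exp_lower_Taylor_quadratic) simp
  finally show ?thesis using pos by (metis ln_exp ln_mono)
qed

lemma ln_quadratic_le_square:
  fixes x :: real shows "ln (1 + x + x\<^sup>2 / 2) \<le> x + x\<^sup>2 / 2"
proof -
  have "-1 < x + x\<^sup>2 / 2" using half_quadratic_pos[of x] by linarith
  then show ?thesis using ln_add_one_self_le_self2[of "x + x\<^sup>2 / 2"] by (simp add: add.assoc)
qed

lemma catoni_influence_bounds:
  assumes "catoni_influence \<phi>"
  shows "\<bar>\<phi> x\<bar> \<le> \<bar>x\<bar>" "\<bar>\<phi> x - x\<bar> \<le> 8 * \<bar>x\<bar> ^ 3" "\<bar>\<phi> x - x\<bar> \<le> x\<^sup>2 / 2"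
proof -
  have up: "\<phi> x \<le> ln (1 + x + x\<^sup>2 / 2)" and low: "- ln (1 + (- x) + (- x)\<^sup>2 / 2) \<le> \<phi> x"
    using assms by (auto simp: catoni_influence_def)
  show "\<bar>\<phi> x\<bar> \<le> \<bar>x\<bar>"
    using up low ln_quadratic_le_abs[of x] ln_quadratic_le_abs[of "- x"] unfolding abs_minus_cancel by linarith
  show "\<bar>\<phi> x - x\<bar> \<le> 8 * \<bar>x\<bar> ^ 3"
    using up low ln_quadratic_le_cubic[of x] ln_quadratic_le_cubic[of "- x"] unfolding abs_minus_cancel by linarith
  show "\<bar>\<phi> x - x\<bar> \<le> x\<^sup>2 / 2"
    using up low ln_quadratic_le_square[of x] ln_quadratic_le_square[of "- x"] unfolding power2_minus by linarith
qed

definition stretched_bound :: "real \<Rightarrow> real \<Rightarrow> real \<Rightarrow> real" where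
  "stretched_bound t0 C1 \<sigma> = C1 * exp (t0 * sqrt \<sigma> * sqrt (2 * C1 / t0\<^sup>2 / \<sigma> + 2))"

text \<open>
  Bounds all moment quantities of the row simultaneously when \<open>a \<le> D / sqrt n\<close>; \<open>S\<close> bounds the third absolute
  moment of the standardized variable.
\<close>
definition catoni_row_bound :: "real \<Rightarrow> real \<Rightarrow> real \<Rightarrow> real \<Rightarrow> real" where
  "catoni_row_bound t0 C1 \<sigma> D = (let W = stretched_bound t0 C1 \<sigma>; S = stretched_const (t0 * sqrt \<sigma>) * W
     in W + 16 * D\<^sup>2 * S + D * S + 2)"

context catoni_setting
begin

\<comment> \<open>keeps \<open>X 1\<close> from being rewritten to \<open>X (Suc 0)\<close>\<close>
declare One_nat_def [simp del]

lemma \<phi>_measurable [measurable]: "\<phi> \<in> borel_measurable borel"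
  using influence unfolding catoni_influence_def by (intro borel_measurable_continuous_onI) auto

lemma \<phi>_mono: "x \<le> y \<Longrightarrow> \<phi> x \<le> \<phi> y"
  using influence unfolding catoni_influence_def by (auto dest: monoD)

lemma X_measurable: "1 \<le> i \<Longrightarrow> random_variable borel (X i)"
  using indep unfolding indep_vars_def by auto

lemma X1_measurable [measurable]: "random_variable borel (X 1)"
  by (rule X_measurable) simp

lemma influence_integrable: "integrable M (\<lambda>\<omega>. \<phi> (c * (X 1 \<omega> - x)))"
proof (rule Bochner_Integration.integrable_bound)
  show "integrable M (\<lambda>\<omega>. c * (X 1 \<omega> - x))" using mean_integrable by simp
  show "AE \<omega> in M. norm (\<phi> (c * (X 1 \<omega> - x))) \<le> norm (c * (X 1 \<omega> - x))"
    unfolding real_norm_def by (intro always_eventually allI catoni_influence_bounds(1) influence)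
qed measurable

lemma standardized_moments:
  "integrable M (\<lambda>\<omega>. (X 1 \<omega> - x) / \<sigma>)" "expectation (\<lambda>\<omega>. (X 1 \<omega> - x) / \<sigma>) = (u - x) / \<sigma>"
  "integrable M (\<lambda>\<omega>. ((X 1 \<omega> - x) / \<sigma>)\<^sup>2)" "expectation (\<lambda>\<omega>. ((X 1 \<omega> - x) / \<sigma>)\<^sup>2) = 1 + ((u - x) / \<sigma>)\<^sup>2"
proof -
  show "integrable M (\<lambda>\<omega>. (X 1 \<omega> - x) / \<sigma>)" using mean_integrable by simp
  show "expectation (\<lambda>\<omega>. (X 1 \<omega> - x) / \<sigma>) = (u - x) / \<sigma>"
    using mean_integrable mean prob_space by simp
  have sq: "(X 1 \<omega> - x)\<^sup>2 = (X 1 \<omega>)\<^sup>2 - 2 * x * X 1 \<omega> + x\<^sup>2" for \<omega> by (simp add: power2_diff)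
  show "integrable M (\<lambda>\<omega>. ((X 1 \<omega> - x) / \<sigma>)\<^sup>2)"
    unfolding power_divide sq using mean_integrable square_integrable by simp
  have "expectation (\<lambda>\<omega>. (X 1 \<omega>)\<^sup>2) = \<sigma>\<^sup>2 + u\<^sup>2"
    using variance_eq[OF mean_integrable square_integrable] variance mean by simp
  then have "expectation (\<lambda>\<omega>. (X 1 \<omega> - x)\<^sup>2) = \<sigma>\<^sup>2 + u\<^sup>2 - 2 * x * u + x\<^sup>2"
    unfolding sq using mean_integrable square_integrable mean prob_space by simp
  also have "\<dots> = \<sigma>\<^sup>2 + (u - x)\<^sup>2" by (simp add: power2_diff)
  finally show "expectation (\<lambda>\<omega>. ((X 1 \<omega> - x) / \<sigma>)\<^sup>2) = 1 + ((u - x) / \<sigma>)\<^sup>2"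
    using sd_pos by (simp add: power_divide add_divide_distrib)
qed

text \<open>
  A first, crude localization of the population zero, by monotonicity in the location parameter.  It bounds the
  moments about \<open>un n\<close>; the sharp distance \<open>O(a^2)\<close> then follows from the cubic bound on \<open>\<phi> x - x\<close>.
\<close>
lemma population_zero_near_mean:
  assumes n: "1 \<le> n" and a: "0 < a" "a < 1" "\<alpha> n = a * inverse \<sigma>"
  shows "\<bar>un n - u\<bar> \<le> \<sigma>"
proof -
  have eq: "\<alpha> n * (y - x) = a * ((y - x) / \<sigma>)" for x y by (simp add: a(3) divide_inverse mult_ac)
  have less: "a\<^sup>2 < a" using a by (simp add: power2_eq_square)
  \<comment> \<open>at distance \<open>\<sigma>\<close> from the mean the linear term \<open>a\<close> beats the quadratic error \<open>a^2\<close>\<close>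
  have "\<not> u + \<sigma> < un n"
  proof
    assume lt: "u + \<sigma> < un n"
    let ?W = "\<lambda>\<omega>. (X 1 \<omega> - (u + \<sigma>)) / \<sigma>"
    have "0 = expectation (\<lambda>\<omega>. \<phi> (\<alpha> n * (X 1 \<omega> - un n)))" using population_zero[OF n] by simp
    also have "\<dots> \<le> expectation (\<lambda>\<omega>. a * ?W \<omega> + a\<^sup>2 / 2 * (?W \<omega>)\<^sup>2)"
    proof (rule integral_mono)
      show "integrable M (\<lambda>\<omega>. a * ?W \<omega> + a\<^sup>2 / 2 * (?W \<omega>)\<^sup>2)"
        by (intro Bochner_Integration.integrable_add integrable_mult_right standardized_moments)
      fix \<omega>
      have "\<phi> (\<alpha> n * (X 1 \<omega> - un n)) \<le> \<phi> (a * ?W \<omega>)"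
        unfolding eq using lt a sd_pos by (intro \<phi>_mono mult_left_mono divide_right_mono) auto
      also have "\<dots> \<le> a * ?W \<omega> + (a * ?W \<omega>)\<^sup>2 / 2"
        using catoni_influence_bounds(3)[OF influence, of "a * ?W \<omega>"] by linarith
      finally show "\<phi> (\<alpha> n * (X 1 \<omega> - un n)) \<le> a * ?W \<omega> + a\<^sup>2 / 2 * (?W \<omega>)\<^sup>2" by (simp only: power_mult_distrib)
    qed (rule influence_integrable)
    also have "\<dots> = a * ((u - (u + \<sigma>)) / \<sigma>) + a\<^sup>2 / 2 * (1 + ((u - (u + \<sigma>)) / \<sigma>)\<^sup>2)"
      by (subst Bochner_Integration.integral_add)
         (intro integrable_mult_right standardized_moments | simp only: integral_mult_right_zero standardized_moments)+
    also have "\<dots> = - a + a\<^sup>2" using sd_pos by simp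
    finally show False using less by simp
  qed
  moreover have "\<not> un n < u - \<sigma>"
  proof
    assume lt: "un n < u - \<sigma>"
    let ?W = "\<lambda>\<omega>. (X 1 \<omega> - (u - \<sigma>)) / \<sigma>"
    have "a - a\<^sup>2 = a * ((u - (u - \<sigma>)) / \<sigma>) - a\<^sup>2 / 2 * (1 + ((u - (u - \<sigma>)) / \<sigma>)\<^sup>2)" using sd_pos by simp
    also have "\<dots> = expectation (\<lambda>\<omega>. a * ?W \<omega> - a\<^sup>2 / 2 * (?W \<omega>)\<^sup>2)"
      by (subst Bochner_Integration.integral_diff)
         (intro integrable_mult_right standardized_moments | simp only: integral_mult_right_zero standardized_moments)+
    also have "\<dots> \<le> expectation (\<lambda>\<omega>. \<phi> (\<alpha> n * (X 1 \<omega> - un n)))"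
    proof (rule integral_mono)
      show "integrable M (\<lambda>\<omega>. a * ?W \<omega> - a\<^sup>2 / 2 * (?W \<omega>)\<^sup>2)"
        by (intro Bochner_Integration.integrable_diff integrable_mult_right standardized_moments)
      fix \<omega>
      have "a * ?W \<omega> - (a * ?W \<omega>)\<^sup>2 / 2 \<le> \<phi> (a * ?W \<omega>)"
        using catoni_influence_bounds(3)[OF influence, of "a * ?W \<omega>"] by linarith
      also have "\<dots> \<le> \<phi> (\<alpha> n * (X 1 \<omega> - un n))"
        unfolding eq using lt a sd_pos by (intro \<phi>_mono mult_left_mono divide_right_mono) auto
      finally show "a * ?W \<omega> - a\<^sup>2 / 2 * (?W \<omega>)\<^sup>2 \<le> \<phi> (\<alpha> n * (X 1 \<omega> - un n))" by (simp only: power_mult_distrib)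
    qed (rule influence_integrable)
    also have "\<dots> = 0" using population_zero[OF n] .
    finally show False using less by simp
  qed
  ultimately show ?thesis by linarith
qed

text \<open>
  By subadditivity of the square root, \<open>sqrt |X - x|\<close> exceeds \<open>sqrt |X|\<close> by a bounded amount.  The bound depends
  on the distribution only through \<open>t0\<close>, \<open>C1\<close> and \<open>\<sigma>\<close>, as \<open>|u|\<close> is itself controlled by the exponential moment.
\<close>
lemma stretched_moment_standardized:
  assumes t0: "0 < t0" and int: "integrable M (\<lambda>\<omega>. exp (t0 * sqrt \<bar>X 1 \<omega>\<bar>))"
    and C1: "expectation (\<lambda>\<omega>. exp (t0 * sqrt \<bar>X 1 \<omega>\<bar>)) \<le> C1" and x: "\<bar>x - u\<bar> \<le> 2 * \<sigma>"
    and f: "f \<in> borel_measurable M" "\<And>\<omega>. \<bar>f \<omega>\<bar> \<le> \<bar>(X 1 \<omega> - x) / \<sigma>\<bar>"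
  shows "integrable M (\<lambda>\<omega>. exp (t0 * sqrt \<sigma> * sqrt \<bar>f \<omega>\<bar>))"
    and "expectation (\<lambda>\<omega>. exp (t0 * sqrt \<sigma> * sqrt \<bar>f \<omega>\<bar>)) \<le> stretched_bound t0 C1 \<sigma>"
proof -
  let ?U = "2 * C1 / t0\<^sup>2"
  have "\<bar>u\<bar> \<le> expectation (\<lambda>\<omega>. \<bar>X 1 \<omega>\<bar>)" unfolding mean[symmetric] by (rule integral_abs_bound)
  also have "\<dots> \<le> expectation (\<lambda>\<omega>. 2 / t0\<^sup>2 * exp (t0 * sqrt \<bar>X 1 \<omega>\<bar>))"
  proof (rule integral_mono)
    show "\<bar>X 1 \<omega>\<bar> \<le> 2 / t0\<^sup>2 * exp (t0 * sqrt \<bar>X 1 \<omega>\<bar>)" for \<omega>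
      using power_le_exp[of "sqrt \<bar>X 1 \<omega>\<bar>" t0 2] t0 by simp
  qed (use int mean_integrable in auto)
  also have "\<dots> \<le> ?U" using C1 t0 by (simp add: divide_right_mono)
  finally have u: "\<bar>u\<bar> \<le> ?U" .
  define k where "k = t0 * sqrt \<sigma> * sqrt (?U / \<sigma> + 2)"
  have bd: "exp (t0 * sqrt \<sigma> * sqrt \<bar>f \<omega>\<bar>) \<le> exp k * exp (t0 * sqrt \<bar>X 1 \<omega>\<bar>)" for \<omega>
  proof -
    have "\<bar>X 1 \<omega> - x\<bar> \<le> \<bar>X 1 \<omega>\<bar> + (?U + 2 * \<sigma>)" using u x by linarith
    then have "\<bar>X 1 \<omega> - x\<bar> / \<sigma> \<le> (\<bar>X 1 \<omega>\<bar> + (?U + 2 * \<sigma>)) / \<sigma>"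
      using sd_pos by (intro divide_right_mono) auto
    moreover have "\<bar>f \<omega>\<bar> \<le> \<bar>X 1 \<omega> - x\<bar> / \<sigma>" using f(2)[of \<omega>] sd_pos by (simp add: abs_divide)
    ultimately have "\<bar>f \<omega>\<bar> \<le> (\<bar>X 1 \<omega>\<bar> + (?U + 2 * \<sigma>)) / \<sigma>" by linarith
    also have "\<dots> = \<bar>X 1 \<omega>\<bar> / \<sigma> + (?U / \<sigma> + 2)" using sd_pos by (simp add: add_divide_distrib)
    finally have "sqrt \<bar>f \<omega>\<bar> \<le> sqrt (\<bar>X 1 \<omega>\<bar> / \<sigma> + (?U / \<sigma> + 2))" by simp
    also have "\<dots> \<le> sqrt (\<bar>X 1 \<omega>\<bar> / \<sigma>) + sqrt (?U / \<sigma> + 2)"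
    proof (rule sqrt_add_le_add_sqrt)
      have "0 \<le> ?U" using u by linarith
      then have "0 \<le> ?U / \<sigma>" using sd_pos by (rule divide_nonneg_pos)
      then show "0 \<le> ?U / \<sigma> + 2" by linarith
    qed (use sd_pos in simp)
    finally have "t0 * sqrt \<sigma> * sqrt \<bar>f \<omega>\<bar> \<le> t0 * sqrt \<sigma> * (sqrt (\<bar>X 1 \<omega>\<bar> / \<sigma>) + sqrt (?U / \<sigma> + 2))"
      using t0 sd_pos by (intro mult_left_mono) auto
    also have "\<dots> = t0 * sqrt \<bar>X 1 \<omega>\<bar> + k"
      using sd_pos by (simp add: k_def distrib_left real_sqrt_divide)
    finally have "exp (t0 * sqrt \<sigma> * sqrt \<bar>f \<omega>\<bar>) \<le> exp (t0 * sqrt \<bar>X 1 \<omega>\<bar> + k)" by simp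
    then show ?thesis by (simp add: exp_add mult.commute)
  qed
  have int': "integrable M (\<lambda>\<omega>. exp k * exp (t0 * sqrt \<bar>X 1 \<omega>\<bar>))" using int by simp
  have [measurable]: "f \<in> borel_measurable M" by fact
  show I: "integrable M (\<lambda>\<omega>. exp (t0 * sqrt \<sigma> * sqrt \<bar>f \<omega>\<bar>))"
    by (rule Bochner_Integration.integrable_bound[OF int']) (use bd in auto)
  have "expectation (\<lambda>\<omega>. exp (t0 * sqrt \<sigma> * sqrt \<bar>f \<omega>\<bar>)) \<le> expectation (\<lambda>\<omega>. exp k * exp (t0 * sqrt \<bar>X 1 \<omega>\<bar>))"
    using I int' bd by (intro integral_mono)
  also have "\<dots> \<le> exp k * C1" using C1 by simp
  finally show "expectation (\<lambda>\<omega>. exp (t0 * sqrt \<sigma> * sqrt \<bar>f \<omega>\<bar>)) \<le> stretched_bound t0 C1 \<sigma>"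
    by (simp add: stretched_bound_def k_def mult.commute)
qed

text \<open>
  \<open>Y\<close> differs from the standardized variable \<open>W = (X 1 - \<theta>) / \<sigma>\<close> by \<open>O(a^2 |W|^3)\<close> and also by \<open>O(a W^2)\<close>.  The first
  bound is used for the mean, where an error \<open>O(r)\<close> would be too large: in the tail it is multiplied by \<open>z / r\<close>.
  The second one suffices for the second moment and requires only third moments.
\<close>
lemma influence_row_moments:
  assumes t0: "0 < t0" and int: "integrable M (\<lambda>\<omega>. exp (t0 * sqrt \<bar>X 1 \<omega>\<bar>))"
    and C1: "expectation (\<lambda>\<omega>. exp (t0 * sqrt \<bar>X 1 \<omega>\<bar>)) \<le> C1"
    and n: "1 \<le> n" and a: "0 < a" "a < 1" "\<alpha> n = a * inverse \<sigma>" "a \<le> D * r"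
    and r: "0 < r" "r \<le> 1" and z: "0 \<le> z" "z * r \<le> 1"
  defines "Y \<equiv> \<lambda>\<omega>. \<phi> (\<alpha> n * (X 1 \<omega> - (un n + z * r * \<sigma>))) / a" and "B \<equiv> catoni_row_bound t0 C1 \<sigma> D"
  shows "integrable M (\<lambda>\<omega>. exp (t0 * sqrt \<sigma> * sqrt \<bar>Y \<omega>\<bar>))" "expectation (\<lambda>\<omega>. exp (t0 * sqrt \<sigma> * sqrt \<bar>Y \<omega>\<bar>)) \<le> B"
    and "\<bar>expectation Y + z * r\<bar> \<le> B * r\<^sup>2" "\<bar>expectation (\<lambda>\<omega>. (Y \<omega>)\<^sup>2) - 1\<bar> \<le> B * ((1 + z) * r)"
proof -
  define t where "t = t0 * sqrt \<sigma>"
  have t: "0 < t" using t0 sd_pos by (simp add: t_def)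
  define W0 where "W0 = stretched_bound t0 C1 \<sigma>"
  define S where "S = stretched_const t * W0"
  have B: "B = W0 + 16 * D\<^sup>2 * S + D * S + 2"
    by (simp add: B_def catoni_row_bound_def Let_def S_def W0_def t_def)
  have "0 \<le> expectation (\<lambda>\<omega>. exp (t0 * sqrt \<bar>X 1 \<omega>\<bar>))" by simp
  then have "0 \<le> C1" using C1 by linarith
  then have W0: "0 \<le> W0" by (simp add: W0_def stretched_bound_def)
  have S: "0 \<le> S" using W0 stretched_const_pos[OF t] by (simp add: S_def)
  have "0 < D * r" using a by linarith
  then have D: "0 < D" using r by (simp add: zero_less_mult_iff)
  have eq: "\<alpha> n * (y - x) = a * ((y - x) / \<sigma>)" for x y by (simp add: a(3) divide_inverse mult_ac)
  define W where "W x \<omega> = (X 1 \<omega> - x) / \<sigma>" for x \<omega>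
  define V where "V x \<omega> = \<phi> (a * W x \<omega>) / a" for x \<omega>
  have [measurable]: "W x \<in> borel_measurable M" "V x \<in> borel_measurable M" for x
    unfolding W_def[abs_def] V_def[abs_def] by measurable
  have V1: "\<bar>V x \<omega>\<bar> \<le> \<bar>W x \<omega>\<bar>" for x \<omega>
    using catoni_influence_bounds(1)[OF influence, of "a * W x \<omega>"] a
    by (simp add: V_def abs_mult pos_divide_le_eq mult.commute)
  have scale: "\<bar>V x \<omega> - W x \<omega>\<bar> = \<bar>\<phi> (a * W x \<omega>) - a * W x \<omega>\<bar> / a" for x \<omega>
  proof -
    have "V x \<omega> - W x \<omega> = (\<phi> (a * W x \<omega>) - a * W x \<omega>) / a" using a by (simp add: V_def field_simps)
    then show ?thesis using a by simp
  qed
  have V3: "\<bar>V x \<omega> - W x \<omega>\<bar> \<le> 8 * a\<^sup>2 * \<bar>W x \<omega>\<bar> ^ 3" for x \<omega>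
    unfolding scale using catoni_influence_bounds(2)[OF influence, of "a * W x \<omega>"] a
    by (simp add: pos_divide_le_eq abs_mult power_mult_distrib power2_eq_square power3_eq_cube mult_ac)
  have V2: "\<bar>V x \<omega> - W x \<omega>\<bar> \<le> a / 2 * (W x \<omega>)\<^sup>2" for x \<omega>
    unfolding scale using catoni_influence_bounds(3)[OF influence, of "a * W x \<omega>"] a
    by (simp add: pos_divide_le_eq power_mult_distrib power2_eq_square mult_ac)
  have near: "\<bar>un n - u\<bar> \<le> \<sigma>" by (rule population_zero_near_mean[OF n a(1-3)])
  define \<theta> where "\<theta> = un n + z * r * \<sigma>"
  have zr\<sigma>: "0 \<le> z * r * \<sigma>" "z * r * \<sigma> \<le> \<sigma>" using z r sd_pos by (auto intro: mult_left_le_one_le)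
  have x1: "\<bar>un n - u\<bar> \<le> 2 * \<sigma>" and x2: "\<bar>\<theta> - u\<bar> \<le> 2 * \<sigma>"
    using near zr\<sigma> sd_pos unfolding \<theta>_def by linarith+
  have W3: "integrable M (\<lambda>\<omega>. \<bar>W x \<omega>\<bar> ^ 3)" "expectation (\<lambda>\<omega>. \<bar>W x \<omega>\<bar> ^ 3) \<le> S" if "\<bar>x - u\<bar> \<le> 2 * \<sigma>" for x
  proof -
    have e: "integrable M (\<lambda>\<omega>. exp (t * sqrt \<bar>W x \<omega>\<bar>))" "expectation (\<lambda>\<omega>. exp (t * sqrt \<bar>W x \<omega>\<bar>)) \<le> W0"
      unfolding t_def W0_def
      by (rule stretched_moment_standardized[OF t0 int C1 that]; simp only: W_def order_refl; measurable)+
    show "integrable M (\<lambda>\<omega>. \<bar>W x \<omega>\<bar> ^ 3)" "expectation (\<lambda>\<omega>. \<bar>W x \<omega>\<bar> ^ 3) \<le> S"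
      unfolding S_def by (rule stretched_exp_moments[OF _ t e], measurable)+
  qed
  have Vint: "integrable M (V x)" for x
    unfolding V_def[abs_def] W_def using influence_integrable[of "a / \<sigma>" x] by simp
  have Wint: "integrable M (W x)" "expectation (W x) = (u - x) / \<sigma>" "integrable M (\<lambda>\<omega>. (W x \<omega>)\<^sup>2)"
    "expectation (\<lambda>\<omega>. (W x \<omega>)\<^sup>2) = 1 + ((u - x) / \<sigma>)\<^sup>2" for x
    unfolding W_def[abs_def] by (rule standardized_moments)+
  have V2int: "integrable M (\<lambda>\<omega>. (V x \<omega>)\<^sup>2)" for x
    by (rule Bochner_Integration.integrable_bound[OF Wint(3)[of x]])
       (use V1 in \<open>auto simp: abs_le_square_iff[symmetric]\<close>)
  have EVW: "\<bar>expectation (V x) - (u - x) / \<sigma>\<bar> \<le> 8 * a\<^sup>2 * S" if "\<bar>x - u\<bar> \<le> 2 * \<sigma>" for x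
  proof -
    have "\<bar>expectation (V x) - expectation (W x)\<bar> = \<bar>expectation (\<lambda>\<omega>. V x \<omega> - W x \<omega>)\<bar>" using Vint Wint by simp
    also have "\<dots> \<le> expectation (\<lambda>\<omega>. \<bar>V x \<omega> - W x \<omega>\<bar>)" by (rule integral_abs_bound)
    also have "\<dots> \<le> expectation (\<lambda>\<omega>. 8 * a\<^sup>2 * \<bar>W x \<omega>\<bar> ^ 3)"
      using V3 W3[OF that] Vint Wint by (intro integral_mono) auto
    also have "\<dots> \<le> 8 * a\<^sup>2 * S" using W3[OF that] by (simp add: mult_left_mono)
    finally show ?thesis by (simp add: Wint)
  qed
  \<comment> \<open>the mean of \<open>V x\<close> vanishes at \<open>x = un n\<close>, so the bound just proved locates \<open>un n\<close> within \<open>O(a^2)\<close> of \<open>u\<close>\<close>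
  have "expectation (V (un n)) = 0"
    unfolding V_def W_def using population_zero[OF n] unfolding eq by simp
  then have uun: "\<bar>(u - un n) / \<sigma>\<bar> \<le> 8 * a\<^sup>2 * S" using EVW[OF x1] by simp
  have YV: "Y = V \<theta>" unfolding Y_def V_def W_def \<theta>_def eq ..
  have ad: "a\<^sup>2 \<le> D\<^sup>2 * r\<^sup>2" using power_mono[OF a(4), of 2] a(1) by (simp add: power_mult_distrib)
  have shift: "(u - \<theta>) / \<sigma> = (u - un n) / \<sigma> - z * r" using sd_pos by (simp add: \<theta>_def field_simps)
  have exp_mom: "integrable M (\<lambda>\<omega>. exp (t0 * sqrt \<sigma> * sqrt \<bar>Y \<omega>\<bar>))" "expectation (\<lambda>\<omega>. exp (t0 * sqrt \<sigma> * sqrt \<bar>Y \<omega>\<bar>)) \<le> W0"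
    unfolding YV W0_def using V1 by (intro stretched_moment_standardized[OF t0 int C1 x2]; simp add: W_def)+
  show "integrable M (\<lambda>\<omega>. exp (t0 * sqrt \<sigma> * sqrt \<bar>Y \<omega>\<bar>))" by (rule exp_mom)
  show "expectation (\<lambda>\<omega>. exp (t0 * sqrt \<sigma> * sqrt \<bar>Y \<omega>\<bar>)) \<le> B"
    using exp_mom(2) S D unfolding B by (simp add: add_increasing2)
  have "\<bar>expectation Y + z * r\<bar> \<le> 16 * a\<^sup>2 * S"
    using EVW[OF x2] uun unfolding YV shift by linarith
  also have "\<dots> \<le> 16 * (D\<^sup>2 * r\<^sup>2) * S" using ad S by (intro mult_right_mono mult_left_mono) auto
  also have "\<dots> = (16 * D\<^sup>2 * S) * r\<^sup>2" by simp
  also have "\<dots> \<le> B * r\<^sup>2" using W0 S D unfolding B by (intro mult_right_mono) auto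
  finally show "\<bar>expectation Y + z * r\<bar> \<le> B * r\<^sup>2" .
  have "\<bar>expectation (\<lambda>\<omega>. (V \<theta> \<omega>)\<^sup>2) - expectation (\<lambda>\<omega>. (W \<theta> \<omega>)\<^sup>2)\<bar> = \<bar>expectation (\<lambda>\<omega>. (V \<theta> \<omega>)\<^sup>2 - (W \<theta> \<omega>)\<^sup>2)\<bar>"
    using V2int Wint by simp
  also have "\<dots> \<le> expectation (\<lambda>\<omega>. \<bar>(V \<theta> \<omega>)\<^sup>2 - (W \<theta> \<omega>)\<^sup>2\<bar>)" by (rule integral_abs_bound)
  also have "\<dots> \<le> expectation (\<lambda>\<omega>. a * \<bar>W \<theta> \<omega>\<bar> ^ 3)"
  proof (rule integral_mono)
    fix \<omega>
    have "(V \<theta> \<omega>)\<^sup>2 - (W \<theta> \<omega>)\<^sup>2 = (V \<theta> \<omega> - W \<theta> \<omega>) * (V \<theta> \<omega> + W \<theta> \<omega>)" by (simp add: power2_eq_square algebra_simps)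
    then have "\<bar>(V \<theta> \<omega>)\<^sup>2 - (W \<theta> \<omega>)\<^sup>2\<bar> = \<bar>V \<theta> \<omega> - W \<theta> \<omega>\<bar> * \<bar>V \<theta> \<omega> + W \<theta> \<omega>\<bar>" by (simp add: abs_mult)
    also have "\<dots> \<le> (a / 2 * (W \<theta> \<omega>)\<^sup>2) * (2 * \<bar>W \<theta> \<omega>\<bar>)"
    proof (rule mult_mono[OF V2])
      show "\<bar>V \<theta> \<omega> + W \<theta> \<omega>\<bar> \<le> 2 * \<bar>W \<theta> \<omega>\<bar>" using V1[of \<theta> \<omega>] by linarith
    qed (use a in auto)
    also have "\<dots> = a * \<bar>W \<theta> \<omega>\<bar> ^ 3"
      by (simp add: power3_eq_cube power2_eq_square abs_mult_self_eq mult.assoc)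
    finally show "\<bar>(V \<theta> \<omega>)\<^sup>2 - (W \<theta> \<omega>)\<^sup>2\<bar> \<le> a * \<bar>W \<theta> \<omega>\<bar> ^ 3" .
  qed (use V2int Wint W3[OF x2] in auto)
  also have "\<dots> \<le> a * S" using W3[OF x2] a by simp
  also have "\<dots> \<le> D * r * S" using a S by (intro mult_right_mono) auto
  finally have sq: "\<bar>expectation (\<lambda>\<omega>. (V \<theta> \<omega>)\<^sup>2) - (1 + ((u - \<theta>) / \<sigma>)\<^sup>2)\<bar> \<le> D * r * S" by (simp add: Wint)
  have "((u - \<theta>) / \<sigma>)\<^sup>2 = \<bar>(u - \<theta>) / \<sigma>\<bar> * \<bar>(u - \<theta>) / \<sigma>\<bar>" by (simp add: power2_eq_square)
  also have "\<dots> \<le> 2 * (8 * a\<^sup>2 * S + z * r)"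
  proof (rule mult_mono)
    have "\<bar>u - \<theta>\<bar> \<le> 2 * \<sigma>" using x2 by linarith
    then show "\<bar>(u - \<theta>) / \<sigma>\<bar> \<le> 2" using sd_pos by (simp add: pos_divide_le_eq)
    have "0 \<le> z * r" using z r by simp
    then show "\<bar>(u - \<theta>) / \<sigma>\<bar> \<le> 8 * a\<^sup>2 * S + z * r" using uun unfolding shift by linarith
  qed auto
  also have "\<dots> \<le> 2 * (8 * (D\<^sup>2 * r\<^sup>2) * S + z * r)"
    using ad S by (intro mult_left_mono add_right_mono mult_right_mono) auto
  also have "\<dots> \<le> 2 * (8 * (D\<^sup>2 * r) * S + z * r)"
  proof -
    have "r * r \<le> 1 * r" using r by (intro mult_right_mono) auto
    then show ?thesis using S by (intro mult_left_mono add_right_mono mult_right_mono) (auto simp: power2_eq_square)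
  qed
  finally have "\<bar>expectation (\<lambda>\<omega>. (Y \<omega>)\<^sup>2) - 1\<bar> \<le> D * r * S + 2 * (8 * (D\<^sup>2 * r) * S + z * r)"
    using sq zero_le_power2[of "(u - \<theta>) / \<sigma>"] unfolding YV by linarith
  also have "\<dots> = (16 * D\<^sup>2 * S + D * S) * r + 2 * (z * r)" by (simp add: algebra_simps)
  also have "\<dots> \<le> B * r + B * (z * r)"
  proof (intro add_mono mult_right_mono)
    have "0 \<le> D * S" "0 \<le> 16 * D\<^sup>2 * S" using S D by auto
    then show "16 * D\<^sup>2 * S + D * S \<le> B" "2 \<le> B" using W0 unfolding B by linarith+
  qed (use z r in auto)
  also have "\<dots> = B * ((1 + z) * r)" by (simp add: algebra_simps)
  finally show "\<bar>expectation (\<lambda>\<omega>. (Y \<omega>)\<^sup>2) - 1\<bar> \<le> B * ((1 + z) * r)" .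
qed

end

section \<open>Moderate deviations of the estimator\<close>

definition catoni_const :: "real \<Rightarrow> real \<Rightarrow> real \<Rightarrow> real \<Rightarrow> real" where
  "catoni_const t0 C1 \<sigma> D = (let t = t0 * sqrt \<sigma>; B = catoni_row_bound t0 C1 \<sigma> D
     in cramer_const (row_const t B) + 720 * exp (3 / 2) * B / (t / 2) ^ 5)"

context catoni_setting
begin

lemma theta_hat_measurable:
  assumes "1 \<le> n" shows "theta_hat X T n \<in> borel_measurable M"
proof -
  have "(\<lambda>\<omega>. \<lambda>i\<in>{1..n}. X i \<omega>) \<in> measurable M (\<Pi>\<^sub>M i\<in>{1..n}. borel)"
    by (rule measurable_restrict) (use X_measurable in auto)
  from measurable_compose[OF this statistic[OF assms]] show ?thesis
    by (simp add: theta_hat_def[abs_def])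
qed

text \<open>
  The estimating function is non-increasing in the location parameter and vanishes at the estimate.  Where it
  has a flat piece at level \<open>0\<close> its sign does not determine the order, hence the two different inequalities.
\<close>
lemma estimator_sandwich:
  assumes n: "1 \<le> n" and "0 \<le> \<alpha> n" and \<omega>: "\<omega> \<in> space M"
  shows "0 < (\<Sum>i=1..n. \<phi> (\<alpha> n * (X i \<omega> - \<theta>))) \<Longrightarrow> \<theta> < theta_hat X T n \<omega>"
    and "\<theta> < theta_hat X T n \<omega> \<Longrightarrow> 0 \<le> (\<Sum>i=1..n. \<phi> (\<alpha> n * (X i \<omega> - \<theta>)))"
proof -
  have anti: "(\<Sum>i=1..n. \<phi> (\<alpha> n * (X i \<omega> - y))) \<le> (\<Sum>i=1..n. \<phi> (\<alpha> n * (X i \<omega> - x)))" if "x \<le> y" for x y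
    using that assms(2) by (intro sum_mono \<phi>_mono mult_left_mono) auto
  note zero = sample_zero[OF n \<omega>]
  show "\<theta> < theta_hat X T n \<omega>" if "0 < (\<Sum>i=1..n. \<phi> (\<alpha> n * (X i \<omega> - \<theta>)))"
    using anti[of "theta_hat X T n \<omega>" \<theta>] zero that by linarith
  show "0 \<le> (\<Sum>i=1..n. \<phi> (\<alpha> n * (X i \<omega> - \<theta>)))" if "\<theta> < theta_hat X T n \<omega>"
    using anti[of \<theta> "theta_hat X T n \<omega>"] zero that by linarith
qed

text \<open>
  The probabilities of \<open>sum > 0\<close> and \<open>sum \<ge> 0\<close> have the same expansion, so the sandwich leaves no room between them.
\<close>
lemma catoni_moderate_deviation:
  assumes t0: "0 < t0" and int: "integrable M (\<lambda>\<omega>. exp (t0 * sqrt \<bar>X 1 \<omega>\<bar>))"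
    and C1: "expectation (\<lambda>\<omega>. exp (t0 * sqrt \<bar>X 1 \<omega>\<bar>)) \<le> C1"
    and n: "1 \<le> n" and b: "b = real n powr (1 / 6)" and r: "r = 1 / sqrt (real n)"
    and a: "0 < a" "a < 1" "\<alpha> n = a * inverse \<sigma>" "a \<le> D * r"
    and c0: "0 \<le> c0" "c0 \<le> 1" "c0 \<le> t0 * sqrt \<sigma> / 2" "c0\<^sup>2 \<le> t0 * sqrt \<sigma>"
    and z: "0 \<le> z" "z \<le> c0 * b"
    and small: "b * r \<le> 1 / (100 * (row_const (t0 * sqrt \<sigma>) (catoni_row_bound t0 C1 \<sigma> D))\<^sup>2)" "b * r \<le> 1"
  shows "\<bar>prob {\<omega>\<in>space M. z < sqrt (real n) * (theta_hat X T n \<omega> - un n) / \<sigma>} / normal_tail z - 1\<bar>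
     \<le> catoni_const t0 C1 \<sigma> D * ((1 + z ^ 3) * r)"
proof -
  define t where "t = t0 * sqrt \<sigma>"
  have t: "0 < t" using t0 sd_pos by (simp add: t_def)
  define B where "B = catoni_row_bound t0 C1 \<sigma> D"
  define \<theta> where "\<theta> = un n + z * r * \<sigma>"
  define Y where "Y i \<omega> = \<phi> (\<alpha> n * (X i \<omega> - \<theta>)) / a" for i \<omega>
  have r0: "0 < r" "r \<le> 1" using n by (auto simp: r)
  have b1: "1 \<le> b" unfolding b using n by (simp add: ge_one_powr_ge_zero)
  have "z \<le> b" using z c0 b1 by (meson mult_left_le_one_le order_trans zero_le_one)
  then have zr: "z * r \<le> 1" using mult_right_mono[of z b r] r0 small by linarith
  have Y1: "Y 1 = (\<lambda>\<omega>. \<phi> (\<alpha> n * (X 1 \<omega> - (un n + z * r * \<sigma>))) / a)" by (simp add: Y_def \<theta>_def fun_eq_iff)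
  have moments: "integrable M (\<lambda>\<omega>. exp (t * sqrt \<bar>Y 1 \<omega>\<bar>))" "expectation (\<lambda>\<omega>. exp (t * sqrt \<bar>Y 1 \<omega>\<bar>)) \<le> B"
    "\<bar>expectation (Y 1) + z * r\<bar> \<le> B * r\<^sup>2" "\<bar>expectation (\<lambda>\<omega>. (Y 1 \<omega>)\<^sup>2) - 1\<bar> \<le> B * ((1 + z) * r)"
    unfolding Y1 t_def B_def by (rule influence_row_moments[OF t0 int C1 n a r0 z(1) zr])+
  have Ym: "(\<lambda>x. \<phi> (\<alpha> n * (x - \<theta>)) / a) \<in> borel_measurable borel" by measurable
  have indepY: "indep_vars (\<lambda>_. borel) Y {1..n}"
    unfolding Y_def[abs_def]
    by (rule indep_vars_compose2[OF indep_vars_subset[OF indep]]) (use Ym in auto)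
  have identY: "distr M borel (Y i) = distr M borel (Y 1)" if "i \<in> {1..n}" for i
  proof -
    have "distr M borel (Y j) = distr (distr M borel (X j)) borel (\<lambda>x. \<phi> (\<alpha> n * (x - \<theta>)) / a)" if "1 \<le> j" for j
      using X_measurable[OF that] Ym by (subst distr_distr) (auto simp: Y_def[abs_def] comp_def)
    then show ?thesis using that ident[of i] by simp
  qed
  define \<epsilon> where "\<epsilon> = catoni_const t0 C1 \<sigma> D * ((1 + z ^ 3) * r)"
  have row: "\<bar>prob {\<omega>\<in>space M. (\<Sum>i=1..n. Y i \<omega>) \<in> A} / normal_tail z - 1\<bar> \<le> \<epsilon>"
    if "A = {0<..} \<or> A = {0..}" for A
  proof -
    have "\<bar>prob {\<omega>\<in>space M. (\<Sum>i=1..n. Y i \<omega>) \<in> A} / normal_tail z - 1\<bar>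
        \<le> (cramer_const (row_const t B) + 720 * exp (3 / 2) * B / (t / 2) ^ 5) * ((1 + z ^ 3) * r)"
      using row_moderate_deviation[OF n b r indepY identY t c0[folded t_def] z moments small(1)[folded t_def B_def] that]
      by simp
    then show ?thesis by (simp add: \<epsilon>_def catoni_const_def Let_def t_def B_def)
  qed
  define P where "P = prob {\<omega>\<in>space M. z < sqrt (real n) * (theta_hat X T n \<omega> - un n) / \<sigma>}"
  have th: "z < sqrt (real n) * (theta_hat X T n \<omega> - un n) / \<sigma> \<longleftrightarrow> \<theta> < theta_hat X T n \<omega>" for \<omega>
    using n sd_pos by (auto simp: \<theta>_def r field_simps)
  have \<alpha>0: "0 \<le> \<alpha> n" using a sd_pos by simp
  have sumY: "(\<Sum>i=1..n. Y i \<omega>) = (\<Sum>i=1..n. \<phi> (\<alpha> n * (X i \<omega> - \<theta>))) / a" for \<omega>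
    by (simp add: Y_def sum_divide_distrib)
  have Ysum: "(\<lambda>\<omega>. \<Sum>i=1..n. Y i \<omega>) \<in> borel_measurable M"
    by (intro borel_measurable_sum) (use indepY in \<open>auto simp: indep_vars_def\<close>)
  have low: "prob {\<omega>\<in>space M. (\<Sum>i=1..n. Y i \<omega>) \<in> {0<..}} \<le> P"
    unfolding P_def th
  proof (rule finite_measure_mono)
    show "{\<omega>\<in>space M. (\<Sum>i=1..n. Y i \<omega>) \<in> {0<..}} \<subseteq> {\<omega>\<in>space M. \<theta> < theta_hat X T n \<omega>}"
      using estimator_sandwich(1)[OF n \<alpha>0] a by (auto simp: sumY zero_less_divide_iff)
    show "{\<omega>\<in>space M. \<theta> < theta_hat X T n \<omega>} \<in> events"
      using theta_hat_measurable[OF n] by measurable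
  qed
  have up: "P \<le> prob {\<omega>\<in>space M. (\<Sum>i=1..n. Y i \<omega>) \<in> {0..}}"
    unfolding P_def th
  proof (rule finite_measure_mono)
    show "{\<omega>\<in>space M. \<theta> < theta_hat X T n \<omega>} \<subseteq> {\<omega>\<in>space M. (\<Sum>i=1..n. Y i \<omega>) \<in> {0..}}"
      using estimator_sandwich(2)[OF n \<alpha>0] a by (auto simp: sumY)
    show "{\<omega>\<in>space M. (\<Sum>i=1..n. Y i \<omega>) \<in> {0..}} \<in> events"
      using Ysum by measurable
  qed
  have Q: "0 < normal_tail z" by (rule normal_tail_pos[OF z(1)])
  have "\<bar>P / normal_tail z - 1\<bar> \<le> \<epsilon>"
  proof -
    have "\<bar>prob {\<omega>\<in>space M. (\<Sum>i=1..n. Y i \<omega>) \<in> {0<..}} / normal_tail z - 1\<bar> \<le> \<epsilon>"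
      "\<bar>prob {\<omega>\<in>space M. (\<Sum>i=1..n. Y i \<omega>) \<in> {0..}} / normal_tail z - 1\<bar> \<le> \<epsilon>"
      by (rule row, simp)+
    moreover have "prob {\<omega>\<in>space M. (\<Sum>i=1..n. Y i \<omega>) \<in> {0<..}} / normal_tail z \<le> P / normal_tail z"
      "P / normal_tail z \<le> prob {\<omega>\<in>space M. (\<Sum>i=1..n. Y i \<omega>) \<in> {0..}} / normal_tail z"
      using Q low up by (intro divide_right_mono; simp)+
    ultimately show ?thesis by linarith
  qed
  then show ?thesis by (simp add: P_def \<epsilon>_def)
qed

end

lemma eventually_scale_admissible:
  assumes lim: "limsup (\<lambda>n. ereal (sqrt (real n) * a n)) \<le> ereal C0" and \<delta>: "0 < \<delta>"
  shows "\<exists>N. \<forall>n\<ge>N. 1 \<le> n \<longrightarrow> a n \<le> (C0 + 1) * (1 / sqrt (real n)) \<and> a n < 1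
     \<and> real n powr (1 / 6) * (1 / sqrt (real n)) \<le> \<delta>"
proof -
  have "limsup (\<lambda>n. ereal (sqrt (real n) * a n)) < ereal (C0 + 1)"
    using lim by (rule le_less_trans) simp
  then have "eventually (\<lambda>n. ereal (sqrt (real n) * a n) < ereal (C0 + 1)) sequentially"
    by (rule Limsup_lessD)
  moreover have "eventually (\<lambda>n. (C0 + 1) * (1 / sqrt (real n)) < 1) sequentially"
  proof -
    have "((\<lambda>n. (C0 + 1) * (1 / sqrt (real n))) \<longlongrightarrow> 0) sequentially" by real_asymp
    then show ?thesis by (rule order_tendstoD) simp
  qed
  moreover have "eventually (\<lambda>n. real n powr (1 / 6) * (1 / sqrt (real n)) < \<delta>) sequentially"
  proof -
    have "((\<lambda>n. real n powr (1 / 6) * (1 / sqrt (real n))) \<longlongrightarrow> 0) sequentially" by real_asymp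
    then show ?thesis using \<delta> by (rule order_tendstoD)
  qed
  ultimately have "eventually (\<lambda>n. 1 \<le> n \<longrightarrow> a n \<le> (C0 + 1) * (1 / sqrt (real n)) \<and> a n < 1
     \<and> real n powr (1 / 6) * (1 / sqrt (real n)) \<le> \<delta>) sequentially"
  proof eventually_elim
    case (elim n)
    show ?case
    proof (intro impI)
      assume n: "1 \<le> n"
      have "a n \<le> (C0 + 1) * (1 / sqrt (real n))"
        using elim(1) n by (simp add: field_simps)
      then show "a n \<le> (C0 + 1) * (1 / sqrt (real n)) \<and> a n < 1
        \<and> real n powr (1 / 6) * (1 / sqrt (real n)) \<le> \<delta>" using elim by auto
    qed
  qed
  then show ?thesis by (simp add: eventually_sequentially)
qed

theorem theorem2p4:
  fixes t0 C0 C1 \<sigma> :: real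
  assumes "0 < t0" and "0 \<le> C0" and "0 < C1" and "0 < \<sigma>"
  shows "\<exists>c0>0. \<exists>C>0. \<forall>a :: nat \<Rightarrow> real.
           (\<forall>n\<ge>1. 0 < a n) \<and> limsup (\<lambda>n. ereal (sqrt (real n) * a n)) \<le> ereal C0 \<longrightarrow>
           (\<exists>n0. \<exists>C'>0. \<forall>(M :: 'a measure) X u \<phi> T un.
              catoni_setting M X u \<sigma> \<phi> (\<lambda>n. a n * inverse \<sigma>) T un \<and>
              integrable M (\<lambda>\<omega>. exp (t0 * sqrt \<bar>X 1 \<omega>\<bar>)) \<and>
              (\<integral>\<omega>. exp (t0 * sqrt \<bar>X 1 \<omega>\<bar>) \<partial>M) < C1 \<longrightarrow>
              (\<forall>n\<ge>1. \<forall>z. 0 \<le> z \<and> z \<le> c0 * real n powr (1 / 6) \<longrightarrow>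
                 \<bar>measure M {\<omega> \<in> space M. sqrt (real n) * (theta_hat X T n \<omega> - un n) / \<sigma> > z}
                    / (1 - std_normal_cdf z) - 1\<bar>
                 \<le> (if n \<ge> n0 then C else C') * (1 + z ^ 3) * real n powr (- 1 / 2)))"
proof -
  define t where "t = t0 * sqrt \<sigma>"
  have t: "0 < t" using assms by (simp add: t_def)
  \<comment> \<open>\<open>c0 \<le> t / 2\<close> keeps the tilt below half the exponential moment, \<open>c0^2 \<le> t\<close> keeps the Gaussian tail
    above the truncation error\<close>
  define c0 where "c0 = min 1 (min (t / 2) (sqrt t))"
  have c0: "0 < c0" "0 \<le> c0" "c0 \<le> 1" "c0 \<le> t0 * sqrt \<sigma> / 2" "c0\<^sup>2 \<le> t0 * sqrt \<sigma>"
  proof -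
    show "0 < c0" "c0 \<le> 1" "c0 \<le> t0 * sqrt \<sigma> / 2" using t by (auto simp: c0_def t_def)
    then show "0 \<le> c0" by simp
    have "c0\<^sup>2 \<le> (sqrt t)\<^sup>2" using \<open>0 < c0\<close> by (intro power_mono) (auto simp: c0_def)
    then show "c0\<^sup>2 \<le> t0 * sqrt \<sigma>" using t by (simp add: t_def)
  qed
  define D where "D = C0 + 1"
  define K where "K = row_const (t0 * sqrt \<sigma>) (catoni_row_bound t0 C1 \<sigma> D)"
  have K: "0 < K"
  proof -
    have W: "0 \<le> stretched_bound t0 C1 \<sigma>" using assms by (simp add: stretched_bound_def)
    have "0 \<le> stretched_const t * stretched_bound t0 C1 \<sigma>" using W stretched_const_pos[OF t] by simp
    moreover have "0 \<le> stretched_const (t0 * sqrt \<sigma>)" using stretched_const_pos[OF t] by (simp add: t_def)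
    ultimately have "0 \<le> catoni_row_bound t0 C1 \<sigma> D"
      using W assms unfolding catoni_row_bound_def Let_def D_def t_def by (intro add_nonneg_nonneg mult_nonneg_nonneg) auto
    then show ?thesis
      unfolding K_def row_const_def t_def[symmetric] using stretched_const_pos[OF t] by (intro add_pos_nonneg mult_nonneg_nonneg) auto
  qed
  define C where "C = max 1 (catoni_const t0 C1 \<sigma> D)"
  have powr_half: "real n powr (- 1 / 2) = 1 / sqrt (real n)" for n
    by (cases "n = 0") (simp_all add: powr_minus_divide powr_half_sqrt[symmetric])
  show ?thesis
  proof (rule exI[of _ c0], rule conjI[OF c0(1)], rule exI[of _ C], intro conjI allI impI)
    show "0 < C" by (simp add: C_def)
    fix a :: "nat \<Rightarrow> real"
    assume a: "(\<forall>n\<ge>1. 0 < a n) \<and> limsup (\<lambda>n. ereal (sqrt (real n) * a n)) \<le> ereal C0"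
    define \<delta> where "\<delta> = min 1 (1 / (100 * K\<^sup>2))"
    have "0 < \<delta>" using K by (auto simp: \<delta>_def)
    from eventually_scale_admissible[OF conjunct2[OF a] this] obtain N where
      N: "\<And>n. N \<le> n \<Longrightarrow> 1 \<le> n \<Longrightarrow> a n \<le> D * (1 / sqrt (real n)) \<and> a n < 1
        \<and> real n powr (1 / 6) * (1 / sqrt (real n)) \<le> \<delta>"
      unfolding D_def by blast
    define Q where "Q = normal_tail (c0 * real N powr (1 / 6))"
    have Q: "0 < Q" unfolding Q_def using c0 by (intro normal_tail_pos) simp
    define C' where "C' = (1 + 1 / Q) * sqrt (real (Suc N))"
    have C': "0 < C'" unfolding C'_def using Q by (intro mult_pos_pos add_pos_pos) auto
    show "\<exists>n0. \<exists>C'>0. \<forall>(M :: 'a measure) X u \<phi> T un.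
              catoni_setting M X u \<sigma> \<phi> (\<lambda>n. a n * inverse \<sigma>) T un \<and>
              integrable M (\<lambda>\<omega>. exp (t0 * sqrt \<bar>X 1 \<omega>\<bar>)) \<and>
              (\<integral>\<omega>. exp (t0 * sqrt \<bar>X 1 \<omega>\<bar>) \<partial>M) < C1 \<longrightarrow>
              (\<forall>n\<ge>1. \<forall>z. 0 \<le> z \<and> z \<le> c0 * real n powr (1 / 6) \<longrightarrow>
                 \<bar>measure M {\<omega> \<in> space M. sqrt (real n) * (theta_hat X T n \<omega> - un n) / \<sigma> > z}
                    / (1 - std_normal_cdf z) - 1\<bar>
                 \<le> (if n \<ge> n0 then C else C') * (1 + z ^ 3) * real n powr (- 1 / 2))"
    proof (rule exI[of _ N], rule exI[of _ C'], intro conjI allI impI C')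
      fix M :: "'a measure" and X u \<phi> T un and n :: nat and z :: real
      assume hyp: "catoni_setting M X u \<sigma> \<phi> (\<lambda>n. a n * inverse \<sigma>) T un \<and>
              integrable M (\<lambda>\<omega>. exp (t0 * sqrt \<bar>X 1 \<omega>\<bar>)) \<and>
              (\<integral>\<omega>. exp (t0 * sqrt \<bar>X 1 \<omega>\<bar>) \<partial>M) < C1"
        and n: "1 \<le> n" and z: "0 \<le> z \<and> z \<le> c0 * real n powr (1 / 6)"
      interpret catoni_setting M X u \<sigma> \<phi> "\<lambda>n. a n * inverse \<sigma>" T un using hyp by blast
      define r where "r = 1 / sqrt (real n)"
      have r: "0 < r" using n by (simp add: r_def)
      have z3: "0 \<le> z ^ 3" using z by simp
      have wr: "0 \<le> (1 + z ^ 3) * r" using z3 r by (intro mult_nonneg_nonneg) auto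
      let ?P = "prob {\<omega> \<in> space M. sqrt (real n) * (theta_hat X T n \<omega> - un n) / \<sigma> > z}"
      have "\<bar>?P / normal_tail z - 1\<bar> \<le> (if n \<ge> N then C else C') * ((1 + z ^ 3) * r)"
      proof (cases "N \<le> n")
        case True
        have "\<bar>?P / normal_tail z - 1\<bar> \<le> catoni_const t0 C1 \<sigma> D * ((1 + z ^ 3) * r)"
        proof (rule catoni_moderate_deviation[OF assms(1) _ _ n refl r_def _ _ _ _ c0(2-5), where a = "a n"])
          show "real n powr (1 / 6) * r \<le> 1" using N[OF True n] by (simp add: \<delta>_def r_def)
          show "real n powr (1 / 6) * r \<le> 1 / (100 * (row_const (t0 * sqrt \<sigma>) (catoni_row_bound t0 C1 \<sigma> D))\<^sup>2)"
            using N[OF True n] by (simp add: \<delta>_def r_def K_def)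
        qed (use hyp n z a N[OF True n] in \<open>auto simp: r_def\<close>)
        also have "\<dots> \<le> C * ((1 + z ^ 3) * r)" using wr by (intro mult_right_mono) (auto simp: C_def)
        finally show ?thesis using True by simp
      next
        \<comment> \<open>for the finitely many small \<open>n\<close> only the size of the Gaussian tail matters\<close>
        case False
        have "real n powr (1 / 6) \<le> real N powr (1 / 6)" using False by (intro powr_mono2) auto
        then have "z \<le> c0 * real N powr (1 / 6)" using z c0 mult_left_mono[of "real n powr (1 / 6)" "real N powr (1 / 6)" c0] by linarith
        then have QQ: "Q \<le> normal_tail z" unfolding Q_def by (rule normal_tail_antimono)
        have "0 \<le> ?P / normal_tail z" using Q QQ by simp
        moreover have "?P / normal_tail z \<le> 1 / Q" using Q QQ by (intro frac_le) auto
        moreover have "\<bar>x - 1\<bar> \<le> (1 + y) * 1" if "0 \<le> x" "x \<le> y" for x y :: real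
          using that by (simp add: abs_le_iff)
        ultimately have "\<bar>?P / normal_tail z - 1\<bar> \<le> (1 + 1 / Q) * 1" by blast
        also have "\<dots> \<le> (1 + 1 / Q) * (sqrt (real (Suc N)) * ((1 + z ^ 3) * r))"
        proof (rule mult_left_mono)
          have "1 \<le> sqrt (real (Suc N)) * r" using False n unfolding r_def by simp
          also have "\<dots> \<le> sqrt (real (Suc N)) * ((1 + z ^ 3) * r)"
            using z3 r by (intro mult_left_mono) (auto simp: mult_le_cancel_right1)
          finally show "1 \<le> sqrt (real (Suc N)) * ((1 + z ^ 3) * r)" .
          show "0 \<le> 1 + 1 / Q" using Q by simp
        qed
        finally show ?thesis using False by (simp add: C'_def mult.assoc)
      qed
      then show "\<bar>?P / (1 - std_normal_cdf z) - 1\<bar> \<le> (if n \<ge> N then C else C') * (1 + z ^ 3) * real n powr (- 1 / 2)"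
        unfolding powr_half r_def[symmetric] normal_tail_def by (simp add: mult.assoc)
    qed
  qed
qed

end
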